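(* Let $G = G(m, p, n)$ with $p \neq m$ or $p=1$. Then $$\bigoplus_{i+k=\ell} \mathcal{SH}_{G(m, p, n)}^{i, k} \neq 0 \quad\Leftrightarrow\quad 0 \leq \ell \leq m \binom{n}{2} + n \left(\frac{m}{p} - 1\right).$$ Moreover, if $\ell = m \binom{n}{2} + n \left(\frac{m}{p} - 1\right)$, then $$\bigoplus_{i+k=\ell} \mathcal{SH}_{G(m, p, n)}^{i, k} = (K + K\,\mathrm{d}) \prod_{1 \leq i < j \leq n} (x_j^m - x_i^m) \cdot (x_1 \cdots x_n)^{m/p - 1},$$ i.e. it is the $K$-span of the polynomial $\Delta=\prod_{1 \leq i < j \leq n} (x_j^m - x_i^m) \cdot (x_1 \cdots x_n)^{m/p - 1}$ and of $\mathrm{d}\Delta$.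
   Context: Setting. $m,p,n\ge1$ are integers with $p\mid m$. $K \subset \mathbb{C}$ is a subfield closed under complex conjugation containing the $m$th roots of unity, $V = K^n$. $G(m,p,n)\subset\mathrm{GL}(V)$ is the group of $n\times n$ matrices with exactly one non-zero entry in each row and column, each such entry an $m$th root of unity, such that the product of the non-zero entries raised to the power $m/p$ is $1$. Differential forms. $x_1,\dots,x_n$ are the coordinate functions on $V$. $K[x_1,\dots,x_n,\theta_1,\dots,\theta_n]$ is the $K$-algebra with $x_ix_j=x_jx_i$, $x_i\theta_j=\theta_jx_i$, $\theta_i\theta_j=-\theta_j\theta_i$ (so $\theta_i^2=0$), bigraded by $x$-degree and $\theta$-degree. $G$ acts by $K$-algebra automorphisms with $\sigma\cdot x_j=\sum_i\overline{\sigma_{ij}}x_i$, $\sigma\cdot\theta_j=\sum_i\overline{\sigma_{ij}}\theta_i$. $\partial_{x_i}$ is the usual ($\theta$-linear) partial derivative; $\partial_{\theta_i}$ is the $x$-linear interior product: for $i_1<\dots<i_k$, $\partial_{\theta_i}\theta_{i_1}\cdots\theta_{i_k}=(-1)^{\ell-1}\theta_{i_1}\cdots\widehat{\theta_{i_\ell}}\cdots\theta_{i_k}$ if $i=i_\ell$, and $0$ otherwise. For $\omega=\sum c_{\alpha,I}x^\alpha\theta_{i_1}\cdots\theta_{i_k}$ put $\partial_\omega=\sum\overline{c_{\alpha,I}}\,\partial_{x_1}^{\alpha_1}\cdots\partial_{x_n}^{\alpha_n}\partial_{\theta_{i_k}}\cdots\partial_{\theta_{i_1}}$. Super harmonics.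 $\mathcal{J}_G$ is the ideal of $K[x_1,\dots,x_n,\theta_1,\dots,\theta_n]$ generated by the bi-homogeneous $G$-invariant elements of positive total degree, and $\mathcal{SH}_G=\{\eta:\partial_\omega\eta=0\text{ for all }\omega\in\mathcal{J}_G\}$; $\mathcal{SH}_G^{i,k}$ is its component of $x$-degree $i$ and $\theta$-degree $k$. Exterior derivative. $\mathrm{d}=\sum_{i=1}^n\partial_{x_i}\theta_i$, where $\theta_i$ denotes left multiplication by $\theta_i$. *)

theory Defs
  imports
    "HOL-Algebra.Algebra"
    "HOL-Library.Poly_Mapping"
    "HOL-Library.FSet"
    "Jordan_Normal_Form.Matrix"
begin

text \<open>Indices are shifted by one: the variables are \<open>x\<^sub>0, \<dots>, x\<^sub>n\<^sub>-\<^sub>1\<close> and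
  \<open>\<theta>\<^sub>0, \<dots>, \<theta>\<^sub>n\<^sub>-\<^sub>1\<close>, in line with the indexing of matrices.\<close>

section \<open>The groups \<open>G(m,p,n)\<close>\<close>

text \<open>The entries lie in every subfield of the complex numbers that contains the \<open>m\<close>-th roots of
  unity, so the field \<open>K\<close> need not be mentioned here.\<close>

definition monomial_group :: "nat \<Rightarrow> nat \<Rightarrow> nat \<Rightarrow> complex mat set" where
  "monomial_group m p n = {\<sigma> \<in> carrier_mat n n.
     (\<forall>i<n. \<exists>!j. j < n \<and> \<sigma> $$ (i, j) \<noteq> 0) \<and>
     (\<forall>j<n. \<exists>!i. i < n \<and> \<sigma> $$ (i, j) \<noteq> 0) \<and>
     (\<forall>i<n. \<forall>j<n. \<sigma> $$ (i, j) \<noteq> 0 \<longrightarrow> (\<sigma> $$ (i, j)) ^ m = 1) \<and>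
     (\<Prod>ij \<in> {(i, j). i < n \<and> j < n \<and> \<sigma> $$ (i, j) \<noteq> 0}. \<sigma> $$ ij) ^ (m div p) = 1}"

definition complex_field :: "complex ring" where
  "complex_field = \<lparr>carrier = UNIV, monoid.mult = (*), monoid.one = 1, ring.zero = 0, ring.add = (+)\<rparr>"

section \<open>Differential forms with polynomial coefficients\<close>

text \<open>The pair \<open>(\<alpha>, I)\<close> stands for \<open>x\<^sup>\<alpha> \<theta>\<^sub>i\<^sub>1 \<cdots> \<theta>\<^sub>i\<^sub>k\<close>, where \<open>i\<^sub>1 < \<dots> < i\<^sub>k\<close> are the
  elements of \<open>I\<close>. A form is the finitely supported family of its coefficients.\<close>

type_synonym monom_form = "(nat \<Rightarrow>\<^sub>0 nat) \<times> nat fset"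
type_synonym form = "monom_form \<Rightarrow>\<^sub>0 complex"

definition scale_form :: "complex \<Rightarrow> form \<Rightarrow> form" where
  "scale_form c f = Poly_Mapping.map ((*) c) f"

definition lin_ext :: "(monom_form \<Rightarrow> form) \<Rightarrow> form \<Rightarrow> form" where
  "lin_ext b f = (\<Sum>k \<in> Poly_Mapping.keys f. scale_form (Poly_Mapping.lookup f k) (b k))"

text \<open>\<open>\<theta>\<^sub>I \<theta>\<^sub>J = theta_sign I J \<cdot> \<theta>\<^sub>I\<^sub>\<union>\<^sub>J\<close>: the sign counts the transpositions needed to sort.\<close>

definition theta_sign :: "nat fset \<Rightarrow> nat fset \<Rightarrow> complex" where
  "theta_sign I J =
     (if I |\<inter>| J = {||} then (- 1) ^ card {(i, j). i |\<in>| I \<and> j |\<in>| J \<and> j < i} else 0)"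

definition form_mult :: "form \<Rightarrow> form \<Rightarrow> form" (infixl \<open>\<star>\<close> 70) where
  "f \<star> g = (\<Sum>(\<alpha>, I) \<in> Poly_Mapping.keys f. \<Sum>(\<beta>, J) \<in> Poly_Mapping.keys g.
     Poly_Mapping.single (\<alpha> + \<beta>, I |\<union>| J)
       (theta_sign I J * Poly_Mapping.lookup f (\<alpha>, I) * Poly_Mapping.lookup g (\<beta>, J)))"

definition one_form :: form where
  "one_form = Poly_Mapping.single (0, {||}) 1"

definition x_form :: "nat \<Rightarrow> form" where
  "x_form i = Poly_Mapping.single (Poly_Mapping.single i 1, {||}) 1"

definition theta_form :: "nat \<Rightarrow> form" where
  "theta_form i = Poly_Mapping.single (0, {|i|}) 1"

definition form_ring :: "complex set \<Rightarrow> nat \<Rightarrow> form ring" where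
  "form_ring K n = \<lparr>
     carrier = {f. (\<forall>k. Poly_Mapping.lookup f k \<in> K) \<and>
       (\<forall>(\<alpha>, I) \<in> Poly_Mapping.keys f. Poly_Mapping.keys \<alpha> \<subseteq> {..<n} \<and> fset I \<subseteq> {..<n})},
     monoid.mult = (\<star>), monoid.one = one_form,
     ring.zero = 0, ring.add = (+)\<rparr>"

definition x_deg :: "(nat \<Rightarrow>\<^sub>0 nat) \<Rightarrow> nat" where
  "x_deg \<alpha> = (\<Sum>i \<in> Poly_Mapping.keys \<alpha>. Poly_Mapping.lookup \<alpha> i)"

text \<open>As usual, zero is bi-homogeneous of every bi-degree.\<close>

definition bihomogeneous :: "nat \<Rightarrow> nat \<Rightarrow> form \<Rightarrow> bool" where
  "bihomogeneous i k f \<longleftrightarrow> (\<forall>(\<alpha>, I) \<in> Poly_Mapping.keys f. x_deg \<alpha> = i \<and> fcard I = k)"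

section \<open>The action of matrices\<close>

definition x_image :: "nat \<Rightarrow> complex mat \<Rightarrow> nat \<Rightarrow> form" where
  "x_image n \<sigma> j = (\<Sum>i<n. scale_form (cnj (\<sigma> $$ (i, j))) (x_form i))"

definition theta_image :: "nat \<Rightarrow> complex mat \<Rightarrow> nat \<Rightarrow> form" where
  "theta_image n \<sigma> j = (\<Sum>i<n. scale_form (cnj (\<sigma> $$ (i, j))) (theta_form i))"

text \<open>The algebra endomorphism with the above values on the generators: a monomial is mapped to
  the product of the images of its factors, in the same order.\<close>

definition form_action :: "nat \<Rightarrow> complex mat \<Rightarrow> form \<Rightarrow> form" where
  "form_action n \<sigma> = lin_ext (\<lambda>(\<alpha>, I). foldr (\<star>)
     (concat (map (\<lambda>j. replicate (Poly_Mapping.lookup \<alpha> j) (x_image n \<sigma> j))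
                  (sorted_list_of_set (Poly_Mapping.keys \<alpha>)))
      @ map (theta_image n \<sigma>) (sorted_list_of_fset I))
     one_form)"

section \<open>Differential operators\<close>

text \<open>Subtraction of exponents is truncated, but then the coefficient vanishes.\<close>

definition partial_x :: "nat \<Rightarrow> form \<Rightarrow> form" where
  "partial_x i = lin_ext (\<lambda>(\<alpha>, I).
     Poly_Mapping.single (\<alpha> - Poly_Mapping.single i 1, I) (of_nat (Poly_Mapping.lookup \<alpha> i)))"

definition partial_theta :: "nat \<Rightarrow> form \<Rightarrow> form" where
  "partial_theta i = lin_ext (\<lambda>(\<alpha>, I).
     if i |\<in>| I then Poly_Mapping.single (\<alpha>, I |-| {|i|}) ((- 1) ^ card {j. j |\<in>| I \<and> j < i})
     else 0)"

text \<open>Note that \<open>foldr\<close> applies the operator of the last index first and \<open>fold\<close> that of the first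
  index, as required by \<open>\<partial>\<^sub>x\<^sub>1\<^sup>\<alpha>\<^sup>1 \<cdots> \<partial>\<^sub>x\<^sub>n\<^sup>\<alpha>\<^sup>n \<partial>\<^sub>\<theta>\<^sub>i\<^sub>k \<cdots> \<partial>\<^sub>\<theta>\<^sub>i\<^sub>1\<close>.\<close>

definition partial_form :: "form \<Rightarrow> form \<Rightarrow> form" where
  "partial_form \<omega> \<eta> = (\<Sum>(\<alpha>, I) \<in> Poly_Mapping.keys \<omega>.
     scale_form (cnj (Poly_Mapping.lookup \<omega> (\<alpha>, I)))
       (foldr (\<lambda>i. partial_x i ^^ Poly_Mapping.lookup \<alpha> i)
              (sorted_list_of_set (Poly_Mapping.keys \<alpha>))
         (fold partial_theta (sorted_list_of_fset I) \<eta>)))"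

definition ext_deriv :: "nat \<Rightarrow> form \<Rightarrow> form" where
  "ext_deriv n f = (\<Sum>i<n. partial_x i (theta_form i \<star> f))"

section \<open>Super harmonics\<close>

definition invariant_forms :: "complex set \<Rightarrow> nat \<Rightarrow> complex mat set \<Rightarrow> form set" where
  "invariant_forms K n G =
     {f \<in> carrier (form_ring K n). \<forall>\<sigma>\<in>G. form_action n \<sigma> f = f}"

definition coinvariant_ideal :: "complex set \<Rightarrow> nat \<Rightarrow> complex mat set \<Rightarrow> form set" where
  "coinvariant_ideal K n G = Idl\<^bsub>form_ring K n\<^esub>
     {f \<in> invariant_forms K n G. \<exists>i k. 0 < i + k \<and> bihomogeneous i k f}"

definition super_harmonics :: "complex set \<Rightarrow> nat \<Rightarrow> complex mat set \<Rightarrow> form set" where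
  "super_harmonics K n G = {\<eta> \<in> carrier (form_ring K n).
     \<forall>\<omega> \<in> coinvariant_ideal K n G. partial_form \<omega> \<eta> = 0}"

definition super_harmonics_bideg ::
    "complex set \<Rightarrow> nat \<Rightarrow> complex mat set \<Rightarrow> nat \<Rightarrow> nat \<Rightarrow> form set" where
  "super_harmonics_bideg K n G i k = {\<eta> \<in> super_harmonics K n G. bihomogeneous i k \<eta>}"

text \<open>The (automatically direct) sum of the components with \<open>i + k = l\<close>.
  For \<open>l < 0\<close> this is the empty sum \<open>{0}\<close>.\<close>

definition super_harmonics_total ::
    "complex set \<Rightarrow> nat \<Rightarrow> complex mat set \<Rightarrow> int \<Rightarrow> form set" where
  "super_harmonics_total K n G l =
     {\<Sum>(i, k) \<in> {(i, k). int i + int k = l}. \<eta> i k | \<eta>.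
        \<forall>i k. int i + int k = l \<longrightarrow> \<eta> i k \<in> super_harmonics_bideg K n G i k}"

section \<open>The top form\<close>

definition var :: "nat \<Rightarrow> (nat \<Rightarrow>\<^sub>0 nat) \<Rightarrow>\<^sub>0 complex" where
  "var i = Poly_Mapping.single (Poly_Mapping.single i 1) 1"

definition form_of_poly :: "((nat \<Rightarrow>\<^sub>0 nat) \<Rightarrow>\<^sub>0 complex) \<Rightarrow> form" where
  "form_of_poly f =
     (\<Sum>\<alpha> \<in> Poly_Mapping.keys f. Poly_Mapping.single (\<alpha>, {||}) (Poly_Mapping.lookup f \<alpha>))"

definition top_poly :: "nat \<Rightarrow> nat \<Rightarrow> nat \<Rightarrow> (nat \<Rightarrow>\<^sub>0 nat) \<Rightarrow>\<^sub>0 complex" where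
  "top_poly m p n =
     (\<Prod>(i, j) \<in> {(i, j). i < j \<and> j < n}. var j ^ m - var i ^ m) * (\<Prod>i<n. var i) ^ (m div p - 1)"

definition top_form :: "nat \<Rightarrow> nat \<Rightarrow> nat \<Rightarrow> form" where
  "top_form m p n = form_of_poly (top_poly m p n)"

section \<open>The forms are a ring\<close>

text \<open>This makes sure that the ideal above is the intended one and not an intersection over the
  empty family.\<close>

lemma sum_single:
  fixes f :: "'a \<Rightarrow>\<^sub>0 'b::comm_monoid_add"
  shows "(\<Sum>k \<in> Poly_Mapping.keys f. Poly_Mapping.single k (Poly_Mapping.lookup f k)) = f"
proof (rule poly_mapping_eqI)
  fix k
  have "Poly_Mapping.lookup (\<Sum>k \<in> Poly_Mapping.keys f.
          Poly_Mapping.single k (Poly_Mapping.lookup f k)) k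
      = (\<Sum>k'\<in>Poly_Mapping.keys f. if k' = k then Poly_Mapping.lookup f k' else 0)"
    by (simp add: lookup_sum lookup_single when_def)
  also have "\<dots> = Poly_Mapping.lookup f k"
    by (simp add: in_keys_iff)
  finally show "Poly_Mapping.lookup (\<Sum>k \<in> Poly_Mapping.keys f.
      Poly_Mapping.single k (Poly_Mapping.lookup f k)) k = Poly_Mapping.lookup f k" .
qed

lemma form_mult_superset:
  assumes "finite A" "finite B" "Poly_Mapping.keys f \<subseteq> A" "Poly_Mapping.keys g \<subseteq> B"
  shows "f \<star> g = (\<Sum>k\<in>A. \<Sum>l\<in>B. Poly_Mapping.single (fst k + fst l, snd k |\<union>| snd l)
     (theta_sign (snd k) (snd l) * Poly_Mapping.lookup f k * Poly_Mapping.lookup g l))"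
proof -
  have "f \<star> g = (\<Sum>k\<in>Poly_Mapping.keys f. \<Sum>l\<in>Poly_Mapping.keys g.
     Poly_Mapping.single (fst k + fst l, snd k |\<union>| snd l)
     (theta_sign (snd k) (snd l) * Poly_Mapping.lookup f k * Poly_Mapping.lookup g l))"
    by (simp add: form_mult_def case_prod_unfold)
  also have "\<dots> = (\<Sum>k\<in>A. \<Sum>l\<in>Poly_Mapping.keys g.
     Poly_Mapping.single (fst k + fst l, snd k |\<union>| snd l)
     (theta_sign (snd k) (snd l) * Poly_Mapping.lookup f k * Poly_Mapping.lookup g l))"
    using assms by (intro sum.mono_neutral_left) (auto simp: in_keys_iff)
  also have "\<dots> = (\<Sum>k\<in>A. \<Sum>l\<in>B. Poly_Mapping.single (fst k + fst l, snd k |\<union>| snd l)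
     (theta_sign (snd k) (snd l) * Poly_Mapping.lookup f k * Poly_Mapping.lookup g l))"
    using assms by (intro sum.cong refl sum.mono_neutral_left) (auto simp: in_keys_iff)
  finally show ?thesis .
qed

lemma form_mult_add_left: "(f + g) \<star> h = f \<star> h + g \<star> h"
proof -
  let ?A = "Poly_Mapping.keys f \<union> Poly_Mapping.keys g"
  have k: "Poly_Mapping.keys (f + g) \<subseteq> ?A" by (rule Poly_Mapping.keys_add)
  show ?thesis
    using k by (simp add: form_mult_superset[of ?A "Poly_Mapping.keys h"] lookup_add algebra_simps
        Poly_Mapping.single_add sum.distrib)
qed

lemma form_mult_add_right: "h \<star> (f + g) = h \<star> f + h \<star> g"
proof -
  let ?A = "Poly_Mapping.keys f \<union> Poly_Mapping.keys g"
  have k: "Poly_Mapping.keys (f + g) \<subseteq> ?A" by (rule Poly_Mapping.keys_add)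
  show ?thesis
    using k by (simp add: form_mult_superset[of "Poly_Mapping.keys h" ?A] lookup_add algebra_simps
        Poly_Mapping.single_add sum.distrib)
qed

lemma form_mult_0_left [simp]: "0 \<star> f = 0" and form_mult_0_right [simp]: "f \<star> 0 = 0"
  by (simp_all add: form_mult_def)

lemma form_mult_sum_left: "sum F A \<star> g = (\<Sum>a\<in>A. F a \<star> g)"
  by (induction A rule: infinite_finite_induct) (auto simp: form_mult_add_left)

lemma form_mult_sum_right: "g \<star> sum F A = (\<Sum>a\<in>A. g \<star> F a)"
  by (induction A rule: infinite_finite_induct) (auto simp: form_mult_add_right)

lemma form_mult_single: "Poly_Mapping.single (\<alpha>, I) a \<star> Poly_Mapping.single (\<beta>, J) b
    = Poly_Mapping.single (\<alpha> + \<beta>, I |\<union>| J) (theta_sign I J * a * b)"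
  by (subst form_mult_superset[of "{(\<alpha>, I)}" "{(\<beta>, J)}"]) auto

lemma theta_sign_empty [simp]: "theta_sign {||} J = 1" "theta_sign I {||} = 1"
  by (simp_all add: theta_sign_def)

lemma finite_inversions: "finite {(i, j). i |\<in>| I \<and> j |\<in>| J \<and> j < (i::nat)}"
  by (rule finite_subset[of _ "fset I \<times> fset J"]) auto

lemma theta_sign_union_left:
  assumes "I |\<inter>| J = {||}"
  shows "theta_sign (I |\<union>| J) L = theta_sign I L * theta_sign J L"
proof -
  have "{(i, j). i |\<in>| I |\<union>| J \<and> j |\<in>| L \<and> j < i} =
      {(i, j). i |\<in>| I \<and> j |\<in>| L \<and> j < i} \<union> {(i, j). i |\<in>| J \<and> j |\<in>| L \<and> j < i}" by auto
  moreover have "{(i, j). i |\<in>| I \<and> j |\<in>| L \<and> j < i} \<inter> {(i, j). i |\<in>| J \<and> j |\<in>| L \<and> j < i} = {}"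
    using assms by auto
  ultimately have "card {(i, j). i |\<in>| I |\<union>| J \<and> j |\<in>| L \<and> j < i} =
      card {(i, j). i |\<in>| I \<and> j |\<in>| L \<and> j < i} + card {(i, j). i |\<in>| J \<and> j |\<in>| L \<and> j < i}"
    by (simp add: card_Un_disjoint finite_inversions)
  moreover have "(I |\<union>| J) |\<inter>| L = {||} \<longleftrightarrow> I |\<inter>| L = {||} \<and> J |\<inter>| L = {||}" by auto
  ultimately show ?thesis unfolding theta_sign_def by (simp add: power_add)
qed

lemma theta_sign_union_right:
  assumes "J |\<inter>| L = {||}"
  shows "theta_sign I (J |\<union>| L) = theta_sign I J * theta_sign I L"
proof -
  have "{(i, j). i |\<in>| I \<and> j |\<in>| J |\<union>| L \<and> j < i} =
      {(i, j). i |\<in>| I \<and> j |\<in>| J \<and> j < i} \<union> {(i, j). i |\<in>| I \<and> j |\<in>| L \<and> j < i}" by auto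
  moreover have "{(i, j). i |\<in>| I \<and> j |\<in>| J \<and> j < i} \<inter> {(i, j). i |\<in>| I \<and> j |\<in>| L \<and> j < i} = {}"
    using assms by auto
  ultimately have "card {(i, j). i |\<in>| I \<and> j |\<in>| J |\<union>| L \<and> j < i} =
      card {(i, j). i |\<in>| I \<and> j |\<in>| J \<and> j < i} + card {(i, j). i |\<in>| I \<and> j |\<in>| L \<and> j < i}"
    by (simp add: card_Un_disjoint finite_inversions)
  moreover have "I |\<inter>| (J |\<union>| L) = {||} \<longleftrightarrow> I |\<inter>| J = {||} \<and> I |\<inter>| L = {||}" by auto
  ultimately show ?thesis unfolding theta_sign_def by (simp add: power_add)
qed

lemma theta_sign_cocycle:
  "theta_sign I J * theta_sign (I |\<union>| J) L = theta_sign J L * theta_sign I (J |\<union>| L)"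
proof -
  have 0: "theta_sign I J = 0" if "I |\<inter>| J \<noteq> {||}" for I J using that by (simp add: theta_sign_def)
  consider "I |\<inter>| J = {||}" "J |\<inter>| L = {||}" | "I |\<inter>| J \<noteq> {||}" | "J |\<inter>| L \<noteq> {||}" by blast
  then show ?thesis
  proof cases
    case 1 then show ?thesis by (simp add: theta_sign_union_left theta_sign_union_right)
  next
    case 2 then have "I |\<inter>| (J |\<union>| L) \<noteq> {||}" by auto
    with 2 show ?thesis by (simp add: 0)
  next
    case 3 then have "(I |\<union>| J) |\<inter>| L \<noteq> {||}" by auto
    with 3 show ?thesis by (simp add: 0)
  qed
qed

lemma form_mult_assoc: "(f \<star> g) \<star> h = f \<star> (g \<star> h)"
proof -
  have *: "(Poly_Mapping.single k a \<star> Poly_Mapping.single l b) \<star> Poly_Mapping.single r c =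
     Poly_Mapping.single k a \<star> (Poly_Mapping.single l b \<star> Poly_Mapping.single r c)"
    for k l r :: monom_form and a b c
  proof (cases k; cases l; cases r)
    fix \<alpha> I \<beta> J \<gamma> L assume "k = (\<alpha>, I)" "l = (\<beta>, J)" "r = (\<gamma>, L)"
    moreover have "theta_sign (I |\<union>| J) L * (theta_sign I J * a * b) * c =
        theta_sign I (J |\<union>| L) * a * (theta_sign J L * b * c)"
      using arg_cong[OF theta_sign_cocycle[of I J L], of "\<lambda>z. z * (a * b * c)"]
      by (simp only: ac_simps)
    ultimately show ?thesis by (simp only: form_mult_single add.assoc funion_assoc)
  qed
  let ?e = "\<lambda>f :: form. \<Sum>k \<in> Poly_Mapping.keys f. Poly_Mapping.single k (Poly_Mapping.lookup f k)"
  have "(?e f \<star> ?e g) \<star> ?e h = ?e f \<star> (?e g \<star> ?e h)"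
    unfolding form_mult_sum_left form_mult_sum_right * ..
  then show ?thesis unfolding sum_single .
qed

lemma form_mult_one_left: "one_form \<star> f = f" and form_mult_one_right: "f \<star> one_form = f"
proof -
  have 1: "one_form \<star> Poly_Mapping.single k a = Poly_Mapping.single k a"
    and 2: "Poly_Mapping.single k a \<star> one_form = Poly_Mapping.single k a" for k :: monom_form and a
    by (cases k; simp add: one_form_def form_mult_single)+
  let ?e = "\<Sum>k \<in> Poly_Mapping.keys f. Poly_Mapping.single k (Poly_Mapping.lookup f k)"
  have "one_form \<star> ?e = ?e" "?e \<star> one_form = ?e"
    unfolding form_mult_sum_left form_mult_sum_right 1 2 by simp_all
  then show "one_form \<star> f = f" "f \<star> one_form = f" unfolding sum_single by simp_all
qed

lemma x_form_commute: "x_form i \<star> x_form j = x_form j \<star> x_form i"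
  by (simp add: x_form_def form_mult_single add.commute)

lemma x_theta_commute: "x_form i \<star> theta_form j = theta_form j \<star> x_form i"
  by (simp add: x_form_def theta_form_def form_mult_single)

lemma theta_form_anticommute: "theta_form i \<star> theta_form j = - (theta_form j \<star> theta_form i)"
proof -
  have "{(a, b). a = i \<and> b = j \<and> b < a} = (if j < i then {(i, j)} else {})" for i j :: nat by auto
  then show ?thesis
    by (auto simp: theta_form_def form_mult_single theta_sign_def finsert_commute
        simp flip: Poly_Mapping.single_uminus)
qed

lemma ring_complex_field: "ring complex_field"
proof (rule ringI)
  show "abelian_group complex_field"
    by (rule abelian_groupI)
      (auto simp: complex_field_def algebra_simps intro!: exI[of _ "- x" for x])
  show "Group.monoid complex_field"
    by (rule Group.monoidI) (auto simp: complex_field_def)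
qed (auto simp: complex_field_def algebra_simps)

lemma subfield_complex_closed:
  assumes "subfield K complex_field"
  shows "0 \<in> K" "1 \<in> K" "a \<in> K \<Longrightarrow> - a \<in> K"
    "a \<in> K \<Longrightarrow> b \<in> K \<Longrightarrow> a + b \<in> K" "a \<in> K \<Longrightarrow> b \<in> K \<Longrightarrow> a * b \<in> K"
proof -
  note [simp] = complex_field_def
  interpret R: ring complex_field by (rule ring_complex_field)
  have s: "subring K complex_field"
    using assms by (intro subcring.axioms(1) subdomain.axioms(1) subfield.axioms(1))
  note c = subringE[OF s]
  show "0 \<in> K" "1 \<in> K" "a \<in> K \<Longrightarrow> b \<in> K \<Longrightarrow> a + b \<in> K" "a \<in> K \<Longrightarrow> b \<in> K \<Longrightarrow> a * b \<in> K"
    using c(2,3) c(6)[of a b] c(7)[of a b] by simp_all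
  assume a: "a \<in> K"
  have "\<ominus>\<^bsub>complex_field\<^esub> a = - a"
    by (rule R.minus_equality) simp_all
  with c(5)[OF a] show "- a \<in> K" by simp
qed

lemma ring_form_ring:
  assumes "subfield K complex_field"
  shows "ring (form_ring K n)"
proof -
  note K = subfield_complex_closed[OF assms]
  let ?C = "carrier (form_ring K n)"
  have Ksum: "sum F A \<in> K" if "\<And>a. a \<in> A \<Longrightarrow> F a \<in> K" for F :: "'a \<Rightarrow> complex" and A
    using that by (induction A rule: infinite_finite_induct) (auto simp: K)
  have C: "f \<in> ?C \<longleftrightarrow> (\<forall>k. Poly_Mapping.lookup f k \<in> K) \<and> (\<forall>k. Poly_Mapping.lookup f k \<noteq> 0 \<longrightarrow>
      Poly_Mapping.keys (fst k) \<subseteq> {..<n} \<and> fset (snd k) \<subseteq> {..<n})" for f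
    by (simp add: form_ring_def in_keys_iff case_prod_unfold Ball_def)
  have add: "f + g \<in> ?C" if "f \<in> ?C" "g \<in> ?C" for f g
    using that unfolding C lookup_add by (metis K(4) add_0)
  have zero: "0 \<in> ?C" by (simp add: C K)
  have one: "one_form \<in> ?C" by (auto simp: C K one_form_def lookup_single when_def)
  have neg: "- f \<in> ?C" if "f \<in> ?C" for f using that by (auto simp: C K)
  have sumC: "sum F A \<in> ?C" if "\<And>a. a \<in> A \<Longrightarrow> F a \<in> ?C" for F :: "monom_form \<Rightarrow> form" and A
    using that by (induction A rule: infinite_finite_induct) (auto simp: zero add)
  have sgn: "theta_sign I J \<in> K" for I J
  proof -
    have "(- 1 :: complex) ^ r \<in> K" for r by (induction r) (auto simp: K)
    then show ?thesis by (simp add: theta_sign_def K)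
  qed
  have mult: "f \<star> g \<in> ?C" if f: "f \<in> ?C" and g: "g \<in> ?C" for f g
  proof -
    have "Poly_Mapping.single (fst k + fst l, snd k |\<union>| snd l)
       (theta_sign (snd k) (snd l) * Poly_Mapping.lookup f k * Poly_Mapping.lookup g l) \<in> ?C"
      if "k \<in> Poly_Mapping.keys f" "l \<in> Poly_Mapping.keys g" for k l
    proof -
      have "Poly_Mapping.lookup f k \<in> K" "Poly_Mapping.lookup g l \<in> K"
        "Poly_Mapping.keys (fst k) \<subseteq> {..<n}" "fset (snd k) \<subseteq> {..<n}"
        "Poly_Mapping.keys (fst l) \<subseteq> {..<n}" "fset (snd l) \<subseteq> {..<n}"
        using f g that unfolding C lookup_not_eq_zero_eq_in_keys by blast+
      moreover have "Poly_Mapping.keys (fst k + fst l) \<subseteq> {..<n}"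
        using calculation Poly_Mapping.keys_add[of "fst k" "fst l"] by blast
      ultimately show ?thesis unfolding C lookup_single when_def by (auto simp: K sgn)
    qed
    then show ?thesis
      by (subst form_mult_superset[OF finite_keys finite_keys order_refl order_refl])
        (intro sumC)
  qed
  have ops: "x \<otimes>\<^bsub>form_ring K n\<^esub> y = x \<star> y" "x \<oplus>\<^bsub>form_ring K n\<^esub> y = x + y"
    "\<one>\<^bsub>form_ring K n\<^esub> = one_form" "\<zero>\<^bsub>form_ring K n\<^esub> = 0" for x y
    by (simp_all add: form_ring_def)
  show ?thesis
  proof (rule ringI)
    show "abelian_group (form_ring K n)"
      by (rule abelian_groupI)
        (simp_all add: ops add zero add_ac, metis neg add.right_inverse)
    show "Group.monoid (form_ring K n)"
      by (rule Group.monoidI)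
        (auto simp: ops mult one form_mult_assoc form_mult_one_left form_mult_one_right)
  qed (auto simp: ops form_mult_add_left form_mult_add_right)
qed

end

theory Submission
  imports Defs
begin

text \<open>
  Let \<open>e = m / p\<close> and let \<open>M = n (e - 1) + m (n choose 2)\<close> be the degree of
  \<open>\<Delta> = \<Prod>\<^bsub>i<j\<^esub> (x\<^sub>j\<^sup>m - x\<^sub>i\<^sup>m) (x\<^sub>1 \<dots> x\<^sub>n)\<^sup>e\<^sup>-\<^sup>1\<close>. Multiplying every coefficient of a form by the
  factorials of its exponents turns the operators \<open>\<partial>\<^sub>\<omega>\<close> into shifts (\<open>jet_partial_form\<close>), so that
  harmonicity of \<open>\<eta>\<close> becomes the vanishing of linear functionals \<open>F \<mapsto> \<Sum> cnj F\<^sub>\<alpha> \<psi>(\<alpha>)\<close>, one for each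
  set of thetas, on explicit polynomials.

  Upper bound. Only a few invariants matter: the power sums of the \<open>x\<^sub>j\<^sup>m\<close>, the product
  \<open>(x\<^sub>1 \<dots> x\<^sub>n)\<^sup>e\<close>, and their differentials. Fix a set \<open>I\<close> of \<open>k\<close> thetas, and let \<open>N\<close> be the kernel of
  the functional of \<open>I\<close>; it contains all multiples of the invariants. Combining the differentials so
  that the terms outside \<open>I\<close> cancel shows that \<open>N\<close> also contains all multiples of
  \<open>x\<^sub>i\<^sup>m\<^sup>-\<^sup>1 \<Prod>\<^bsub>l\<notin>I'\<^esub> (x\<^sub>i\<^sup>m - x\<^sub>l\<^sup>m)\<close> for \<open>i \<in> I' \<subseteq> I\<close>, and of a similar polynomial coming from the product
  (\<open>witness_relation\<close>, \<open>witness_prod_relation\<close>). Modulo \<open>N\<close>, leading terms of these relations reduce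
  every monomial to standard ones, whose degree is at most \<open>M - k\<close> (\<open>standard_exponents_bound\<close>); only
  one standard monomial attains this degree, and for \<open>k \<ge> 2\<close> one more relation puts it into \<open>N\<close> too
  (\<open>pair_in_N\<close>). Hence a harmonic form of \<open>x\<close>-degree \<open>i\<close> and \<open>\<theta>\<close>-degree \<open>k\<close> vanishes if \<open>i + k > M\<close>, and
  also if \<open>i + k = M\<close> and \<open>k \<ge> 2\<close>, while for \<open>k = 0\<close> and \<open>i = M\<close> it is determined by a single coefficient
  (\<open>harmonic_system_eq_0\<close>). For \<open>k = 1\<close> and \<open>i + 1 = M\<close>, the exterior derivative satisfies
  the same relations with \<open>k = 2\<close>, so it vanishes; the form is the differential of a potential that
  satisfies the relations with \<open>k = 0\<close>, hence a multiple of \<open>d\<Delta>\<close> (\<open>harmonic_system_potential\<close>).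

  Lower bound. The exponents of \<open>\<Delta>\<close> are \<open>\<equiv> e - 1\<close> modulo \<open>m\<close>, and \<open>\<Delta>\<close> changes sign under transpositions.
  Suppose that pairing an invariant of positive degree and \<open>\<theta>\<close>-degree at most \<open>1\<close> with \<open>\<Delta>\<close> leaves a
  monomial \<open>x\<^sup>\<beta>\<close>. The diagonal matrices in the group make the exponents of an invariant congruent to each
  other modulo \<open>m\<close> and divisible by \<open>e\<close>, so the entries of \<open>\<beta>\<close> are congruent to each other modulo \<open>m\<close> and
  \<open>\<equiv> -1\<close> modulo \<open>e\<close>; antisymmetry makes them distinct. Their sum is then at least \<open>M\<close>, which contradicts
  the positive degree of the invariant (\<open>invariant_annihilates\<close>). So \<open>\<Delta>\<close>, all its partial derivatives and
  \<open>d\<Delta>\<close> are harmonic, and some partial derivative of \<open>\<Delta>\<close> is non-zero in every degree from \<open>0\<close> to \<open>M\<close>.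
\<close>

abbreviation lookup where "lookup \<equiv> Poly_Mapping.lookup"
abbreviation keys where "keys \<equiv> Poly_Mapping.keys"
abbreviation single where "single \<equiv> Poly_Mapping.single"

section \<open>Signed elementary symmetric polynomials\<close>

text \<open>The coefficients of \<open>\<Prod>\<^sub>y (t - y)\<close>: the elementary symmetric polynomials with the sign \<open>(-1)\<^sup>r\<close> included.\<close>

fun selem :: "'a::comm_ring_1 list \<Rightarrow> nat \<Rightarrow> 'a" where
  "selem ys 0 = 1"
| "selem [] (Suc r) = 0"
| "selem (y # ys) (Suc r) = selem ys (Suc r) - y * selem ys r"

lemma selem_eq_0: "length ys < r \<Longrightarrow> selem ys r = 0"
  by (induction ys r rule: selem.induct) auto

lemma selem_length: "selem ys (length ys) = (- 1) ^ length ys * prod_list ys"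
  by (induction ys) (auto simp: selem_eq_0)

lemma prod_list_diff_eq_selem:
  "(\<Prod>y\<leftarrow>ys. t - y) = (\<Sum>r\<le>length ys. selem ys r * t ^ (length ys - r))"
proof (induction ys)
  case (Cons y ys)
  let ?L = "length ys"
  have "(\<Sum>r\<le>Suc ?L. selem (y # ys) r * t ^ (Suc ?L - r))
      = t ^ Suc ?L + (\<Sum>r\<le>?L. (selem ys (Suc r) - y * selem ys r) * t ^ (?L - r))"
    by (simp add: sum.atMost_Suc_shift del: sum.atMost_Suc)
  also have "\<dots> = t ^ Suc ?L + (\<Sum>r\<le>?L. selem ys (Suc r) * t ^ (?L - r))
      - y * (\<Sum>r\<le>?L. selem ys r * t ^ (?L - r))"
    by (simp add: algebra_simps sum_subtractf sum_distrib_left)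
  also have "t ^ Suc ?L + (\<Sum>r\<le>?L. selem ys (Suc r) * t ^ (?L - r))
      = (\<Sum>r\<le>Suc ?L. selem ys r * t ^ (Suc ?L - r))"
    by (simp add: sum.atMost_Suc_shift del: sum.atMost_Suc)
  also have "\<dots> = (\<Sum>r\<le>?L. selem ys r * t ^ (Suc ?L - r))"
    by (simp add: selem_eq_0)
  also have "\<dots> = t * (\<Sum>r\<le>?L. selem ys r * t ^ (?L - r))"
    by (simp add: sum_distrib_left Suc_diff_le mult.left_commute)
  finally show ?case
    by (simp add: Cons.IH algebra_simps)
qed simp

text \<open>Newton's identities, in a form that also covers \<open>r > length ys\<close>. In the induction, the terms
  contributed by a new entry \<open>y\<close> telescope to \<open>y * selem ys q\<close>.\<close>

lemma newton_identity:
  "of_nat r * selem ys r + (\<Sum>i<r. (\<Sum>y\<leftarrow>ys. y ^ Suc i) * selem ys (r - Suc i)) = 0"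
proof (induction ys arbitrary: r)
  case Nil
  show ?case by (cases r) auto
next
  case (Cons y ys)
  show ?case
  proof (cases r)
    case (Suc q)
    let ?p = "\<lambda>i. \<Sum>y\<leftarrow>ys. y ^ Suc i"
    have tele: "(\<Sum>i<Suc q. y ^ Suc i * selem (y # ys) (q - i)) = y * selem ys q" for q
    proof (induction q)
      case (Suc q)
      have "(\<Sum>i<Suc (Suc q). y ^ Suc i * selem (y # ys) (Suc q - i))
          = y * selem (y # ys) (Suc q) + y * (\<Sum>i<Suc q. y ^ Suc i * selem (y # ys) (q - i))"
        by (subst sum.lessThan_Suc_shift)
          (simp add: sum_distrib_left mult.assoc del: sum.lessThan_Suc)
      then show ?case unfolding Suc.IH by (simp add: algebra_simps)
    qed simp
    have shift: "(\<Sum>i<Suc q. ?p i * selem (y # ys) (q - i))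
        = (\<Sum>i<Suc q. ?p i * selem ys (q - i)) - y * (\<Sum>i<q. ?p i * selem ys (q - Suc i))"
    proof -
      have "(\<Sum>i<q. ?p i * selem (y # ys) (q - i))
          = (\<Sum>i<q. ?p i * selem ys (q - i) - y * (?p i * selem ys (q - Suc i)))"
      proof (intro sum.cong refl)
        fix i assume "i \<in> {..<q}"
        then have "q - i = Suc (q - Suc i)" by auto
        then show "?p i * selem (y # ys) (q - i)
            = ?p i * selem ys (q - i) - y * (?p i * selem ys (q - Suc i))"
          by (simp add: algebra_simps)
      qed
      then show ?thesis by (simp add: sum_subtractf sum_distrib_left)
    qed
    have "(\<Sum>i<Suc q. (\<Sum>y\<leftarrow>y # ys. y ^ Suc i) * selem (y # ys) (Suc q - Suc i))
       = (\<Sum>i<Suc q. y ^ Suc i * selem (y # ys) (q - i))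
       + (\<Sum>i<Suc q. ?p i * selem (y # ys) (q - i))"
      by (simp add: distrib_right sum.distrib del: sum.lessThan_Suc)
    also have "\<dots> = y * selem ys q + (- of_nat (Suc q) * selem ys (Suc q))
        - y * (- of_nat q * selem ys q)"
    proof -
      have "(\<Sum>i<Suc q. ?p i * selem ys (q - i)) = - (of_nat (Suc q) * selem ys (Suc q))"
        using Cons.IH[of "Suc q"] by (simp only: diff_Suc_Suc add_eq_0_iff)
      moreover have "(\<Sum>i<q. ?p i * selem ys (q - Suc i)) = - (of_nat q * selem ys q)"
        using Cons.IH[of q] by (simp only: add_eq_0_iff)
      ultimately show ?thesis unfolding tele shift by (simp del: sum.lessThan_Suc of_nat_Suc)
    qed
    finally show ?thesis by (simp add: Suc algebra_simps del: sum.lessThan_Suc)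
  qed simp
qed

section \<open>Bounds on standard monomials\<close>

lemma sum_triangle:
  fixes h :: "nat \<Rightarrow> 'a::comm_ring_1"
  shows "(\<Sum>r\<le>R. \<Sum>q\<le>r. h q) = (\<Sum>q\<le>R. of_nat (Suc R - q) * h q)"
proof (induction R)
  case (Suc R)
  have "(\<Sum>q\<le>R. of_nat (Suc (Suc R) - q) * h q) = (\<Sum>q\<le>R. of_nat (Suc R - q) * h q + h q)"
    by (intro sum.cong refl) (auto simp: Suc_diff_le algebra_simps)
  then show ?case using Suc by (simp add: sum.distrib)
qed simp

text \<open>The assumptions are the bounds satisfied by the exponents of a monomial that none of the relations
  below can reduce: \<open>H\<close> comes from the power sums, \<open>B\<close> from \<open>(x\<^sub>1 \<dots> x\<^sub>n)\<^sup>e\<close>, \<open>D\<close> and \<open>A\<close> from the differentials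
  of the two. Put \<open>t j = e - 1 + m (n - 1 - j)\<close>. Assume \<open>e \<ge> 2\<close>, and let \<open>r\<close> be the first index with \<open>a r < e\<close>. Up to \<open>r\<close>
  the bounds \<open>A\<close> and \<open>B\<close> apply and are the desired ones. After \<open>r\<close> the exponents can exceed \<open>t\<close> by at most
  \<open>m - e\<close> each, but the exponent at \<open>r\<close> itself is smaller than \<open>t r\<close> by \<open>m (n - 1 - r) - 1\<close> or more; altogether
  \<open>(n - 1 - r) e - 1\<close> is lost, which is positive unless \<open>r\<close> is the last index. If \<open>e = 1\<close>, then \<open>m = 1\<close>, and \<open>H\<close> and \<open>D\<close> are the
  desired bounds.\<close>

lemma standard_exponents_bound:
  fixes a :: "nat \<Rightarrow> nat"
  assumes m: "1 \<le> m" and n: "1 \<le> n" and e: "1 \<le> e" "e \<le> m" "2 \<le> e \<or> m = 1" and k: "k \<le> n"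
    and H: "\<And>j. j < n \<Longrightarrow> a j < m * (n - j)"
    and D: "\<And>j. j < k \<Longrightarrow> a j < m - 1 + m * (n - 1 - j)"
    and A: "\<And>j. j < k \<Longrightarrow> \<forall>i<j. e \<le> a i \<Longrightarrow> a j < e - 1 + m * (n - 1 - j)"
    and B: "\<And>j. j < n \<Longrightarrow> \<forall>i<j. e \<le> a i \<Longrightarrow> a j < e + m * (n - 1 - j)"
  shows "(\<Sum>j<n. a j) + k \<le> (\<Sum>j<n. e - 1 + m * (n - 1 - j))"
    and "(\<Sum>j<n. a j) + k = (\<Sum>j<n. e - 1 + m * (n - 1 - j)) \<Longrightarrow>
          \<forall>j<n. a j + (if j < k then 1 else 0) = e - 1 + m * (n - 1 - j)"
proof -
  define t where "t j = e - 1 + m * (n - 1 - j)" for j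
  define a' where "a' j = a j + (if j < k then 1 else 0)" for j
  have "(\<Sum>j<n. if j < k then 1 else 0::nat) = card {j\<in>{..<n}. j < k}"
    by (simp add: sum.If_cases Int_def)
  also have "{j\<in>{..<n}. j < k} = {..<k}" using k by auto
  finally have sa': "(\<Sum>j<n. a' j) = (\<Sum>j<n. a j) + k"
    by (simp add: a'_def sum.distrib)
  \<comment> \<open>the second alternative covers exponents that exceed \<open>t\<close> somewhere after \<open>r\<close>\<close>
  have "(\<forall>j<n. a' j \<le> t j) \<or> (\<Sum>j<n. a' j) < (\<Sum>j<n. t j)"
  proof (cases "e = 1")
    case True
    then have "m = 1" using e by auto
    then have "a' j \<le> t j" if "j < n" for j
      using H[OF that] D[of j] True that by (auto simp: a'_def t_def)
    then show ?thesis by blast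
  next
    case False
    then have e2: "2 \<le> e" using e by auto
    have "\<exists>r<n. a r < e"
    proof (rule ccontr)
      assume "\<not> ?thesis"
      then have "\<forall>i<n. e \<le> a i" by force
      then have "a (n - 1) < e" "e \<le> a (n - 1)" using B[of "n - 1"] n by auto
      then show False by simp
    qed
    then obtain r0 where r0: "r0 < n" "a r0 < e" by blast
    define r where "r = (LEAST r. a r < e)"
    have r: "r < n" "a r < e"
      using Least_le[of "\<lambda>r. a r < e", OF r0(2)] LeastI[of "\<lambda>r. a r < e", OF r0(2)] r0(1)
      by (auto simp: r_def)
    have min: "e \<le> a i" if "i < r" for i
      using not_less_Least[of i "\<lambda>r. a r < e"] that by (simp add: r_def not_less)
    have before: "a' j \<le> t j" if "j < r" for j
      using A[of j] B[of j] min that r by (auto simp: a'_def t_def)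
    show ?thesis
    proof (cases "r = n - 1")
      case True
      have "a' r \<le> t r" using A[of r] min r True by (auto simp: a'_def t_def)
      moreover have "j < r \<or> j = r" if "j < n" for j using that True by auto
      ultimately have "\<forall>j<n. a' j \<le> t j" using before by blast
      then show ?thesis by blast
    next
      case False
      \<comment> \<open>the upper bounds for \<open>a' j\<close> before, at and after \<open>r\<close>\<close>
      define u where "u j = (if j < r then int (t j) else if j = r then int e
          else int (t j) + int (m - e))" for j
      have "int (a' j) \<le> u j" if "j < n" for j
      proof -
        consider "j < r" | "j = r" | "r < j" by linarith
        then show ?thesis
        proof cases
          case 3
          have "m * (n - j) = m + m * (n - 1 - j)" using that
            by (metis Suc_diff_Suc diff_Suc_eq_diff_pred mult_Suc_right)
          then have "a' j \<le> t j + (m - e)" using 3 H[OF that] D[of j] e e2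
            by (auto simp: a'_def t_def)
          then show ?thesis using 3 by (simp add: u_def flip: of_nat_add)
        qed (use before[of j] r in \<open>auto simp: u_def a'_def\<close>)
      qed
      then have "int (\<Sum>j<n. a' j) \<le> (\<Sum>j<n. u j)" by (auto intro: sum_mono)
      also have "\<dots> = (\<Sum>j<n. int (t j) + (if r < j then int (m - e) else 0)
          + (if j = r then int e - int (t r) else 0))"
        by (intro sum.cong) (auto simp: u_def)
      also have "\<dots> = (\<Sum>j<n. int (t j)) + (\<Sum>j<n. if r < j then int (m - e) else 0)
          + (int e - int (t r))"
        using r by (simp add: sum.distrib)
      also have "(\<Sum>j<n. if r < j then int (m - e) else 0) = int (n - 1 - r) * int (m - e)"
      proof -
        have "{j\<in>{..<n}. r < j} = {r<..<n}" by auto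
        then show ?thesis by (simp add: sum.If_cases Int_def)
      qed
      also have "(\<Sum>j<n. int (t j)) + int (n - 1 - r) * int (m - e) + (int e - int (t r))
          = (\<Sum>j<n. int (t j)) + 1 - int (n - 1 - r) * int e"
        using e by (simp add: t_def of_nat_diff right_diff_distrib left_diff_distrib mult.commute)
      also have "\<dots> < (\<Sum>j<n. int (t j))"
      proof -
        have "1 \<le> n - 1 - r" using r False by auto
        then have "1 * 2 \<le> int (n - 1 - r) * int e" using e2 by (intro mult_mono) auto
        then show ?thesis by linarith
      qed
      finally have "(\<Sum>j<n. a' j) < (\<Sum>j<n. t j)" unfolding of_nat_sum[symmetric] of_nat_less_iff .
      then show ?thesis by blast
    qed
  qed
  then have *: "(\<Sum>j<n. a' j) \<le> (\<Sum>j<n. t j) \<and>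
     ((\<Sum>j<n. a' j) = (\<Sum>j<n. t j) \<longrightarrow> (\<forall>j<n. a' j = t j))"
  proof (elim disjE)
    assume le: "\<forall>j<n. a' j \<le> t j"
    have "a' j = t j" if "(\<Sum>j<n. a' j) = (\<Sum>j<n. t j)" "j < n" for j
    proof (rule ccontr)
      assume "a' j \<noteq> t j"
      then have "(\<Sum>j<n. a' j) < (\<Sum>j<n. t j)"
        using le that(2) by (intro sum_strict_mono_ex1) (auto intro!: bexI[of _ j])
      then show False using that by simp
    qed
    then show ?thesis using le by (auto intro: sum_mono)
  qed auto
  show "(\<Sum>j<n. a j) + k \<le> (\<Sum>j<n. e - 1 + m * (n - 1 - j))"
    using * unfolding sa' t_def by blast
  show "\<forall>j<n. a j + (if j < k then 1 else 0) = e - 1 + m * (n - 1 - j)"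
    if "(\<Sum>j<n. a j) + k = (\<Sum>j<n. e - 1 + m * (n - 1 - j))"
    using * that unfolding sa'[symmetric] t_def[symmetric] a'_def[symmetric] by simp
qed

section \<open>Straightening of monomials\<close>

text \<open>The set \<open>N\<close> stands for the kernel of a functional on polynomials. This need not be an ideal, but it contains all
  multiples of certain polynomials, whence the free factor \<open>f\<close> in the relations. The relations \<open>wit\<close> and \<open>wit_prod\<close> are those for the
  thetas \<open>{0..<k}\<close>, with \<open>I' = {0..j}\<close>. The relation \<open>wit2\<close> has one factor less than \<open>wit\<close> at \<open>j = 0\<close>; it is what
  excludes the last monomial of degree \<open>M - k\<close>.\<close>

locale straightening =
  fixes x :: "nat \<Rightarrow> 'a::comm_ring_1" and N :: "'a set" and m e n k :: nat
  assumes m: "1 \<le> m" and n: "1 \<le> n" and e: "1 \<le> e" "e \<le> m" "2 \<le> e \<or> m = 1" and k: "k \<le> n"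
    and N_zero: "0 \<in> N" and N_add: "f \<in> N \<Longrightarrow> g \<in> N \<Longrightarrow> f + g \<in> N"
    and N_uminus: "f \<in> N \<Longrightarrow> - f \<in> N"
    and N_divide: "0 < c \<Longrightarrow> of_nat c * f \<in> N \<Longrightarrow> f \<in> N"
    and power_sum: "0 < r \<Longrightarrow> f * (\<Sum>j<n. x j ^ (m * r)) \<in> N"
    and power_prod: "f * (\<Prod>j<n. x j ^ e) \<in> N"
    and wit: "j < k \<Longrightarrow> f * (x j ^ (m - 1) * (\<Prod>l\<in>{Suc j..<n}. x j ^ m - x l ^ m)) \<in> N"
    and wit2: "2 \<le> k \<Longrightarrow> f * (x 0 ^ (m - 1) * (\<Prod>l\<in>{2..<n}. x 0 ^ m - x l ^ m)) \<in> N"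
    and wit_prod: "j < k \<Longrightarrow> f * ((\<Prod>l<j. x l ^ e) * x j ^ (e - 1) *
          (\<Prod>l\<in>{Suc j..<n}. x j ^ m - x l ^ m)) \<in> N"
begin

abbreviation Y :: "nat \<Rightarrow> 'a" where "Y j \<equiv> x j ^ m"

definition mon :: "(nat \<Rightarrow> nat) \<Rightarrow> 'a" where "mon a = (\<Prod>j<n. x j ^ a j)"

text \<open>Straightening replaces powers of one variable by powers of variables with smaller indices. This
  keeps the degree and lowers the weight.\<close>

definition wt :: "(nat \<Rightarrow> nat) \<Rightarrow> nat" where "wt a = (\<Sum>j<n. j * a j)"

text \<open>Modulo the power sums, \<open>\<Prod>\<^sub>l (1 - Y\<^sub>l t)\<close> is \<open>1\<close>, so \<open>g j r\<close>, which is the coefficient of \<open>t\<^sup>r\<close> in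
  \<open>\<Prod>\<^bsub>l\<ge>j\<^esub> (1 - Y\<^sub>l t)\<close>, becomes the complete homogeneous polynomial of degree \<open>r\<close> in \<open>Y\<^sub>0, \<dots>, Y\<^sub>j\<^sub>-\<^sub>1\<close>.\<close>

definition g :: "nat \<Rightarrow> nat \<Rightarrow> 'a" where "g j r = selem (map Y [j..<n]) r"

lemma N_diff: "f \<in> N \<Longrightarrow> h \<in> N \<Longrightarrow> f - h \<in> N"
  using N_add[of f "- h"] N_uminus by simp

lemma N_sum: "(\<And>i. i \<in> A \<Longrightarrow> F i \<in> N) \<Longrightarrow> sum F A \<in> N"
  by (induction A rule: infinite_finite_induct) (auto simp: N_zero N_add)

lemma N_of_nat: "f \<in> N \<Longrightarrow> of_nat c * f \<in> N"
  by (induction c) (auto simp: N_zero N_add algebra_simps)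

lemma N_of_int: "f \<in> N \<Longrightarrow> of_int c * f \<in> N"
proof (cases c rule: int_diff_cases)
  case (diff p q)
  then have "of_int c * f = of_nat p * f - of_nat q * f"
    by (simp add: left_diff_distrib)
  moreover assume "f \<in> N"
  ultimately show ?thesis by (simp add: N_diff N_of_nat)
qed

lemma mon_add: "mon (\<lambda>i. a i + b i) = mon a * mon b"
  by (simp add: mon_def power_add prod.distrib)

lemma mon_single: "j < n \<Longrightarrow> mon (\<lambda>i. if i = j then c else 0) = x j ^ c"
proof -
  assume "j < n"
  have "mon (\<lambda>i. if i = j then c else 0) = (\<Prod>i<n. if i = j then x j ^ c else 1)"
    unfolding mon_def by (intro prod.cong) auto
  also have "\<dots> = x j ^ c" using \<open>j < n\<close> by simp
  finally show ?thesis .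
qed

lemma mon_cong: "(\<And>i. i < n \<Longrightarrow> a i = b i) \<Longrightarrow> mon a = mon b"
  by (simp add: mon_def)

lemma mon_dvd: "(\<And>i. i < n \<Longrightarrow> c i \<le> b i) \<Longrightarrow> mon c dvd mon b"
  unfolding mon_def by (intro prod_dvd_prod) (auto intro: le_imp_power_dvd)

lemma mon_mult_in_N:
  assumes "\<And>f. f * (mon c * h) \<in> N" "\<And>i. i < n \<Longrightarrow> c i \<le> b i"
  shows "mon b * h \<in> N"
proof -
  obtain u where "mon b = mon c * u" using mon_dvd[of c b] assms(2) by (auto elim: dvdE)
  then show ?thesis using assms(1)[of u] by (simp add: mult_ac)
qed

lemma g_0 [simp]: "g j 0 = 1" by (simp add: g_def)

lemma g_Suc: "j < n \<Longrightarrow> g (Suc j) (Suc r) = g j (Suc r) + Y j * g (Suc j) r"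
  by (simp add: g_def upt_rec[of j n])

lemma g_eq_0: "n - j < r \<Longrightarrow> g j r = 0"
  by (simp add: g_def selem_eq_0)

lemma g_top: "g j (n - j) = (- 1) ^ (n - j) * (\<Prod>l\<in>{j..<n}. Y l)"
  using selem_length[of "map Y [j..<n]"]
  by (simp add: g_def prod.distinct_set_conv_list[symmetric])

lemma g_expand: "j < n \<Longrightarrow> g (Suc j) r = (\<Sum>q\<le>r. Y j ^ (r - q) * g j q)"
proof (induction r)
  case (Suc r)
  have "(\<Sum>q\<le>r. Y j ^ (Suc r - q) * g j q) = Y j * g (Suc j) r"
    using Suc by (simp add: sum_distrib_left Suc_diff_le mult.assoc)
  then show ?case using g_Suc[OF Suc.prems, of r] by (simp del: One_nat_def)
qed simp

lemma prod_diff_eq: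
  "(\<Prod>l\<in>{j..<n}. t - Y l) = (\<Sum>r\<le>n - j. g j r * t ^ (n - j - r))"
  using prod_list_diff_eq_selem[of t "map Y [j..<n]"]
  by (simp add: g_def prod.distinct_set_conv_list[symmetric] o_def)

text \<open>In terms of the \<open>g j q\<close>, which modulo \<open>N\<close> involve only variables before \<open>x\<^sub>j\<close>, the product has the leading
  term \<open>(n - j) Y\<^sub>j\<^sup>n\<^sup>-\<^sup>1\<^sup>-\<^sup>j\<close>. Its coefficient is a positive integer, in general not \<open>1\<close>.\<close>

lemma witness_expand:
  assumes "j < n"
  shows "(\<Prod>l\<in>{Suc j..<n}. Y j - Y l)
    = (\<Sum>q\<le>n - Suc j. of_nat (Suc (n - Suc j) - q) * (Y j ^ (n - Suc j - q) * g j q))"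
proof -
  let ?R = "n - Suc j"
  have "(\<Prod>l\<in>{Suc j..<n}. Y j - Y l) = (\<Sum>r\<le>?R. g (Suc j) r * Y j ^ (?R - r))"
    by (rule prod_diff_eq)
  also have "\<dots> = (\<Sum>r\<le>?R. \<Sum>q\<le>r. Y j ^ (?R - q) * g j q)"
  proof (intro sum.cong refl)
    fix r assume r: "r \<in> {..?R}"
    have "g (Suc j) r * Y j ^ (?R - r) = (\<Sum>q\<le>r. (Y j ^ (r - q) * Y j ^ (?R - r)) * g j q)"
      by (simp add: g_expand[OF assms] sum_distrib_left sum_distrib_right mult_ac)
    also have "\<dots> = (\<Sum>q\<le>r. Y j ^ (?R - q) * g j q)"

    proof (intro sum.cong refl arg_cong2[where f = "(*)"])
      fix q assume "q \<in> {..r}"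
      then have "r - q + (?R - r) = ?R - q" using r by simp
      then show "Y j ^ (r - q) * Y j ^ (?R - r) = Y j ^ (?R - q)"
        by (simp only: power_add[symmetric])
    qed
    finally show "g (Suc j) r * Y j ^ (?R - r) = (\<Sum>q\<le>r. Y j ^ (?R - q) * g j q)" .
  qed
  also have "\<dots> = (\<Sum>q\<le>?R. of_nat (Suc ?R - q) * (Y j ^ (?R - q) * g j q))"
    by (rule sum_triangle)
  finally show ?thesis .
qed

text \<open>By Newton's identities, \<open>r * g 0 r\<close> lies in the ideal of the power sums.\<close>

lemma g_initial: "0 < r \<Longrightarrow> f * g 0 r \<in> N"
proof (rule N_divide[of r])
  assume r: "0 < r"
  have "f * ((\<Sum>y\<leftarrow>map Y [0..<n]. y ^ Suc i) * h) \<in> N" for i h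
    using power_sum[of "Suc i" "f * h"]
    by (simp add: interv_sum_list_conv_sum_set_nat atLeast0LessThan
        o_def mult_ac power_mult[symmetric] del: power_Suc mult_Suc mult_Suc_right)
  then have "(\<Sum>i<r. f * ((\<Sum>y\<leftarrow>map Y [0..<n]. y ^ Suc i) * g 0 (r - Suc i))) \<in> N"
    by (intro N_sum)
  then have "- (f * (\<Sum>i<r. (\<Sum>y\<leftarrow>map Y [0..<n]. y ^ Suc i) * g 0 (r - Suc i))) \<in> N"
    by (intro N_uminus) (simp only: sum_distrib_left)
  also have "- (f * (\<Sum>i<r. (\<Sum>y\<leftarrow>map Y [0..<n]. y ^ Suc i) * g 0 (r - Suc i)))
     = f * (of_nat r * g 0 r)"
    using newton_identity[of r "map Y [0..<n]"] unfolding g_def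
    by (simp only: add_eq_0_iff mult_minus_right minus_minus)
  finally show "of_nat r * (f * g 0 r) \<in> N" by (simp only: mult_ac)
qed

text \<open>\<open>g j r\<close> reduces to the complete homogeneous polynomial in \<open>Y\<^sub>0, \<dots>, Y\<^sub>j\<^sub>-\<^sub>1\<close>, so it suffices to treat
  the monomials of degree \<open>r\<close> in these. The recursion \<open>g_Suc\<close> is that of complete homogeneous polynomials.\<close>

lemma mon_mult_g_in_N:
  assumes "j \<le> n"
    and "\<And>c. (\<forall>i\<ge>j. c i = 0) \<Longrightarrow> (\<Sum>i<j. c i) = r \<Longrightarrow> mon (\<lambda>i. b i + m * c i) \<in> N"
  shows "mon b * g j r \<in> N"
  using assms
proof (induction j arbitrary: r b)
  case 0
  show ?case
  proof (cases r)
    case 0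
    then show ?thesis using "0.prems"(2)[of "\<lambda>_. 0"] by simp
  qed (auto intro: g_initial)
next
  case (Suc j)
  note outer = Suc.IH
  show ?case using Suc.prems
  proof (induction r arbitrary: b)
    case 0
    then show ?case using "0.prems"(2)[of "\<lambda>_. 0"] by simp
  next
    case (Suc r)
    have j: "j < n" using Suc.prems by simp
    have 1: "mon b * g j (Suc r) \<in> N"
    proof (rule outer)
      fix c :: "nat \<Rightarrow> nat" assume "\<forall>i\<ge>j. c i = 0" "(\<Sum>i<j. c i) = Suc r"
      then show "mon (\<lambda>i. b i + m * c i) \<in> N" by (intro Suc.prems(2)) auto
    qed (use j in simp)
    let ?b = "\<lambda>i. b i + (if i = j then m else 0)"
    have 2: "mon ?b * g (Suc j) r \<in> N"
    proof (rule Suc.IH)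
      fix c :: "nat \<Rightarrow> nat" assume c: "\<forall>i\<ge>Suc j. c i = 0" "(\<Sum>i<Suc j. c i) = r"
      let ?c = "\<lambda>i. c i + (if i = j then 1 else 0)"
      have "mon (\<lambda>i. b i + m * ?c i) \<in> N"
        using c by (intro Suc.prems(2)) (auto simp: sum.distrib)
      also have "mon (\<lambda>i. b i + m * ?c i) = mon (\<lambda>i. ?b i + m * c i)"
        by (intro mon_cong) auto
      finally show "mon (\<lambda>i. ?b i + m * c i) \<in> N" .
    qed (use j in simp)
    have "mon b * g (Suc j) (Suc r) = mon b * g j (Suc r) + mon ?b * g (Suc j) r"
      by (simp add: g_Suc[OF j] mon_add mon_single[OF j] algebra_simps)
    then show ?case using 1 2 N_add by simp
  qed
qed

text \<open>The leading term \<open>Y\<^sub>j\<^sup>R\<close> of a relation is traded for terms in which some of the factors \<open>Y\<^sub>j\<close> have become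
  factors \<open>Y\<^sub>i\<close> with \<open>i < j\<close>. These terms have the same degree and smaller weight, so they are in \<open>N\<close> by induction.\<close>

lemma straighten:
  assumes j: "j < n" and R: "\<And>i. i < n \<Longrightarrow> a i = b i + (if i = j then m * R else 0)"
    and \<kappa>: "0 < \<kappa> 0"
    and rel: "mon b * (\<Sum>q\<le>R. of_nat (\<kappa> q) * (Y j ^ (R - q) * g j q)) \<in> N"
    and IH: "\<And>a'. (\<Sum>i<n. a' i) = (\<Sum>i<n. a i) \<Longrightarrow> wt a' < wt a \<Longrightarrow> mon a' \<in> N"
  shows "mon a \<in> N"
proof -
  have mult_Y: "mon b * Y j ^ s = mon (\<lambda>i. b i + (if i = j then m * s else 0))" for s
    by (simp add: mon_add mon_single[OF j] power_mult)
  have a: "mon a = mon b * Y j ^ R"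
    unfolding mult_Y by (intro mon_cong) (simp add: R)
  have lower: "mon b * Y j ^ (R - q) * g j q \<in> N" if q: "1 \<le> q" "q \<le> R" for q
    unfolding mult_Y
  proof (rule mon_mult_g_in_N)
    fix c :: "nat \<Rightarrow> nat" assume c: "\<forall>i\<ge>j. c i = 0" "(\<Sum>i<j. c i) = q"
    have ext: "(\<Sum>i<n. h i * c i) = (\<Sum>i<j. h i * c i)" for h :: "nat \<Rightarrow> nat"
      using c j by (intro sum.mono_neutral_right) auto
    let ?a = "\<lambda>i. b i + (if i = j then m * (R - q) else 0) + m * c i"
    have sep: "(\<Sum>i<n. h i * ?a i) = (\<Sum>i<n. h i * b i) + h j * (m * (R - q)) + m * (\<Sum>i<j. h i * c i)"
      for h :: "nat \<Rightarrow> nat"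
    proof -
      have "(\<Sum>i<n. h i * ?a i) = (\<Sum>i<n. h i * b i) + (\<Sum>i<n. if i = j then h j * (m * (R - q)) else 0)
          + m * (\<Sum>i<n. h i * c i)"
        unfolding sum_distrib_left sum.distrib[symmetric]
        by (intro sum.cong) (auto simp: algebra_simps)
      then show ?thesis using j by (simp add: ext)
    qed
    have sepa: "(\<Sum>i<n. h i * a i) = (\<Sum>i<n. h i * b i) + h j * (m * R)" for h :: "nat \<Rightarrow> nat"
    proof -
      have "(\<Sum>i<n. h i * a i) = (\<Sum>i<n. h i * b i) + (\<Sum>i<n. if i = j then h j * (m * R) else 0)"
        unfolding sum.distrib[symmetric] by (intro sum.cong) (auto simp: R distrib_left)
      then show ?thesis using j by simp
    qed
    show "mon ?a \<in> N"
    proof (rule IH)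
      show "(\<Sum>i<n. ?a i) = (\<Sum>i<n. a i)"
        using sep[of "\<lambda>_. 1"] sepa[of "\<lambda>_. 1"] c(2) q by (simp flip: add_mult_distrib2)
      have "(\<Sum>i<j. i * c i) \<le> (\<Sum>i<j. (j - 1) * c i)" by (intro sum_mono) auto
      also have "\<dots> = (j - 1) * q" by (simp add: c(2) flip: sum_distrib_left)
      also have "\<dots> < j * q" using c(2) q by (cases j) auto
      finally have "m * (\<Sum>i<j. i * c i) < j * (m * q)" using m by simp
      also have "j * (m * (R - q)) + j * (m * q) = j * (m * R)" using q
        by (simp flip: add_mult_distrib2)
      then have "j * (m * q) = j * (m * R) - j * (m * (R - q))" by simp
      finally show "wt ?a < wt a"
        using sep[of id] sepa[of id] unfolding wt_def by simp
    qed
  qed (use j in simp)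
  have "(\<Sum>q\<le>R. of_nat (\<kappa> q) * (Y j ^ (R - q) * g j q))
     = of_nat (\<kappa> 0) * Y j ^ R + (\<Sum>q\<in>{1..R}. of_nat (\<kappa> q) * (Y j ^ (R - q) * g j q))"
    by (simp add: atMost_atLeast0 sum.atLeast_Suc_atMost)
  then have eq: "of_nat (\<kappa> 0) * mon a = mon b * (\<Sum>q\<le>R. of_nat (\<kappa> q) * (Y j ^ (R - q) * g j q))
      - (\<Sum>q\<in>{1..R}. of_nat (\<kappa> q) * (mon b * Y j ^ (R - q) * g j q))"
    by (simp add: a algebra_simps sum_distrib_left)
  have "of_nat (\<kappa> 0) * mon a \<in> N" unfolding eq
    by (intro N_diff rel N_sum N_of_nat lower) auto
  then show ?thesis using N_divide \<kappa> by blast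
qed

lemma exponent_split:
  assumes "m * R \<le> a j"
  shows "a i = (a(j := a j - m * R)) i + (if i = j then m * R else 0)"
  using assms by simp

lemma mon_threshold:
  assumes "j < n"
  shows "mon (\<lambda>i. if i < j then c else if i = j then d else 0) = (\<Prod>l<j. x l ^ c) * x j ^ d"
proof -
  have "mon (\<lambda>i. if i < j then c else if i = j then d else 0)
     = mon (\<lambda>i. (if i < j then c else 0) + (if i = j then d else 0))"
    by (intro mon_cong) auto
  also have "\<dots> = mon (\<lambda>i. if i < j then c else 0) * x j ^ d"
    by (simp add: mon_add mon_single[OF assms])
  also have "mon (\<lambda>i. if i < j then c else 0) = (\<Prod>l<j. x l ^ c)"
    unfolding mon_def using assms by (intro prod.mono_neutral_cong_right) auto
  finally show ?thesis .
qed

lemma mon_pair: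
  assumes "2 \<le> n"
  shows "x 0 ^ c * x 1 ^ d = mon (\<lambda>i. (if i = 0 then c else 0) + (if i = 1 then d else 0))"
  using assms by (simp add: mon_add mon_single)

text \<open>For \<open>j = 1\<close>, the complete homogeneous polynomial is a power of the single variable \<open>Y\<^sub>0\<close>.\<close>

lemma pair_expand:
  assumes "2 \<le> n"
  shows "u * g 1 q - u * Y 0 ^ q \<in> N"
proof -
  have "g 1 q = (\<Sum>r\<le>q. Y 0 ^ (q - r) * g 0 r)" using g_expand[of 0 q] assms by simp
  also have "\<dots> = Y 0 ^ q + (\<Sum>r\<in>{1..q}. Y 0 ^ (q - r) * g 0 r)"
    by (simp add: atMost_atLeast0 sum.atLeast_Suc_atMost)
  finally have "u * g 1 q - u * Y 0 ^ q = (\<Sum>r\<in>{1..q}. (u * Y 0 ^ (q - r)) * g 0 r)"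
    by (simp add: algebra_simps sum_distrib_left)
  also have "\<dots> \<in> N" by (intro N_sum g_initial) auto
  finally show ?thesis .
qed

text \<open>With the indices \<open>0\<close> and \<open>1\<close> left out, the product becomes, modulo the power sums, a binary form in
  \<open>Y\<^sub>0\<close> and \<open>Y\<^sub>1\<close>.\<close>

lemma pair_witness_0:
  assumes "2 \<le> n"
  shows "u * (\<Prod>l\<in>{2..<n}. Y 0 - Y l)
     - (\<Sum>s\<le>n - 2. of_nat (n - 1 - s) * (u * (Y 0 ^ (n - 2 - s) * Y 1 ^ s))) \<in> N"
proof -
  let ?R = "n - 2"
  have "(\<Prod>l\<in>{2..<n}. Y 0 - Y l) = (\<Sum>r\<le>?R. \<Sum>s\<le>r. Y 0 ^ (?R - r) * (Y 1 ^ s * g 1 (r - s)))"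
  proof -
    have "g 2 r = (\<Sum>s\<le>r. Y 1 ^ s * g 1 (r - s))" for r
      using g_expand[of 1 r] assms
      by (simp add: numeral_2_eq_2)
        (rule sum.reindex_bij_witness[of _ "\<lambda>q. r - q" "\<lambda>q. r - q"], auto)
    then show ?thesis unfolding prod_diff_eq
      by (simp add: sum_distrib_left mult.commute mult.left_commute)
  qed
  moreover have "(\<Sum>s\<le>?R. of_nat (n - 1 - s) * (u * (Y 0 ^ (?R - s) * Y 1 ^ s)))
      = (\<Sum>r\<le>?R. \<Sum>s\<le>r. u * (Y 0 ^ (?R - s) * Y 1 ^ s))"
  proof -
    have "Suc ?R - s = n - 1 - s" for s using assms by auto
    then show ?thesis unfolding sum_triangle by simp
  qed
  moreover have "u * (Y 0 ^ (?R - s) * Y 1 ^ s) = (u * Y 0 ^ (?R - r) * Y 1 ^ s) * Y 0 ^ (r - s)"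
    if "r \<le> ?R" "s \<le> r" for r s
  proof -
    have "?R - s = ?R - r + (r - s)" using that by simp
    then show ?thesis by (simp only: power_add mult_ac)
  qed
  then have "(\<Sum>r\<le>?R. \<Sum>s\<le>r. u * (Y 0 ^ (?R - s) * Y 1 ^ s))
      = (\<Sum>r\<le>?R. \<Sum>s\<le>r. (u * Y 0 ^ (?R - r) * Y 1 ^ s) * Y 0 ^ (r - s))"
    by (intro sum.cong refl) simp
  ultimately have "u * (\<Prod>l\<in>{2..<n}. Y 0 - Y l)
      - (\<Sum>s\<le>n - 2. of_nat (n - 1 - s) * (u * (Y 0 ^ (n - 2 - s) * Y 1 ^ s)))
     = (\<Sum>r\<le>?R. \<Sum>s\<le>r. (u * Y 0 ^ (?R - r) * Y 1 ^ s) * g 1 (r - s)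
         - (u * Y 0 ^ (?R - r) * Y 1 ^ s) * Y 0 ^ (r - s))"
    by (simp only: sum_distrib_left sum_subtractf mult.assoc)
  also have "\<dots> \<in> N" by (intro N_sum pair_expand assms)
  finally show ?thesis .
qed

lemma pair_witness_1:
  assumes "2 \<le> n"
  shows "u * (\<Prod>l\<in>{2..<n}. Y 1 - Y l)
     - (\<Sum>s\<le>n - 2. of_nat (s + 1) * (u * (Y 0 ^ (n - 2 - s) * Y 1 ^ s))) \<in> N"
proof -
  let ?R = "n - 2"
  have "(\<Prod>l\<in>{2..<n}. Y 1 - Y l) = (\<Sum>q\<le>?R. of_nat (Suc ?R - q) * (Y 1 ^ (?R - q) * g 1 q))"
    using witness_expand[of 1] assms by (simp add: numeral_2_eq_2)
  moreover have "(\<Sum>s\<le>?R. of_nat (s + 1) * (u * (Y 0 ^ (?R - s) * Y 1 ^ s)))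
     = (\<Sum>q\<le>?R. of_nat (Suc ?R - q) * (u * (Y 0 ^ q * Y 1 ^ (?R - q))))"
  proof (rule sum.reindex_bij_witness[of _ "\<lambda>q. ?R - q" "\<lambda>q. ?R - q"])
    fix s assume "s \<in> {..?R}"
    then have "?R - (?R - s) = s" "Suc ?R - (?R - s) = s + 1" by auto
    then show "of_nat (Suc ?R - (?R - s)) * (u * (Y 0 ^ (?R - s) * Y 1 ^ (?R - (?R - s))))
        = of_nat (s + 1) * (u * (Y 0 ^ (?R - s) * Y 1 ^ s))"
      by (simp only: )
  qed auto
  ultimately have "u * (\<Prod>l\<in>{2..<n}. Y 1 - Y l)
     - (\<Sum>s\<le>n - 2. of_nat (s + 1) * (u * (Y 0 ^ (n - 2 - s) * Y 1 ^ s)))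
     = (\<Sum>q\<le>?R. of_nat (Suc ?R - q) * ((u * Y 1 ^ (?R - q)) * g 1 q - (u * Y 1 ^ (?R - q)) * Y 0 ^ q))"
    by (simp add: sum_distrib_left sum_subtractf right_diff_distrib mult_ac)
  also have "\<dots> \<in> N" by (intro N_sum N_of_nat pair_expand assms)
  finally show ?thesis .
qed

lemma witness_in_N:
  assumes jn: "j < n" and le: "m * (n - Suc j) \<le> a j"
    and rel: "mon (a(j := a j - m * (n - Suc j))) * (\<Prod>l\<in>{Suc j..<n}. Y j - Y l) \<in> N"
    and IH: "\<And>a'. (\<Sum>i<n. a' i) = (\<Sum>i<n. a i) \<Longrightarrow> wt a' < wt a \<Longrightarrow> mon a' \<in> N"
  shows "mon a \<in> N"
proof (rule straighten[OF jn exponent_split[of "n - Suc j" a j, OF le] _ _ IH])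
  show "mon (a(j := a j - m * (n - Suc j))) *
      (\<Sum>q\<le>n - Suc j. of_nat (Suc (n - Suc j) - q) * (Y j ^ (n - Suc j - q) * g j q)) \<in> N"
    using rel unfolding witness_expand[OF jn] .
qed auto

text \<open>The exponents at \<open>0\<close> and \<open>1\<close> are those of the one standard monomial of degree \<open>M - k\<close>. Modulo \<open>N\<close>, \<open>wit2\<close> reads
  \<open>x\<^sub>0\<^sup>m\<^sup>-\<^sup>1 \<Sum>\<^sub>s (n - 1 - s) Y\<^sub>0\<^sup>n\<^sup>-\<^sup>2\<^sup>-\<^sup>s Y\<^sub>1\<^sup>s\<close>. If \<open>e \<ge> 2\<close>, the term with \<open>s = n - 2\<close> divides the monomial and the others have
  smaller weight. If \<open>m = e = 1\<close>, the exponent of \<open>x\<^sub>1\<close> is only \<open>n - 3\<close>; subtracting the form of \<open>wit\<close> at \<open>j = 1\<close>, which is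
  \<open>\<Sum>\<^sub>s (s + 1) Y\<^sub>0\<^sup>n\<^sup>-\<^sup>2\<^sup>-\<^sup>s Y\<^sub>1\<^sup>s\<close>, from \<open>n - 1\<close> times the first one cancels \<open>s = n - 2\<close> and leaves the coefficient \<open>n\<close> at
  \<open>s = n - 3\<close>.\<close>

lemma pair_in_N:
  assumes k2: "2 \<le> k"
    and a: "a 0 + 1 = e - 1 + m * (n - 1)" "a 1 + 1 = e - 1 + m * (n - 2)"
    and IH: "\<And>a'. (\<Sum>i<n. a' i) = (\<Sum>i<n. a i) \<Longrightarrow> wt a' < wt a \<Longrightarrow> mon a' \<in> N"
  shows "mon a \<in> N"
proof -
  have n2: "2 \<le> n" using k2 k by simp
  let ?Z = "\<lambda>s. Y 0 ^ (n - 2 - s) * Y 1 ^ s"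
  \<comment> \<open>\<open>a\<close> is at least the exponent of \<open>x\<^sub>0\<^sup>m\<^sup>-\<^sup>1 Y\<^sub>0\<^sup>d Y\<^sub>1\<^sup>c\<close>\<close>
  have gen: "mon a \<in> N"
    if cd: "c + d = n - 2" and c: "m * c \<le> a 1" and d: "m - 1 + m * d \<le> a 0"
      and \<kappa>: "0 < \<kappa> c" "\<And>s. s \<le> n - 2 \<Longrightarrow> c < s \<Longrightarrow> \<kappa> s = 0"
      and rel: "\<And>u. (\<Sum>s\<le>n - 2. of_int (\<kappa> s) * (u * x 0 ^ (m - 1) * ?Z s)) \<in> N"
    for c d and \<kappa> :: "nat \<Rightarrow> int"
  proof -
    define b where "b i = (if i = 0 then a 0 - (m - 1 + m * d) else if i = 1 then a 1 - m * c else a i)" for i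
    have Z: "mon b * x 0 ^ (m - 1) * ?Z s
        = mon (\<lambda>i. b i + ((if i = 0 then m - 1 + m * (n - 2 - s) else 0) + (if i = 1 then m * s else 0)))" for s
      unfolding mon_add mon_pair[OF n2, symmetric, unfolded mon_add]
      by (simp add: power_add power_mult mult_ac)
    have low: "mon b * x 0 ^ (m - 1) * ?Z s \<in> N" if s: "s < c" for s
      unfolding Z
    proof (rule IH)
      let ?a = "\<lambda>i. b i + ((if i = 0 then m - 1 + m * (n - 2 - s) else 0) + (if i = 1 then m * s else 0))"
      have split: "(\<Sum>i<n. f i) = f 0 + f 1 + (\<Sum>i\<in>{2..<n}. f i)" for f :: "nat \<Rightarrow> nat"
        using n2 by (simp add: lessThan_atLeast0 sum.atLeast_Suc_lessThan numeral_2_eq_2 add.assoc)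
      have rest: "?a i = a i" if "2 \<le> i" for i using that by (simp add: b_def)
      have rests: "(\<Sum>i\<in>{2..<n}. ?a i) = (\<Sum>i\<in>{2..<n}. a i)"
        "(\<Sum>i\<in>{2..<n}. i * ?a i) = (\<Sum>i\<in>{2..<n}. i * a i)"
        by (intro sum.cong refl; simp only: rest atLeastLessThan_iff)+
      have a1: "?a 1 = a 1 - m * (c - s)" "m * (c - s) \<le> a 1"
        using s c by (auto simp: b_def diff_mult_distrib2)
      have "m * (n - 2 - s) = m * d + m * (c - s)"
        using s cd unfolding add_mult_distrib2[symmetric] by (intro arg_cong[of _ _ "(*) m"]) auto
      then have a0: "?a 0 = a 0 + m * (c - s)" using d by (simp add: b_def)
      show "(\<Sum>i<n. ?a i) = (\<Sum>i<n. a i)"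
        unfolding split[of ?a] split[of a] a0 a1(1) rests using a1(2) by simp
      have "0 < m * (c - s)" using s m by (intro mult_pos_pos) auto
      then show "wt ?a < wt a"
        unfolding wt_def split[of "\<lambda>i. i * ?a i"] split[of "\<lambda>i. i * a i"] a0 a1(1) rests
        using a1(2) by linarith
    qed
    have lead: "mon b * x 0 ^ (m - 1) * ?Z c = mon a"
      unfolding Z
    proof (rule mon_cong)
      have "n - 2 - c = d" using cd by simp
      then show "b i + ((if i = 0 then m - 1 + m * (n - 2 - c) else 0) + (if i = 1 then m * c else 0)) = a i" for i
        using c d by (simp add: b_def)
    qed
    have c2: "c \<le> n - 2" using cd by simp
    have "of_int (\<kappa> c) * mon a = (\<Sum>s\<le>n - 2. of_int (\<kappa> s) * (mon b * x 0 ^ (m - 1) * ?Z s))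
       - (\<Sum>s\<in>{..n - 2} - {c}. of_int (\<kappa> s) * (mon b * x 0 ^ (m - 1) * ?Z s))"
      using c2 by (subst sum.remove[of "{..n - 2}" c]) (auto simp only: lead finite_atMost atMost_iff, simp)
    also have "\<dots> \<in> N"
    proof (intro N_diff rel N_sum)
      fix s assume s: "s \<in> {..n - 2} - {c}"
      show "of_int (\<kappa> s) * (mon b * x 0 ^ (m - 1) * ?Z s) \<in> N"
      proof (cases "s < c")
        case True then show ?thesis by (intro N_of_int low)
      next
        case False
        then have "\<kappa> s = 0" using s \<kappa>(2)[of s] by auto
        then show ?thesis by (simp add: N_zero)
      qed
    qed
    finally have "of_nat (nat (\<kappa> c)) * mon a \<in> N" using \<kappa>(1) by simp
    then show ?thesis by (rule N_divide[rotated]) (use \<kappa>(1) in simp)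
  qed
  have w0: "(\<Sum>s\<le>n - 2. of_int (int (n - 1 - s)) * (u * x 0 ^ (m - 1) * ?Z s)) \<in> N" for u
    using N_diff[OF wit2[OF k2, of u] pair_witness_0[OF n2, of "u * x 0 ^ (m - 1)"]]
    by (simp add: mult.assoc)
  show ?thesis
  proof (cases "2 \<le> e")
    case True
    have "m * (n - 1) = m * (n - 2) + m" using n2 by (metis Suc_diff_Suc Suc_1 Suc_le_lessD mult_Suc_right add.commute One_nat_def)
    moreover have "m * 1 \<le> m * (n - 1)" using n2 by (intro mult_le_mono2) simp
    ultimately show ?thesis
      using a True n2 e by (intro gen[of "n - 2" 0 "\<lambda>s. int (n - 1 - s)"] w0) auto
  next
    case False
    then have m1: "m = 1" "e = 1" using e by auto
    then have n3: "3 \<le> n" using a by auto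
    have w1: "(\<Sum>s\<le>n - 2. of_nat (s + 1) * (u * ?Z s)) \<in> N" for u
    proof -
      have "u * (\<Prod>l\<in>{2..<n}. Y 1 - Y l) \<in> N"
        using wit[of 1 u] k2 m1 by (simp add: numeral_2_eq_2)
      from N_diff[OF this pair_witness_1[OF n2, of u]] show ?thesis by simp
    qed
    \<comment> \<open>the combination that cancels the term with \<open>s = n - 2\<close>\<close>
    let ?\<kappa> = "\<lambda>s. int (n - 1) * int (n - 1 - s) - int (s + 1)"
    show ?thesis
    proof (rule gen[of "n - 3" 1 ?\<kappa>])
      show "n - 3 + 1 = n - 2" using n3 by simp
      show "m * (n - 3) \<le> a 1" "m - 1 + m * 1 \<le> a 0" using a m1 n3 by auto
      have "n - 1 - (n - 3) = 2" "n - 3 + 1 = n - 2" using n3 by auto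
      then show "0 < ?\<kappa> (n - 3)" using n3 by simp
      show "?\<kappa> s = 0" if "s \<le> n - 2" "n - 3 < s" for s
      proof -
        have "s = n - 2" using that n3 by auto
        then show ?thesis using n3 by (auto simp: of_nat_diff)
      qed
      have "of_nat (n - 1) * (\<Sum>s\<le>n - 2. of_int (int (n - 1 - s)) * (u * x 0 ^ (m - 1) * ?Z s))
          - (\<Sum>s\<le>n - 2. of_nat (s + 1) * (u * ?Z s)) \<in> N" for u
        by (intro N_diff N_of_nat w0 w1)
      then show "(\<Sum>s\<le>n - 2. of_int (?\<kappa> s) * (u * x 0 ^ (m - 1) * ?Z s)) \<in> N" for u
        by (simp add: m1 sum_distrib_left sum_subtractf left_diff_distrib mult.assoc)
    qed
  qed
qed

text \<open>By induction on the weight, a monomial that violates one of the bounds of \<open>standard_exponents_bound\<close> is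
  straightened. A monomial that satisfies them has degree at most \<open>M - k\<close>, with equality for one exponent only.\<close>

theorem mon_in_N:
  assumes deg: "(\<Sum>j<n. e - 1 + m * (n - 1 - j)) \<le> (\<Sum>j<n. a j) + k"
    and top: "2 \<le> k \<or> (\<Sum>j<n. e - 1 + m * (n - 1 - j)) < (\<Sum>j<n. a j) + k \<or>
       (k = 0 \<and> mon (\<lambda>j. e - 1 + m * (n - 1 - j)) \<in> N)"
  shows "mon a \<in> N"
  using assms
proof (induction "wt a" arbitrary: a rule: less_induct)
  case less
  have IH: "mon a' \<in> N" if "(\<Sum>i<n. a' i) = (\<Sum>i<n. a i)" "wt a' < wt a" for a'
    using less(1)[of a'] less(2,3) that by simp
  show ?case
  proof (rule ccontr)
    assume notin: "mon a \<notin> N"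
    have H: "a j < m * (n - j)" if j: "j < n" for j
    proof (rule ccontr)
      assume "\<not> ?thesis"
      then have le: "m * (n - j) \<le> a j" by simp
      have "mon a \<in> N"
      proof (rule straighten[OF j exponent_split[of "n - j" a j, OF le] _ _ IH, where \<kappa> = "\<lambda>_. 1"])
        have "(\<Sum>q\<le>n - j. of_nat 1 * (Y j ^ (n - j - q) * g j q)) = 0"
          using g_expand[OF j, of "n - j"] g_eq_0[of "Suc j" "n - j"] j by simp
        then show "mon (a(j := a j - m * (n - j))) *
            (\<Sum>q\<le>n - j. of_nat 1 * (Y j ^ (n - j - q) * g j q)) \<in> N"
          by (simp only: mult_zero_right N_zero)
      qed auto
      then show False using notin by simp
    qed
    have D: "a j < m - 1 + m * (n - 1 - j)" if j: "j < k" for j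
    proof (rule ccontr)
      assume "\<not> ?thesis"
      then have le: "m - 1 + m * (n - Suc j) \<le> a j" by simp
      have jn: "j < n" using j k by simp
      have "mon (a(j := a j - m * (n - Suc j))) * (\<Prod>l\<in>{Suc j..<n}. Y j - Y l) \<in> N"
        by (rule mon_mult_in_N[where c = "\<lambda>i. if i = j then m - 1 else 0"])
          (use wit[OF j] le mon_single[OF jn] in auto)
      then show False using notin witness_in_N[OF jn _ _ IH] le by simp
    qed
    have A: "a j < e - 1 + m * (n - 1 - j)" if j: "j < k" and pre: "\<forall>i<j. e \<le> a i" for j
    proof (rule ccontr)
      assume "\<not> ?thesis"
      then have le: "e - 1 + m * (n - Suc j) \<le> a j" by simp
      have jn: "j < n" using j k by simp
      have "mon (a(j := a j - m * (n - Suc j))) * (\<Prod>l\<in>{Suc j..<n}. Y j - Y l) \<in> N"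
        by (rule mon_mult_in_N[where c = "\<lambda>i. if i < j then e else if i = j then e - 1 else 0"])
          (use wit_prod[OF j] le mon_threshold[OF jn] pre in auto)
      then show False using notin witness_in_N[OF jn _ _ IH] le by simp
    qed
    have B: "a j < e + m * (n - 1 - j)" if j: "j < n" and pre: "\<forall>i<j. e \<le> a i" for j
    proof (rule ccontr)
      assume "\<not> ?thesis"
      then have le: "e + m * (n - Suc j) \<le> a j" by simp
      have "f * (mon (\<lambda>i. if i < j then e else if i = j then e else 0) * g (Suc j) (n - Suc j)) \<in> N" for f
      proof -
        have "(\<Prod>l<n. x l ^ e) = (\<Prod>l<j. x l ^ e) * x j ^ e * (\<Prod>l\<in>{Suc j..<n}. x l ^ e)"
          using j by (simp add: lessThan_atLeast0 prod.atLeastLessThan_concat[symmetric, of 0 "Suc j" n])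
        moreover have "(\<Prod>l\<in>{Suc j..<n}. Y l) = (\<Prod>l\<in>{Suc j..<n}. x l ^ (m - e)) * (\<Prod>l\<in>{Suc j..<n}. x l ^ e)"
          using e by (simp flip: prod.distrib power_add)
        ultimately have "f * (mon (\<lambda>i. if i < j then e else if i = j then e else 0) * g (Suc j) (n - Suc j))
            = (f * (- 1) ^ (n - Suc j) * (\<Prod>l\<in>{Suc j..<n}. x l ^ (m - e))) * (\<Prod>l<n. x l ^ e)"
          unfolding mon_threshold[OF j] g_top by (simp only: mult_ac)
        then show ?thesis using power_prod by metis
      qed
      then have "mon (a(j := a j - m * (n - Suc j))) * g (Suc j) (n - Suc j) \<in> N"
        by (rule mon_mult_in_N) (use le pre in auto)
      then have rel: "mon (a(j := a j - m * (n - Suc j)))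
          * (\<Sum>q\<le>n - Suc j. of_nat 1 * (Y j ^ (n - Suc j - q) * g j q)) \<in> N"
        by (simp only: g_expand[OF j] of_nat_1 mult_1)
      have "mon a \<in> N"
        by (rule straighten[OF j exponent_split[of "n - Suc j" a j] _ rel IH])
          (use le in auto)
      then show False using notin by simp
    qed
    have "(\<Sum>j<n. a j) + k \<le> (\<Sum>j<n. e - 1 + m * (n - 1 - j))"
      by (rule standard_exponents_bound(1)[OF m n e k]) (blast intro: H D A B)+
    then have eq: "(\<Sum>j<n. a j) + k = (\<Sum>j<n. e - 1 + m * (n - 1 - j))"
      using less.prems(1) by simp
    have tops: "\<forall>j<n. a j + (if j < k then 1 else 0) = e - 1 + m * (n - 1 - j)"
      by (rule standard_exponents_bound(2)[OF m n e k _ _ _ _ eq]) (blast intro: H D A B)+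
    from less.prems(2) eq consider "2 \<le> k" | "k = 0" "mon (\<lambda>j. e - 1 + m * (n - 1 - j)) \<in> N"
      by auto
    then show False
    proof cases
      case 1
      have n2: "2 \<le> n" using 1 k by simp
      have a1: "a 1 + 1 = e - 1 + m * (n - 2)"
        using tops[rule_format, of 1] 1 n2 by (simp add: numeral_2_eq_2)
      have a0: "a 0 + 1 = e - 1 + m * (n - 1)" using tops[rule_format, of 0] 1 n2 by simp
      show False using notin pair_in_N[OF 1 a0 a1 IH] by blast
    next
      case 2
      then show False using notin tops mon_cong[of a "\<lambda>j. e - 1 + m * (n - 1 - j)"] by simp
    qed
  qed
qed

end

type_synonym mpoly = "(nat \<Rightarrow>\<^sub>0 nat) \<Rightarrow>\<^sub>0 complex"

section \<open>Functionals on polynomials\<close>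

text \<open>If \<open>\<psi>\<close> is the jet of a polynomial, this is the value at \<open>0\<close> of the operator \<open>\<partial>\<^sub>F\<close> applied to it. The conjugation
  is the one in \<open>\<partial>\<^sub>\<omega>\<close>.\<close>

definition pair :: "mpoly \<Rightarrow> ((nat \<Rightarrow>\<^sub>0 nat) \<Rightarrow> complex) \<Rightarrow> complex" where
  "pair F \<psi> = (\<Sum>\<alpha>\<in>keys F. cnj (lookup F \<alpha>) * \<psi> \<alpha>)"

lemma pair_superset:
  "finite A \<Longrightarrow> keys F \<subseteq> A \<Longrightarrow>
    pair F \<psi> = (\<Sum>\<alpha>\<in>A. cnj (lookup F \<alpha>) * \<psi> \<alpha>)"
  unfolding pair_def by (intro sum.mono_neutral_left) (auto simp: in_keys_iff)

lemma pair_0 [simp]: "pair 0 \<psi> = 0"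
  by (simp add: pair_def)

lemma pair_zero_right [simp]: "pair F (\<lambda>_. 0) = 0"
  by (simp add: pair_def)

lemma pair_add: "pair (F + G) \<psi> = pair F \<psi> + pair G \<psi>"
proof -
  let ?A = "keys F \<union> keys G"
  have "keys (F + G) \<subseteq> ?A" by (rule Poly_Mapping.keys_add)
  then show ?thesis
    by (simp add: pair_superset[of ?A] lookup_add algebra_simps sum.distrib)
qed

lemma pair_uminus: "pair (- F) \<psi> = - pair F \<psi>"
  using pair_add[of F "- F" \<psi>] by (simp add: eq_neg_iff_add_eq_0 add.commute)

lemma pair_sum: "pair (sum F A) \<psi> = (\<Sum>a\<in>A. pair (F a) \<psi>)"
  by (induction A rule: infinite_finite_induct) (auto simp: pair_add)

lemma pair_single [simp]: "pair (single \<alpha> c) \<psi> = cnj c * \<psi> \<alpha>"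
  by (subst pair_superset[of "{\<alpha>}"]) auto

lemma pair_diff_right: "pair F (\<lambda>\<alpha>. \<psi> \<alpha> - \<phi> \<alpha>) = pair F \<psi> - pair F \<phi>"
  by (simp add: pair_def sum_subtractf right_diff_distrib)

lemma pair_cmult_right: "pair F (\<lambda>\<alpha>. c * \<psi> \<alpha>) = c * pair F \<psi>"
  by (simp add: pair_def sum_distrib_left mult.left_commute)

lemma pair_mult_single:
  "pair (F * single \<beta> c) \<psi> = cnj c * pair F (\<lambda>\<alpha>. \<psi> (\<alpha> + \<beta>))"
proof -
  have "pair (F * single \<beta> c) \<psi>
      = pair ((\<Sum>\<alpha>\<in>keys F. single \<alpha> (lookup F \<alpha>))
          * single \<beta> c) \<psi>"
    by (simp only: sum_single)
  also have "\<dots> = cnj c * pair F (\<lambda>\<alpha>. \<psi> (\<alpha> + \<beta>))"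
    by (simp add: sum_distrib_right mult_single pair_sum sum_distrib_left mult_ac)
      (simp add: pair_def sum_distrib_left mult_ac add.commute)
  finally show ?thesis .
qed

lemma pair_mult_eq_sum:
  "pair (F * G) \<psi> = (\<Sum>\<beta>\<in>keys G. cnj (lookup G \<beta>) * pair F (\<lambda>\<alpha>. \<psi> (\<alpha> + \<beta>)))"
proof -
  have "pair (F * G) \<psi> = pair (F * (\<Sum>\<beta>\<in>keys G. single \<beta> (lookup G \<beta>))) \<psi>"
    by (simp only: sum_single)
  then show ?thesis by (simp add: sum_distrib_left pair_sum pair_mult_single)
qed

lemma pair_mult_of_nat: "pair (F * of_nat c) \<psi> = of_nat c * pair F \<psi>"
  by (simp add: pair_mult_single flip: Poly_Mapping.single_of_nat)

lemma var_power: "var i ^ c = single (single i c) 1"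
  by (induction c) (auto simp: var_def mult_single simp flip: Poly_Mapping.single_add)

lemma prod_single:
  "(\<Prod>j\<in>A. single (\<gamma> j) (1::complex)) = single (\<Sum>j\<in>A. \<gamma> j) 1"
  for \<gamma> :: "'b \<Rightarrow> nat \<Rightarrow>\<^sub>0 nat"
  by (induction A rule: infinite_finite_induct) (auto simp: mult_single)

lemma var_neq_0: "var i \<noteq> 0"
proof
  assume "var i = 0"
  then have "lookup (var i) (single i 1) = 0" by simp
  then show False by (simp only: var_def lookup_single_eq one_neq_zero)
qed

section \<open>Relations between the coefficients of a harmonic form\<close>

text \<open>An invariant \<open>F\<close> of the group together with its partial derivatives, up to a common positive factor.\<close>

definition invariant_pairs :: "nat \<Rightarrow> nat \<Rightarrow> nat \<Rightarrow> (mpoly \<times> (nat \<Rightarrow> mpoly)) set" where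
  "invariant_pairs m e n =
     {(\<Sum>j<n. var j ^ (m * r), \<lambda>j. var j ^ (m * r - 1)) | r. 0 < r}
   \<union> {(\<Prod>j<n. var j ^ e, \<lambda>j. (\<Prod>l\<in>{..<n} - {j}. var l ^ e) * var j ^ (e - 1))}"

lemma power_sum_in_invariant_pairs:
  "0 < r \<Longrightarrow> (\<Sum>j<n. var j ^ (m * r), \<lambda>j. var j ^ (m * r - 1)) \<in> invariant_pairs m e n"
  unfolding invariant_pairs_def by blast

lemma power_prod_in_invariant_pairs:
  "(\<Prod>j<n. var j ^ e, \<lambda>j. (\<Prod>l\<in>{..<n} - {j}. var l ^ e) * var j ^ (e - 1)) \<in> invariant_pairs m e n"
  unfolding invariant_pairs_def by blast

text \<open>The equations that the invariants \<open>F\<close> and \<open>\<Sum>\<^sub>j dF\<^sub>j \<theta>\<^sub>j\<close> impose on the jet \<open>\<Psi>\<close> of a harmonic form.\<close>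

definition harmonic_system ::
    "nat \<Rightarrow> nat \<Rightarrow> nat \<Rightarrow> ((nat \<Rightarrow>\<^sub>0 nat) \<Rightarrow> nat fset \<Rightarrow> complex) \<Rightarrow> bool" where
  "harmonic_system m e n \<Psi> \<longleftrightarrow>
     (\<forall>\<alpha> B. \<Psi> \<alpha> B \<noteq> 0 \<longrightarrow> keys \<alpha> \<subseteq> {..<n} \<and> fset B \<subseteq> {..<n}) \<and>
     (\<forall>(F, dF) \<in> invariant_pairs m e n. \<forall>\<beta> B.
        pair F (\<lambda>\<alpha>. \<Psi> (\<alpha> + \<beta>) B) = 0 \<and>
        (\<Sum>j\<in>{..<n} - fset B. theta_sign {|j|} B * pair (dF j) (\<lambda>\<alpha>. \<Psi> (\<alpha> + \<beta>) (finsert j B))) = 0)"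

lemma harmonic_system_support:
  "harmonic_system m e n \<Psi> \<Longrightarrow> \<Psi> \<alpha> B \<noteq> 0 \<Longrightarrow> keys \<alpha> \<subseteq> {..<n} \<and> fset B \<subseteq> {..<n}"
  unfolding harmonic_system_def by blast

lemma harmonic_system_pair:
  assumes "harmonic_system m e n \<Psi>" "(F, dF) \<in> invariant_pairs m e n"
  shows "pair (F * G) (\<lambda>\<alpha>. \<Psi> \<alpha> B) = 0"
proof -
  have "\<forall>\<beta> B. pair F (\<lambda>\<alpha>. \<Psi> (\<alpha> + \<beta>) B) = 0"
    using assms unfolding harmonic_system_def by fast
  then show ?thesis by (simp add: pair_mult_eq_sum)
qed

lemma harmonic_system_deriv:
  assumes "harmonic_system m e n \<Psi>" "(F, dF) \<in> invariant_pairs m e n"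
  shows "(\<Sum>j\<in>{..<n} - fset B. theta_sign {|j|} B * pair (dF j * G) (\<lambda>\<alpha>. \<Psi> \<alpha> (finsert j B))) = 0"
proof -
  have *: "(\<Sum>j\<in>{..<n} - fset B. theta_sign {|j|} B * pair (dF j) (\<lambda>\<alpha>. \<Psi> (\<alpha> + \<beta>) (finsert j B))) = 0" for \<beta>
    using assms unfolding harmonic_system_def by fast
  have "(\<Sum>j\<in>{..<n} - fset B. theta_sign {|j|} B * pair (dF j * G) (\<lambda>\<alpha>. \<Psi> \<alpha> (finsert j B)))
     = (\<Sum>\<beta>\<in>keys G. cnj (lookup G \<beta>) *
         (\<Sum>j\<in>{..<n} - fset B. theta_sign {|j|} B * pair (dF j) (\<lambda>\<alpha>. \<Psi> (\<alpha> + \<beta>) (finsert j B))))"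
    unfolding pair_mult_eq_sum sum_distrib_left by (subst sum.swap) (simp add: mult_ac)
  then show ?thesis by (simp add: *)
qed

text \<open>The relation at \<open>I - {i}\<close> involves the indices \<open>j\<close> outside this set; if \<open>T j\<close> vanishes outside \<open>I\<close>, only
  \<open>j = i\<close> remains.\<close>

lemma isolate_index:
  assumes I: "i |\<in>| I" "fset I \<subseteq> {..<n}"
    and rel: "(\<Sum>j\<in>{..<n} - fset (I |-| {|i|}). theta_sign {|j|} (I |-| {|i|}) *
       pair (T j) (\<lambda>\<alpha>. \<Psi> \<alpha> (finsert j (I |-| {|i|})))) = 0"
    and T0: "\<And>j. j < n \<Longrightarrow> j |\<notin>| I \<Longrightarrow> T j = 0"
  shows "pair (T i) (\<lambda>\<alpha>. \<Psi> \<alpha> I) = 0"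
proof -
  let ?B = "I |-| {|i|}"
  have "(\<Sum>j\<in>{..<n} - fset ?B. theta_sign {|j|} ?B * pair (T j) (\<lambda>\<alpha>. \<Psi> \<alpha> (finsert j ?B)))
     = (\<Sum>j\<in>{i}. theta_sign {|j|} ?B * pair (T j) (\<lambda>\<alpha>. \<Psi> \<alpha> (finsert j ?B)))"
  proof (intro sum.mono_neutral_right ballI)
    fix j assume "j \<in> {..<n} - fset ?B - {i}"
    then have "T j = 0" by (intro T0) auto
    then show "theta_sign {|j|} ?B * pair (T j) (\<lambda>\<alpha>. \<Psi> \<alpha> (finsert j ?B)) = 0" by simp
  qed (use I in auto)
  also have "\<dots> = theta_sign {|i|} ?B * pair (T i) (\<lambda>\<alpha>. \<Psi> \<alpha> I)"
    using I by (simp add: finsert_absorb)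
  finally have "theta_sign {|i|} ?B * pair (T i) (\<lambda>\<alpha>. \<Psi> \<alpha> I) = 0" using rel by simp
  moreover have "theta_sign {|i|} ?B \<noteq> 0" by (auto simp: theta_sign_def)
  ultimately show ?thesis by simp
qed

lemma prod_diff_expand:
  fixes y :: "nat \<Rightarrow> 'a::comm_ring_1"
  assumes "finite A"
  obtains c where "\<And>t. (\<Prod>l\<in>A. t - y l) = (\<Sum>s\<le>card A. c s * t ^ s)"
    and "c 0 = (- 1) ^ card A * (\<Prod>l\<in>A. y l)"
proof
  let ?ys = "map y (sorted_list_of_set A)"
  have len: "length ?ys = card A" using assms by simp
  show "(\<Prod>l\<in>A. t - y l) = (\<Sum>s\<le>card A. selem ?ys (card A - s) * t ^ s)" for t
  proof -
    have "(\<Prod>l\<in>A. t - y l) = (\<Prod>y\<leftarrow>?ys. t - y)"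
      using prod.distinct_set_conv_list[of "sorted_list_of_set A" "\<lambda>l. t - y l"] assms
      by (simp only: map_map o_def distinct_sorted_list_of_set set_sorted_list_of_set simp_thms)
    also have "\<dots> = (\<Sum>r\<le>card A. selem ?ys r * t ^ (card A - r))"
      by (simp only: prod_list_diff_eq_selem len)
    also have "\<dots> = (\<Sum>s\<le>card A. selem ?ys (card A - s) * t ^ s)"
      by (rule sum.reindex_bij_witness[of _ "\<lambda>q. card A - q" "\<lambda>q. card A - q"]) auto
    finally show ?thesis .
  qed
  show "selem ?ys (card A - 0) = (- 1) ^ card A * (\<Prod>l\<in>A. y l)"
    using selem_length[of ?ys] prod.distinct_set_conv_list[of "sorted_list_of_set A" y] assms len
    by simp
qed

text \<open>The polynomials \<open>T j = f x\<^sub>j\<^sup>m\<^sup>-\<^sup>1 \<Prod>\<^bsub>l\<notin>I'\<^esub> (x\<^sub>j\<^sup>m - x\<^sub>l\<^sup>m)\<close> vanish for \<open>j \<notin> I'\<close>. Expanding the product in powers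
  of \<open>x\<^sub>j\<^sup>m\<close> gives coefficients that do not depend on \<open>j\<close>, so the \<open>T j\<close> combine the differentials of power sums.\<close>

lemma witness_relation:
  assumes H: "harmonic_system m e n \<Psi>" and m: "1 \<le> m"
    and I: "i \<in> I'" "I' \<subseteq> fset I" "fset I \<subseteq> {..<n}"
  shows "pair (f * (var i ^ (m - 1) * (\<Prod>l\<in>{..<n} - I'. var i ^ m - var l ^ m))) (\<lambda>\<alpha>. \<Psi> \<alpha> I) = 0"
proof -
  let ?A = "{..<n} - I'" and ?B = "I |-| {|i|}"
  have "finite ?A" by simp
  then obtain c where c: "\<And>t. (\<Prod>l\<in>?A. t - var l ^ m) = (\<Sum>s\<le>card ?A. c s * t ^ s)"
    by (rule prod_diff_expand[where y = "\<lambda>l. var l ^ m"]) (rule that, assumption)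
  define T where "T j = f * (var j ^ (m - 1) * (\<Prod>l\<in>?A. var j ^ m - var l ^ m))" for j
  have T: "T j = (\<Sum>s\<le>card ?A. var j ^ (m * Suc s - 1) * (f * c s))" for j
  proof -
    have pw: "var j ^ (m * Suc s - 1) = var j ^ (m - 1) * (var j ^ m) ^ s" for s
    proof -
      have "m * Suc s - 1 = (m - 1) + m * s" using m by simp
      then show ?thesis by (simp only: power_add power_mult)
    qed
    show ?thesis
      unfolding T_def c pw by (simp only: sum_distrib_left mult_ac)
  qed
  have "pair (T i) (\<lambda>\<alpha>. \<Psi> \<alpha> I) = 0"
  proof (rule isolate_index)
    show "T j = 0" if "j < n" "j |\<notin>| I" for j
      using that I unfolding T_def by (auto intro!: prod_zero)
    have "(\<Sum>j\<in>{..<n} - fset ?B. theta_sign {|j|} ?B *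
        pair (var j ^ (m * Suc s - 1) * (f * c s)) (\<lambda>\<alpha>. \<Psi> \<alpha> (finsert j ?B))) = 0" for s
      by (rule harmonic_system_deriv[OF H]) (rule power_sum_in_invariant_pairs, simp)
    then have "(\<Sum>s\<le>card ?A. \<Sum>j\<in>{..<n} - fset ?B. theta_sign {|j|} ?B *
        pair (var j ^ (m * Suc s - 1) * (f * c s)) (\<lambda>\<alpha>. \<Psi> \<alpha> (finsert j ?B))) = 0" by simp
    then show "(\<Sum>j\<in>{..<n} - fset ?B. theta_sign {|j|} ?B * pair (T j) (\<lambda>\<alpha>. \<Psi> \<alpha> (finsert j ?B))) = 0"
      unfolding T pair_sum sum_distrib_left by (subst (asm) sum.swap)
  qed (use I in auto)
  then show ?thesis by (simp add: T_def)
qed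

text \<open>As in \<open>witness_relation\<close>, with the constant term \<open>c 0\<close> of \<open>\<Prod>\<^bsub>l\<notin>I'\<^esub> (t - x\<^sub>l\<^sup>m)\<close> supplied by the differential of
  \<open>(x\<^sub>1 \<dots> x\<^sub>n)\<^sup>e\<close>: it is a multiple of \<open>\<Prod>\<^bsub>l\<notin>I'\<^esub> x\<^sub>l\<^sup>e\<close>. Then \<open>x\<^sub>j T j\<close> is \<open>f \<Prod>\<^bsub>l\<in>I'\<^esub> x\<^sub>l\<^sup>e\<close> times the value of the product at
  \<open>t = x\<^sub>j\<^sup>m\<close>, and \<open>x\<^sub>j\<close> can be cancelled.\<close>

lemma witness_prod_relation:
  assumes H: "harmonic_system m e n \<Psi>" and m: "1 \<le> m" and e: "1 \<le> e" "e \<le> m"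
    and I: "i \<in> I'" "I' \<subseteq> fset I" "fset I \<subseteq> {..<n}"
  shows "pair (f * ((\<Prod>l\<in>I' - {i}. var l ^ e) * var i ^ (e - 1) * (\<Prod>l\<in>{..<n} - I'. var i ^ m - var l ^ m)))
     (\<lambda>\<alpha>. \<Psi> \<alpha> I) = 0"
proof -
  let ?A = "{..<n} - I'" and ?B = "I |-| {|i|}"
  have fin: "finite ?A" "finite I'" using I finite_subset[of I' "fset I"] by auto
  obtain c where c: "\<And>t. (\<Prod>l\<in>?A. t - var l ^ m) = (\<Sum>s\<le>card ?A. c s * t ^ s)"
      and c0: "c 0 = (- 1) ^ card ?A * (\<Prod>l\<in>?A. var l ^ m)"
    by (rule prod_diff_expand[OF fin(1), where y = "\<lambda>l. var l ^ m"]) (rule that, assumption+)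
  define P where "P = (\<Prod>l\<in>I'. var l ^ e)"
  \<comment> \<open>\<open>f * C\<close> is the factor that makes \<open>dE\<close> contribute the constant term \<open>c 0\<close>\<close>
  define C where "C = (- 1) ^ card ?A * (\<Prod>l\<in>?A. var l ^ (m - e))"
  define dE where "dE j = (\<Prod>l\<in>{..<n} - {j}. var l ^ e) * var j ^ (e - 1)" for j
  define T where "T j = (\<Sum>s<card ?A. var j ^ (m * Suc s - 1) * (f * P * c (Suc s))) + dE j * (f * C)" for j
  have var_e: "var j * var j ^ (e - 1) = var j ^ e" for j
    using e by (simp flip: power_Suc)
  have T: "var j * T j = f * P * (\<Prod>l\<in>?A. var j ^ m - var l ^ m)" if j: "j < n" for j
  proof -
    have "var j * dE j = (\<Prod>l<n. var l ^ e)"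
    proof -
      have "(\<Prod>l<n. var l ^ e) = var j ^ e * (\<Prod>l\<in>{..<n} - {j}. var l ^ e)"
        using j by (intro prod.remove) auto
      then show ?thesis unfolding dE_def var_e[of j, symmetric] by (simp only: mult_ac)
    qed
    also have "\<dots> = P * (\<Prod>l\<in>?A. var l ^ e)"
    proof -
      have "{..<n} = I' \<union> ?A" using I by auto
      then show ?thesis unfolding P_def using fin by (metis prod.union_disjoint Diff_disjoint)
    qed
    finally have dE: "var j * dE j = P * (\<Prod>l\<in>?A. var l ^ e)" .
    have "(\<Prod>l\<in>?A. var l ^ m) = (\<Prod>l\<in>?A. var l ^ (m - e)) * (\<Prod>l\<in>?A. var l ^ e)"
      using e by (simp flip: prod.distrib power_add)
    then have "var j * (dE j * (f * C)) = f * P * c 0"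
      unfolding mult.assoc[symmetric] dE by (simp only: C_def c0 mult_ac)
    moreover have "var j * (var j ^ (m * Suc s - 1) * (f * P * c (Suc s)))
        = f * P * (c (Suc s) * (var j ^ m) ^ Suc s)" for s
    proof -
      have "Suc (m * Suc s - 1) = m * Suc s" using m by simp
      then have *: "var j * var j ^ (m * Suc s - 1) = (var j ^ m) ^ Suc s"
        by (simp only: power_Suc[symmetric] power_mult[symmetric])
      show ?thesis unfolding mult.assoc[symmetric] * by (simp only: mult_ac)
    qed
    ultimately have "var j * T j = f * P * ((\<Sum>s<card ?A. c (Suc s) * (var j ^ m) ^ Suc s) + c 0)"
      unfolding T_def distrib_left sum_distrib_left by (simp only:)
    also have "(\<Sum>s<card ?A. c (Suc s) * (var j ^ m) ^ Suc s) + c 0 = (\<Sum>s\<le>card ?A. c s * (var j ^ m) ^ s)"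
      by (simp add: lessThan_Suc_atMost[symmetric] sum.lessThan_Suc_shift del: sum.lessThan_Suc power_Suc)
    finally show ?thesis by (simp add: c)
  qed
  have "pair (T i) (\<lambda>\<alpha>. \<Psi> \<alpha> I) = 0"
  proof (rule isolate_index)
    show "T j = 0" if "j < n" "j |\<notin>| I" for j
    proof -
      have "(\<Prod>l\<in>?A. var j ^ m - var l ^ m) = 0"
        using that I by (intro prod_zero) auto
      then have "var j * T j = 0" unfolding T[OF that(1)] by (simp only: mult_zero_right)
      then show ?thesis using var_neq_0[of j] by (simp only: mult_eq_0_iff simp_thms)
    qed
    have r1: "(\<Sum>j\<in>{..<n} - fset ?B. theta_sign {|j|} ?B *
        pair (var j ^ (m * Suc s - 1) * (f * P * c (Suc s))) (\<lambda>\<alpha>. \<Psi> \<alpha> (finsert j ?B))) = 0" for s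
      by (rule harmonic_system_deriv[OF H]) (rule power_sum_in_invariant_pairs, simp)
    have r2: "(\<Sum>j\<in>{..<n} - fset ?B. theta_sign {|j|} ?B *
        pair (dE j * (f * C)) (\<lambda>\<alpha>. \<Psi> \<alpha> (finsert j ?B))) = 0"
      unfolding dE_def by (rule harmonic_system_deriv[OF H power_prod_in_invariant_pairs])
    have "(\<Sum>s<card ?A. \<Sum>j\<in>{..<n} - fset ?B. theta_sign {|j|} ?B *
        pair (var j ^ (m * Suc s - 1) * (f * P * c (Suc s))) (\<lambda>\<alpha>. \<Psi> \<alpha> (finsert j ?B))) = 0"
      by (intro sum.neutral ballI r1)
    with r2 show "(\<Sum>j\<in>{..<n} - fset ?B. theta_sign {|j|} ?B * pair (T j) (\<lambda>\<alpha>. \<Psi> \<alpha> (finsert j ?B))) = 0"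
      unfolding T_def pair_add pair_sum distrib_left sum.distrib sum_distrib_left
      by (subst sum.swap) (simp only: add_0_left)
  qed (use I in auto)
  also have "T i = f * ((\<Prod>l\<in>I' - {i}. var l ^ e) * var i ^ (e - 1) * (\<Prod>l\<in>{..<n} - I'. var i ^ m - var l ^ m))"
  proof -
    have "i < n" using I by auto
    have "var i * T i = var i * (f * ((\<Prod>l\<in>I' - {i}. var l ^ e) * var i ^ (e - 1) * (\<Prod>l\<in>?A. var i ^ m - var l ^ m)))"
      unfolding T[OF \<open>i < n\<close>] P_def prod.remove[OF fin(2) I(1)] var_e[symmetric] by (simp only: mult_ac)
    then show ?thesis using var_neq_0[of i] by simp
  qed
  finally show ?thesis .
qed

section \<open>Vanishing in high degree\<close>

lemma enumeration_starting_with: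
  assumes "I \<subseteq> {..<n}"
  obtains \<pi> where "bij_betw \<pi> {..<n} {..<n}" "\<pi> ` {..<card I} = I" "I = {} \<Longrightarrow> \<pi> = id"
proof (cases "I = {}")
  case True
  then show ?thesis by (intro that[of id]) auto
next
  case False
  have fin: "finite I" using assms finite_subset by blast
  define xs where "xs = sorted_list_of_set I @ sorted_list_of_set ({..<n} - I)"
  have d: "distinct xs" "set xs = {..<n}" using assms fin by (auto simp: xs_def)
  then have len: "length xs = n" by (metis card_lessThan distinct_card)
  have l1: "length (sorted_list_of_set I) = card I" using fin by simp
  show ?thesis
  proof (rule that[of "\<lambda>i. xs ! i"])
    show "bij_betw (\<lambda>i. xs ! i) {..<n} {..<n}"
      by (rule bij_betw_nth[OF d(1)]) (simp_all only: d(2) len)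
    have "(\<lambda>i. xs ! i) ` {0..<card I} = set (take (card I) xs)"
      using l1 by (intro nth_image) (simp add: xs_def)
    also have "take (card I) xs = sorted_list_of_set I" using l1 by (simp add: xs_def)
    finally show "(\<lambda>i. xs ! i) ` {..<card I} = I" using fin by (simp add: lessThan_atLeast0)
  qed (use False in simp)
qed

definition top_degree :: "nat \<Rightarrow> nat \<Rightarrow> nat \<Rightarrow> nat" where
  "top_degree m e n = (\<Sum>j<n. e - 1 + m * (n - 1 - j))"

text \<open>The exponent of the only standard monomial of degree \<open>M\<close> for \<open>I = {}\<close>.\<close>

definition top_exponent :: "nat \<Rightarrow> nat \<Rightarrow> nat \<Rightarrow> nat \<Rightarrow>\<^sub>0 nat" where
  "top_exponent m e n = (\<Sum>j<n. single j (e - 1 + m * (n - 1 - j)))"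

lemma x_deg_superset: "finite A \<Longrightarrow> keys \<alpha> \<subseteq> A \<Longrightarrow> x_deg \<alpha> = (\<Sum>i\<in>A. lookup \<alpha> i)"
  unfolding x_deg_def by (intro sum.mono_neutral_left) (auto simp: in_keys_iff)

lemma sum_single_lookup:
  assumes "finite A" "keys \<alpha> \<subseteq> A"
  shows "(\<Sum>i\<in>A. single i (lookup \<alpha> i)) = \<alpha>"
proof -
  have "(\<Sum>i\<in>A. single i (lookup \<alpha> i))
    = (\<Sum>i\<in>keys \<alpha>. single i (lookup \<alpha> i))"
    using assms by (intro sum.mono_neutral_right) (auto simp: in_keys_iff)
  then show ?thesis by (simp add: sum_single)
qed

text \<open>The variables are renumbered by \<open>\<pi>\<close> so that \<open>I\<close> becomes \<open>{0..<k}\<close>; then the polynomials killed by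
  the functional of \<open>I\<close> satisfy the assumptions of the locale \<open>straightening\<close>. For \<open>I = {}\<close> the renumbering
  is the identity, so that \<open>top_exponent\<close> keeps its meaning.\<close>

theorem harmonic_system_eq_0:
  assumes H: "harmonic_system m e n \<Psi>"
    and m: "1 \<le> m" and n: "1 \<le> n" and e: "1 \<le> e" "e \<le> m" "2 \<le> e \<or> m = 1"
    and deg: "top_degree m e n \<le> x_deg \<alpha> + fcard I"
    and top: "2 \<le> fcard I \<or> top_degree m e n < x_deg \<alpha> + fcard I \<or>
       (I = {||} \<and> \<Psi> (top_exponent m e n) I = 0)"
  shows "\<Psi> \<alpha> I = 0"
proof (rule ccontr)
  assume "\<Psi> \<alpha> I \<noteq> 0"
  then have supp: "keys \<alpha> \<subseteq> {..<n}" "fset I \<subseteq> {..<n}"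
    using harmonic_system_support[OF H] by auto
  define k where "k = fcard I"
  have kI: "card (fset I) = k" by (simp add: k_def fcard.rep_eq)
  have kn: "k \<le> n" using card_mono[OF _ supp(2)] kI by simp
  obtain \<pi> where \<pi>: "bij_betw \<pi> {..<n} {..<n}" "\<pi> ` {..<k} = fset I" "fset I = {} \<Longrightarrow> \<pi> = id"
    using enumeration_starting_with[OF supp(2)] kI by metis
  let ?N = "{F. pair F (\<lambda>\<alpha>. \<Psi> \<alpha> I) = 0}"
  have re_sum: "(\<Sum>j<n. h (\<pi> j)) = (\<Sum>j<n. h j)" for h :: "nat \<Rightarrow> mpoly"
    by (rule sum.reindex_bij_betw[OF \<pi>(1)])
  have re_prod: "(\<Prod>j<n. h (\<pi> j)) = (\<Prod>j<n. h j)" for h :: "nat \<Rightarrow> mpoly"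
    by (rule prod.reindex_bij_betw[OF \<pi>(1)])
  have inj: "inj_on \<pi> {..<n}" using \<pi>(1) by (rule bij_betw_imp_inj_on)
  have img: "\<pi> ` {..<n} = {..<n}" using \<pi>(1) by (rule bij_betw_imp_surj_on)
  have compl: "(\<Prod>l\<in>{j..<n}. h (\<pi> l)) = (\<Prod>l\<in>{..<n} - \<pi> ` {..<j}. h l)" if "j \<le> n"
    for h :: "nat \<Rightarrow> mpoly" and j
  proof -
    have "{..<n} - \<pi> ` {..<j} = \<pi> ` {..<n} - \<pi> ` {..<j}" by (simp add: img)
    also have "\<dots> = \<pi> ` ({..<n} - {..<j})"
      using inj that by (subst inj_on_image_set_diff[of \<pi> "{..<n}"]) auto
    also have "{..<n} - {..<j} = {j..<n}" by auto
    finally have "{..<n} - \<pi> ` {..<j} = \<pi> ` {j..<n}" .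
    then show ?thesis
      using inj_on_subset[OF inj, of "{j..<n}"] by (simp add: prod.reindex subset_eq)
  qed
  have low: "(\<Prod>l<j. h (\<pi> l)) = (\<Prod>l\<in>\<pi> ` {..<Suc j} - {\<pi> j}. h l)" if "j < n"
    for h :: "nat \<Rightarrow> mpoly" and j
  proof -
    have "\<pi> ` {..<Suc j} - {\<pi> j} = \<pi> ` ({..<Suc j} - {j})"
      using inj that by (subst inj_on_image_set_diff[of \<pi> "{..<n}"]) auto
    also have "{..<Suc j} - {j} = {..<j}" by auto
    finally show ?thesis
      using inj_on_subset[OF inj, of "{..<j}"] that by (simp add: prod.reindex subset_eq)
  qed
  interpret S: straightening "\<lambda>j. var (\<pi> j)" ?N m e n k
  proof
    show "f * (\<Sum>j<n. var (\<pi> j) ^ (m * r)) \<in> ?N" if "0 < r" for f r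
      using harmonic_system_pair[OF H power_sum_in_invariant_pairs[OF that], of f I]
      unfolding re_sum[of "\<lambda>j. var j ^ (m * r)"] by (simp only: mult.commute mem_Collect_eq)
    show "f * (\<Prod>j<n. var (\<pi> j) ^ e) \<in> ?N" for f
      using harmonic_system_pair[OF H power_prod_in_invariant_pairs, of f I]
      unfolding re_prod[of "\<lambda>j. var j ^ e"] by (simp only: mult.commute mem_Collect_eq)
    have sub: "\<pi> ` {..<j} \<subseteq> fset I" if "j \<le> k" for j using that \<pi>(2) by auto
    show "f * (var (\<pi> j) ^ (m - 1) * (\<Prod>l\<in>{Suc j..<n}. var (\<pi> j) ^ m - var (\<pi> l) ^ m)) \<in> ?N"
      if "j < k" for f j
      using witness_relation[OF H m _ sub[of "Suc j"] supp(2), of "\<pi> j" f] that kn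
      by (simp add: compl[of "Suc j" "\<lambda>l. var (\<pi> j) ^ m - var l ^ m"])
    show "f * (var (\<pi> 0) ^ (m - 1) * (\<Prod>l\<in>{2..<n}. var (\<pi> 0) ^ m - var (\<pi> l) ^ m)) \<in> ?N"
      if "2 \<le> k" for f
      using witness_relation[OF H m _ sub[of 2] supp(2), of "\<pi> 0" f] that kn
      by (simp add: compl[of 2 "\<lambda>l. var (\<pi> 0) ^ m - var l ^ m"])
    show "f * ((\<Prod>l<j. var (\<pi> l) ^ e) * var (\<pi> j) ^ (e - 1) *
        (\<Prod>l\<in>{Suc j..<n}. var (\<pi> j) ^ m - var (\<pi> l) ^ m)) \<in> ?N"
      if "j < k" for f j
      using witness_prod_relation[OF H m e(1,2) _ sub[of "Suc j"] supp(2), of "\<pi> j" f] that kn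
      by (simp add: compl[of "Suc j" "\<lambda>l. var (\<pi> j) ^ m - var l ^ m"] low[of j "\<lambda>l. var l ^ e"])
    show "f \<in> ?N" if "0 < c" "of_nat c * f \<in> ?N" for c and f :: mpoly
      using that unfolding mult.commute[of "of_nat c" f] by (simp add: pair_mult_of_nat)
    show "1 \<le> m" "1 \<le> n" "1 \<le> e" "e \<le> m" "2 \<le> e \<or> m = 1" "k \<le> n"
      by (rule m n e kn)+
    show "0 \<in> ?N" by simp
    show "f + g \<in> ?N" if "f \<in> ?N" "g \<in> ?N" for f g using that by (simp add: pair_add)
    show "- f \<in> ?N" if "f \<in> ?N" for f using that by (simp add: pair_uminus)
  qed
  have mon: "S.mon a = single (\<Sum>j<n. single (\<pi> j) (a j)) 1" for a
    unfolding S.mon_def var_power by (rule prod_single)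
  define a where "a j = lookup \<alpha> (\<pi> j)" for j
  have "(\<Sum>j<n. single (\<pi> j) (a j)) = (\<Sum>j<n. single j (lookup \<alpha> j))"
    unfolding a_def by (rule sum.reindex_bij_betw[OF \<pi>(1)])
  also have "\<dots> = \<alpha>" using supp(1) by (intro sum_single_lookup) auto
  finally have mon_a: "S.mon a = single \<alpha> 1" by (simp add: mon)
  have deg_a: "x_deg \<alpha> = (\<Sum>j<n. a j)"
    unfolding x_deg_superset[OF finite_lessThan supp(1)] a_def
    by (rule sum.reindex_bij_betw[OF \<pi>(1), symmetric])
  have "S.mon a \<in> ?N"
  proof (rule S.mon_in_N)
    show "(\<Sum>j<n. e - 1 + m * (n - 1 - j)) \<le> (\<Sum>j<n. a j) + k"
      using deg by (simp add: top_degree_def deg_a k_def)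
    have "S.mon (\<lambda>j. e - 1 + m * (n - 1 - j)) \<in> ?N" if "I = {||}" "\<Psi> (top_exponent m e n) I = 0"
    proof -
      have "\<pi> = id" using that \<pi>(3) by simp
      then show ?thesis using that unfolding mon by (simp add: top_exponent_def)
    qed
    then show "2 \<le> k \<or> (\<Sum>j<n. e - 1 + m * (n - 1 - j)) < (\<Sum>j<n. a j) + k \<or>
       (k = 0 \<and> S.mon (\<lambda>j. e - 1 + m * (n - 1 - j)) \<in> ?N)"
      using top unfolding top_degree_def deg_a k_def by auto
  qed
  then show False using \<open>\<Psi> \<alpha> I \<noteq> 0\<close> unfolding mon_a by simp
qed

section \<open>Closedness and potentials in top degree\<close>

lemma x_deg_add: "x_deg (\<alpha> + \<beta>) = x_deg \<alpha> + x_deg \<beta>"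
proof -
  let ?A = "keys \<alpha> \<union> keys \<beta>"
  have "keys (\<alpha> + \<beta>) \<subseteq> ?A" by (rule Poly_Mapping.keys_add)
  then show ?thesis by (simp add: x_deg_superset[of ?A] lookup_add sum.distrib)
qed

lemma x_deg_single [simp]: "x_deg (single i c) = c"
  by (subst x_deg_superset[of "{i}"]) auto

lemma keys_add_nat: "keys (\<alpha> + \<beta>) = keys \<alpha> \<union> keys \<beta>"
  for \<alpha> \<beta> :: "'a \<Rightarrow>\<^sub>0 nat"
  by (auto simp: in_keys_iff lookup_add)

lemma keys_decompose:
  fixes \<beta> :: "nat \<Rightarrow>\<^sub>0 nat"
  assumes "i \<in> keys \<beta>"
  shows "\<beta> = (\<beta> - single i 1) + single i 1"
  using assms by (intro poly_mapping_eqI) (auto simp: lookup_add lookup_minus lookup_single when_def in_keys_iff)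

text \<open>Euler's identity for homogeneous polynomials.\<close>

lemma invariant_pairs_euler:
  assumes "(F, dF) \<in> invariant_pairs m e n" "1 \<le> m" "1 \<le> e" "1 \<le> n"
  obtains c where "0 < c" "(\<Sum>j<n. dF j * var j) = F * of_nat c"
proof -
  have pow: "var j ^ (c - 1) * var j = var j ^ c" if "0 < c" for j c
    using that by (simp only: power_minus_mult)
  from assms(1) consider (sum) r where "0 < r" "F = (\<Sum>j<n. var j ^ (m * r))" "dF = (\<lambda>j. var j ^ (m * r - 1))"
    | (prod) "F = (\<Prod>j<n. var j ^ e)" "dF = (\<lambda>j. (\<Prod>l\<in>{..<n} - {j}. var l ^ e) * var j ^ (e - 1))"
    unfolding invariant_pairs_def by blast
  then show ?thesis
  proof cases
    case (sum r)
    have "0 < m * r" using sum(1) assms(2) by simp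
    then have "(\<Sum>j<n. dF j * var j) = F * of_nat 1" unfolding sum(2,3) by (simp only: pow of_nat_1 mult_1_right)
    then show ?thesis by (rule that[of 1, rotated]) simp
  next
    case prod
    have "dF j * var j = F" if "j < n" for j
    proof -
      have "0 < e" using assms(3) by simp
      have "F = var j ^ e * (\<Prod>l\<in>{..<n} - {j}. var l ^ e)"
        unfolding prod(1) using that by (intro prod.remove) auto
      then show ?thesis unfolding prod(2) pow[OF \<open>0 < e\<close>, of j, symmetric] by (simp only: mult_ac)
    qed
    then have "(\<Sum>j<n. dF j * var j) = (\<Sum>j<n. F)" by (intro sum.cong) auto
    also have "\<dots> = F * of_nat n" by (simp add: mult.commute)
    finally show ?thesis using assms(4) by (intro that[of n]) auto
  qed
qed

lemma pair_mult_var: "pair (F * var j) \<psi> = pair F (\<lambda>\<alpha>. \<psi> (\<alpha> + single j 1))"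
  by (simp add: var_def pair_mult_single)

lemma harmonic_system_shift:
  assumes "harmonic_system m e n \<Psi>" "(F, dF) \<in> invariant_pairs m e n"
  shows "pair F (\<lambda>\<alpha>. \<Psi> (\<alpha> + \<beta>) B) = 0"
    and "(\<Sum>j\<in>{..<n} - fset B. theta_sign {|j|} B * pair (dF j) (\<lambda>\<alpha>. \<Psi> (\<alpha> + \<beta>) (finsert j B))) = 0"
  using assms unfolding harmonic_system_def by fast+

lemma harmonic_systemI:
  assumes "\<And>\<alpha> B. \<Psi> \<alpha> B \<noteq> 0 \<Longrightarrow> keys \<alpha> \<subseteq> {..<n} \<and> fset B \<subseteq> {..<n}"
    and "\<And>F dF \<beta> B. (F, dF) \<in> invariant_pairs m e n \<Longrightarrow> pair F (\<lambda>\<alpha>. \<Psi> (\<alpha> + \<beta>) B) = 0"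
    and "\<And>F dF \<beta> B. (F, dF) \<in> invariant_pairs m e n \<Longrightarrow>
      (\<Sum>j\<in>{..<n} - fset B. theta_sign {|j|} B * pair (dF j) (\<lambda>\<alpha>. \<Psi> (\<alpha> + \<beta>) (finsert j B))) = 0"
  shows "harmonic_system m e n \<Psi>"
  unfolding harmonic_system_def
proof (intro conjI allI impI ballI)
  fix P assume "P \<in> invariant_pairs m e n"
  then show "case P of (F, dF) \<Rightarrow> \<forall>\<beta> B. pair F (\<lambda>\<alpha>. \<Psi> (\<alpha> + \<beta>) B) = 0 \<and>
      (\<Sum>j\<in>{..<n} - fset B. theta_sign {|j|} B * pair (dF j) (\<lambda>\<alpha>. \<Psi> (\<alpha> + \<beta>) (finsert j B))) = 0"
    using assms(2,3) by (cases P) simp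
qed (use assms(1) in blast)+

lemma harmonic_system_diff:
  assumes "harmonic_system m e n \<Psi>" "harmonic_system m e n \<Phi>"
  shows "harmonic_system m e n (\<lambda>\<alpha> B. \<Psi> \<alpha> B - c * \<Phi> \<alpha> B)"
proof (rule harmonic_systemI)
  show "keys \<alpha> \<subseteq> {..<n} \<and> fset B \<subseteq> {..<n}" if "\<Psi> \<alpha> B - c * \<Phi> \<alpha> B \<noteq> 0" for \<alpha> B
  proof -
    have "\<Psi> \<alpha> B \<noteq> 0 \<or> \<Phi> \<alpha> B \<noteq> 0" using that by auto
    then show ?thesis using assms harmonic_system_support by blast
  qed
  fix F dF \<beta> B assume F: "(F, dF) \<in> invariant_pairs m e n"
  show "pair F (\<lambda>\<alpha>. \<Psi> (\<alpha> + \<beta>) B - c * \<Phi> (\<alpha> + \<beta>) B) = 0"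
    by (simp add: pair_diff_right pair_cmult_right harmonic_system_shift(1)[OF assms(1) F]
        harmonic_system_shift(1)[OF assms(2) F])
  have "(\<Sum>j\<in>{..<n} - fset B. theta_sign {|j|} B *
         pair (dF j) (\<lambda>\<alpha>. \<Psi> (\<alpha> + \<beta>) (finsert j B) - c * \<Phi> (\<alpha> + \<beta>) (finsert j B)))
     = (\<Sum>j\<in>{..<n} - fset B. theta_sign {|j|} B * pair (dF j) (\<lambda>\<alpha>. \<Psi> (\<alpha> + \<beta>) (finsert j B)))
      - c * (\<Sum>j\<in>{..<n} - fset B. theta_sign {|j|} B * pair (dF j) (\<lambda>\<alpha>. \<Phi> (\<alpha> + \<beta>) (finsert j B)))"
    by (simp add: pair_diff_right pair_cmult_right right_diff_distrib sum_subtractf sum_distrib_left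
        mult.left_commute)
  then show "(\<Sum>j\<in>{..<n} - fset B. theta_sign {|j|} B *
         pair (dF j) (\<lambda>\<alpha>. \<Psi> (\<alpha> + \<beta>) (finsert j B) - c * \<Phi> (\<alpha> + \<beta>) (finsert j B))) = 0"
    by (simp only: harmonic_system_shift(2)[OF assms(1) F] harmonic_system_shift(2)[OF assms(2) F]
        mult_zero_right diff_zero)
qed

text \<open>The coefficients of the exterior derivative of the part of \<open>\<theta>\<close>-degree \<open>1\<close>.\<close>

definition curl :: "((nat \<Rightarrow>\<^sub>0 nat) \<Rightarrow> nat fset \<Rightarrow> complex) \<Rightarrow> (nat \<Rightarrow>\<^sub>0 nat) \<Rightarrow> nat fset \<Rightarrow> complex" where
  "curl \<Psi> \<beta> B = (if fcard B = 2
     then \<Psi> (\<beta> + single (Min (fset B)) 1) {|Max (fset B)|}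
        - \<Psi> (\<beta> + single (Max (fset B)) 1) {|Min (fset B)|}
     else 0)"

lemma curl_pair:
  assumes "i \<noteq> j"
  shows "theta_sign {|i|} {|j|} * curl \<Psi> \<beta> {|i, j|}
     = \<Psi> (\<beta> + single i 1) {|j|} - \<Psi> (\<beta> + single j 1) {|i|}"
proof -
  have "fcard {|i, j|} = 2" using assms by (simp add: fcard_finsert_if)
  moreover have "theta_sign {|i|} {|j|} = (if j < i then - 1 else 1)"
  proof -
    have "{(a, b). a = i \<and> b = j \<and> b < a} = (if j < i then {(i, j)} else {})" by auto
    then show ?thesis using assms by (simp add: theta_sign_def)
  qed
  ultimately show ?thesis using assms
    by (cases "i < j") (auto simp: curl_def min_def max_def)
qed

lemma fcard_1_elim:
  assumes "fcard B = 1"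
  obtains b where "B = {|b|}"
proof -
  obtain b where "fset B = {b}" using assms unfolding fcard.rep_eq by (rule card_1_singletonE)
  then have "B = {|b|}" by (metis fset_inject finsert.rep_eq bot_fset.rep_eq)
  then show ?thesis by (rule that)
qed

text \<open>Contracting the relation for \<open>dF\<close> with the exterior derivative produces, besides a relation for \<open>\<Psi>\<close>
  itself, the term \<open>\<Sum>\<^sub>j dF\<^sub>j x\<^sub>j\<close>, which is a multiple of \<open>F\<close> by Euler's identity.\<close>

lemma harmonic_system_curl:
  assumes H: "harmonic_system m e n \<Psi>" and pos: "1 \<le> m" "1 \<le> e" "1 \<le> n"
  shows "harmonic_system m e n (curl \<Psi>)"
proof (rule harmonic_systemI)
  fix \<alpha> B assume nz: "curl \<Psi> \<alpha> B \<noteq> 0"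
  let ?a = "Min (fset B)" and ?b = "Max (fset B)"
  have card: "fcard B = 2" using nz by (auto simp: curl_def split: if_splits)
  then have ne: "fset B \<noteq> {}" by (auto simp: fcard.rep_eq)
  have "\<Psi> (\<alpha> + single ?a 1) {|?b|} \<noteq> 0 \<or> \<Psi> (\<alpha> + single ?b 1) {|?a|} \<noteq> 0"
    using nz card by (auto simp: curl_def)
  then have "keys \<alpha> \<subseteq> {..<n} \<and> ?b < n"
  proof
    assume "\<Psi> (\<alpha> + single ?a 1) {|?b|} \<noteq> 0"
    from harmonic_system_support[OF H this] show ?thesis by (simp add: keys_add_nat)
  next
    assume "\<Psi> (\<alpha> + single ?b 1) {|?a|} \<noteq> 0"
    from harmonic_system_support[OF H this] show ?thesis by (simp add: keys_add_nat)
  qed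
  moreover have "b \<le> ?b" if "b \<in> fset B" for b using that by simp
  ultimately show "keys \<alpha> \<subseteq> {..<n} \<and> fset B \<subseteq> {..<n}"
    by (meson lessThan_iff order_le_less_trans subsetI)
next
  fix F dF \<beta> B assume F: "(F, dF) \<in> invariant_pairs m e n"
  have "pair F (\<lambda>\<alpha>. \<Psi> (\<alpha> + \<beta> + \<gamma>) C) = 0" for \<gamma> C
    using harmonic_system_shift(1)[OF H F, of "\<beta> + \<gamma>" C] by (simp add: add.assoc)
  then show "pair F (\<lambda>\<alpha>. curl \<Psi> (\<alpha> + \<beta>) B) = 0"
    by (cases "fcard B = 2") (simp_all add: curl_def pair_diff_right)
  show "(\<Sum>j\<in>{..<n} - fset B. theta_sign {|j|} B * pair (dF j) (\<lambda>\<alpha>. curl \<Psi> (\<alpha> + \<beta>) (finsert j B))) = 0"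
  proof (cases "fcard B = 1")
    case False
    have "curl \<Psi> (\<alpha> + \<beta>) (finsert j B) = 0" if "j \<notin> fset B" for \<alpha> j
      using that False by (simp add: curl_def fcard_finsert_if)
    then show ?thesis by (intro sum.neutral) simp
  next
    case True
    then obtain b where B: "B = {|b|}" by (rule fcard_1_elim)
    obtain c where c: "0 < c" "(\<Sum>j<n. dF j * var j) = F * of_nat c"
      using invariant_pairs_euler[OF F pos] .
    let ?e = "\<lambda>i. single i (1::nat)"
    have "(\<Sum>j\<in>{..<n} - fset B. theta_sign {|j|} B * pair (dF j) (\<lambda>\<alpha>. curl \<Psi> (\<alpha> + \<beta>) (finsert j B)))
       = (\<Sum>j\<in>{..<n} - {b}. pair (dF j) (\<lambda>\<alpha>. \<Psi> (\<alpha> + \<beta> + ?e j) {|b|} - \<Psi> (\<alpha> + \<beta> + ?e b) {|j|}))"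
      unfolding B by (rule sum.cong) (auto simp: curl_pair simp flip: pair_cmult_right)
    also have "\<dots> = (\<Sum>j<n. pair (dF j) (\<lambda>\<alpha>. \<Psi> (\<alpha> + \<beta> + ?e j) {|b|} - \<Psi> (\<alpha> + \<beta> + ?e b) {|j|}))"
      by (rule sum.mono_neutral_left) auto
    also have "\<dots> = pair (\<Sum>j<n. dF j * var j) (\<lambda>\<alpha>. \<Psi> (\<alpha> + \<beta>) {|b|})
        - (\<Sum>j<n. pair (dF j) (\<lambda>\<alpha>. \<Psi> (\<alpha> + (\<beta> + ?e b)) {|j|}))"
      by (simp add: pair_diff_right sum_subtractf pair_sum pair_mult_var add.assoc
          add.commute[of \<beta>])
    also have "\<dots> = 0"
      using harmonic_system_shift(1)[OF H F, of \<beta> "{|b|}"]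
        harmonic_system_shift(2)[OF H F, of "{||}" "\<beta> + ?e b"]
      by (simp add: c(2) pair_mult_of_nat)
    finally show ?thesis .
  qed
qed

text \<open>The curl has \<open>\<theta>\<close>-degree \<open>2\<close> and total degree \<open>M\<close>, so it vanishes by \<open>harmonic_system_eq_0\<close>, and \<open>\<Psi>\<close> has
  a potential \<open>\<zeta>\<close>. A shifted \<open>\<zeta>\<close> is a coefficient of \<open>\<Psi>\<close> and inherits its relations; for \<open>\<zeta>\<close> itself, the relation
  for \<open>F\<close> follows from the one for \<open>dF\<close> by Euler's identity.\<close>

lemma harmonic_system_potential:
  assumes H: "harmonic_system m e n \<Psi>"
    and m: "1 \<le> m" and n: "1 \<le> n" and e: "1 \<le> e" "e \<le> m" "2 \<le> e \<or> m = 1"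
    and deg: "\<And>\<alpha> i. \<Psi> \<alpha> {|i|} \<noteq> 0 \<Longrightarrow> x_deg \<alpha> + 1 = top_degree m e n"
  obtains \<zeta> where "\<And>\<alpha> i. i < n \<Longrightarrow> \<Psi> \<alpha> {|i|} = \<zeta> (\<alpha> + single i 1)"
    and "harmonic_system m e n (\<lambda>\<alpha> B. if B = {||} then \<zeta> \<alpha> else 0)"
proof -
  let ?e = "\<lambda>i. single i (1::nat)"
  \<comment> \<open>if the degree of \<open>\<beta>\<close> is not \<open>M - 2\<close>, both sides are zero by homogeneity\<close>
  have closed: "\<Psi> (\<beta> + ?e i) {|j|} = \<Psi> (\<beta> + ?e j) {|i|}" for \<beta> i j
  proof (cases "i = j \<or> x_deg \<beta> + 2 \<noteq> top_degree m e n")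
    case True
    moreover have "\<Psi> (\<beta> + ?e i) {|j|} = 0" if "x_deg \<beta> + 2 \<noteq> top_degree m e n" for i j
      using deg[of "\<beta> + ?e i" j] that by (auto simp: x_deg_add)
    ultimately show ?thesis by metis
  next
    case False
    then have "fcard {|i, j|} = 2" by (simp add: fcard_finsert_if)
    then have "curl \<Psi> \<beta> {|i, j|} = 0"
      using False by (intro harmonic_system_eq_0[OF harmonic_system_curl[OF H m e(1) n] m n e]) auto
    then show ?thesis using curl_pair[of i j \<Psi> \<beta>] False by simp
  qed
  \<comment> \<open>any index of \<open>\<gamma>\<close> would do, by closedness; the choice only has to be a function of \<open>\<gamma>\<close>\<close>
  define \<zeta> where "\<zeta> \<gamma> = (if keys \<gamma> \<subseteq> {..<n} \<and> keys \<gamma> \<noteq> {}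
      then \<Psi> (\<gamma> - ?e (Min (keys \<gamma>))) {|Min (keys \<gamma>)|} else 0)" for \<gamma>
  have \<zeta>: "\<Psi> \<alpha> {|i|} = \<zeta> (\<alpha> + ?e i)" if i: "i < n" for \<alpha> i
  proof (cases "keys \<alpha> \<subseteq> {..<n}")
    case False
    then show ?thesis using harmonic_system_support[OF H, of \<alpha> "{|i|}"]
      by (auto simp: \<zeta>_def keys_add_nat)
  next
    case True
    let ?l = "Min (keys (\<alpha> + ?e i))"
    have "?l \<in> keys (\<alpha> + ?e i)" by (intro Min_in) (auto simp: keys_add_nat)
    then have l: "?l = i \<or> ?l \<in> keys \<alpha>" by (auto simp: keys_add_nat)
    have "\<zeta> (\<alpha> + ?e i) = \<Psi> (\<alpha> + ?e i - ?e ?l) {|?l|}"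
      using True i by (auto simp: \<zeta>_def keys_add_nat)
    also have "\<dots> = \<Psi> \<alpha> {|i|}"
    proof (cases "?l = i")
      case False
      then have a: "\<alpha> = (\<alpha> - ?e ?l) + ?e ?l" using l by (intro keys_decompose) auto
      define \<beta> where "\<beta> = \<alpha> - ?e ?l"
      define l where "l = ?l"
      have "\<alpha> = \<beta> + ?e l" using a by (simp only: \<beta>_def l_def)
      moreover have "\<beta> + ?e l + ?e i - ?e l = \<beta> + ?e i"
        by (simp only: add.assoc add.commute[of "?e l"]) (simp only: add_diff_cancel_right' flip: add.assoc)
      ultimately show ?thesis
        using closed[of \<beta> i l] unfolding l_def[symmetric] by (simp only:)
    qed simp
    finally show ?thesis by simp
  qed
  have \<zeta>_supp: "keys \<gamma> \<subseteq> {..<n}" if "\<zeta> \<gamma> \<noteq> 0" for \<gamma>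
    using that by (auto simp: \<zeta>_def split: if_splits)
  have pairF: "pair F (\<lambda>\<alpha>. \<zeta> (\<alpha> + \<beta>)) = 0" if F: "(F, dF) \<in> invariant_pairs m e n" for F dF \<beta>
  proof (cases "\<beta> = 0")
    case True
    obtain c where c: "0 < c" "(\<Sum>j<n. dF j * var j) = F * of_nat c"
      using invariant_pairs_euler[OF F m e(1) n] .
    have "of_nat c * pair F \<zeta> = pair (\<Sum>j<n. dF j * var j) \<zeta>"
      by (simp add: c(2) pair_mult_of_nat)
    also have "\<dots> = (\<Sum>j<n. pair (dF j) (\<lambda>\<alpha>. \<Psi> \<alpha> {|j|}))"
      by (simp add: pair_sum pair_mult_var \<zeta>)
    also have "\<dots> = 0" using harmonic_system_shift(2)[OF H F, of "{||}" 0] by simp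
    finally show ?thesis using c(1) True by simp
  next
    case False
    then obtain i where i: "i \<in> keys \<beta>" by fastforce
    show ?thesis
    proof (cases "i < n")
      case True
      have "\<zeta> (\<alpha> + \<beta>) = \<Psi> (\<alpha> + (\<beta> - ?e i)) {|i|}" for \<alpha>
      proof -
        have "\<alpha> + (\<beta> - ?e i) + ?e i = \<alpha> + \<beta>"
          using keys_decompose[OF i] by (simp only: add.assoc)
        then show ?thesis using \<zeta>[OF True, of "\<alpha> + (\<beta> - ?e i)"] by (simp only:)
      qed
      then show ?thesis by (simp add: harmonic_system_shift(1)[OF H F])
    next
      case False
      then have "\<zeta> (\<alpha> + \<beta>) = 0" for \<alpha> using \<zeta>_supp[of "\<alpha> + \<beta>"] i by (auto simp: keys_add_nat)
      then show ?thesis by simp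
    qed
  qed
  have "harmonic_system m e n (\<lambda>\<alpha> B. if B = {||} then \<zeta> \<alpha> else 0)"
  proof (rule harmonic_systemI)
    show "keys \<alpha> \<subseteq> {..<n} \<and> fset B \<subseteq> {..<n}"
      if "(if B = {||} then \<zeta> \<alpha> else 0) \<noteq> 0" for \<alpha> B
      using that \<zeta>_supp by (auto split: if_splits)
    show "pair F (\<lambda>\<alpha>. if B = {||} then \<zeta> (\<alpha> + \<beta>) else 0) = 0"
      if "(F, dF) \<in> invariant_pairs m e n" for F dF \<beta> B
      using pairF[OF that] by (cases "B = {||}") auto
  qed simp
  with \<zeta> show ?thesis by (rule that)
qed

section \<open>Jets of forms\<close>

text \<open>The coefficients multiplied by the factorials of their exponents, which makes partial derivatives act
  as shifts.\<close>

definition jet :: "form \<Rightarrow> (nat \<Rightarrow>\<^sub>0 nat) \<Rightarrow> nat fset \<Rightarrow> complex" where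
  "jet \<eta> \<beta> B = of_nat (\<Prod>i\<in>keys \<beta>. fact (lookup \<beta> i)) * lookup \<eta> (\<beta>, B)"

lemma jet_eq_0_iff: "jet \<eta> \<beta> B = 0 \<longleftrightarrow> lookup \<eta> (\<beta>, B) = 0"
  by (simp add: jet_def)

lemma form_eqI: "(\<And>\<beta> B. jet \<eta> \<beta> B = jet \<kappa> \<beta> B) \<Longrightarrow> \<eta> = \<kappa>"
proof (rule poly_mapping_eqI)
  fix k :: monom_form
  assume *: "\<And>\<beta> B. jet \<eta> \<beta> B = jet \<kappa> \<beta> B"
  obtain \<beta> B where "k = (\<beta>, B)" by (cases k)
  then show "lookup \<eta> k = lookup \<kappa> k"
    using *[of \<beta> B] by (simp add: jet_def)
qed

lemma jet_0 [simp]: "jet 0 \<beta> B = 0" by (simp add: jet_def)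

lemma jet_add: "jet (\<eta> + \<kappa>) \<beta> B = jet \<eta> \<beta> B + jet \<kappa> \<beta> B"
  by (simp add: jet_def lookup_add distrib_left)

lemma jet_sum: "jet (sum F A) \<beta> B = (\<Sum>a\<in>A. jet (F a) \<beta> B)"
  by (induction A rule: infinite_finite_induct) (auto simp: jet_add)

lemma lookup_scale_form [simp]: "lookup (scale_form c f) k = c * lookup f k"
  by (simp add: scale_form_def Poly_Mapping.map.rep_eq when_def)

lemma jet_scale_form: "jet (scale_form c f) \<beta> B = c * jet f \<beta> B"
  by (simp add: jet_def)

lemma prod_fact_superset:
  "finite A \<Longrightarrow> keys \<beta> \<subseteq> A \<Longrightarrow>
    (\<Prod>i\<in>keys \<beta>. fact (lookup \<beta> i)) = (\<Prod>i\<in>A. fact (lookup \<beta> i) :: nat)"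
  by (intro prod.mono_neutral_left) (auto simp: in_keys_iff)

lemma prod_fact_add_single:
  "(\<Prod>j\<in>keys (\<beta> + single i 1). fact (lookup (\<beta> + single i 1) j))
     = (Suc (lookup \<beta> i)) * (\<Prod>j\<in>keys \<beta>. fact (lookup \<beta> j) :: nat)"
proof -
  let ?A = "insert i (keys \<beta>)"
  have "(\<Prod>j\<in>?A. fact (lookup (\<beta> + single i 1) j))
      = fact (Suc (lookup \<beta> i)) * (\<Prod>j\<in>?A - {i}. fact (lookup \<beta> j) :: nat)"
  proof -
    have "(\<Prod>j\<in>?A - {i}. fact (lookup (\<beta> + single i 1) j) :: nat)
        = (\<Prod>j\<in>?A - {i}. fact (lookup \<beta> j))"
      by (intro prod.cong) (auto simp: lookup_add lookup_single)
    moreover have "lookup (\<beta> + single i 1) i = Suc (lookup \<beta> i)"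
      by (simp add: lookup_add)
    moreover note prod.remove[of ?A i "\<lambda>j. fact (lookup (\<beta> + single i 1) j) :: nat"]
    ultimately show ?thesis by (simp only: finite_insert finite_keys insertI1 simp_thms)
  qed
  also have "\<dots> = Suc (lookup \<beta> i) * (\<Prod>j\<in>?A. fact (lookup \<beta> j))"
    using prod.remove[of ?A i "\<lambda>j. fact (lookup \<beta> j) :: nat"]
    by (simp add: algebra_simps)
  finally show ?thesis
    by (simp add: keys_add_nat insert_commute prod_fact_superset[of ?A] subset_insertI)
qed

lemma lookup_lin_ext:
  "lookup (lin_ext b f) k
     = (\<Sum>l\<in>keys f. lookup f l * lookup (b l) k)"
  by (simp add: lin_ext_def lookup_sum)

lemma lin_ext_add: "lin_ext b (f + g) = lin_ext b f + lin_ext b g"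
proof (rule poly_mapping_eqI)
  fix k
  let ?A = "keys f \<union> keys g"
  have sup: "lookup (lin_ext b h) k = (\<Sum>l\<in>?A. lookup h l * lookup (b l) k)"
    if "keys h \<subseteq> ?A" for h
    unfolding lookup_lin_ext using that by (intro sum.mono_neutral_left) (auto simp: in_keys_iff)
  have "keys (f + g) \<subseteq> ?A" by (rule Poly_Mapping.keys_add)
  then show "lookup (lin_ext b (f + g)) k = lookup (lin_ext b f + lin_ext b g) k"
    by (simp add: sup lookup_add distrib_right sum.distrib)
qed

lemma lin_ext_0 [simp]: "lin_ext b 0 = 0" by (simp add: lin_ext_def)

lemma lin_ext_sum: "lin_ext b (sum F A) = (\<Sum>a\<in>A. lin_ext b (F a))"
  by (induction A rule: infinite_finite_induct) (auto simp: lin_ext_add)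

lemma lin_ext_single: "lin_ext b (single k c) = scale_form c (b k)"
  by (rule poly_mapping_eqI) (simp add: lookup_lin_ext)

lemma lookup_partial_x:
  "lookup (partial_x i f) (\<beta>, B)
     = of_nat (Suc (lookup \<beta> i)) * lookup f (\<beta> + single i 1, B)"
proof -
  let ?e = "single i (1::nat)"
  let ?h = "\<lambda>l. lookup f l * lookup (case l of (\<alpha>, I) \<Rightarrow>
      single (\<alpha> - ?e, I) (of_nat (lookup \<alpha> i))) (\<beta>, B)"
  have zero: "?h l = 0" if "l \<noteq> (\<beta> + ?e, B)" for l
  proof (cases l)
    case (Pair \<alpha> I)
    have "\<alpha> = \<beta> + ?e" if "\<alpha> - ?e = \<beta>" "lookup \<alpha> i \<noteq> 0"
      using keys_decompose[of i \<alpha>] that by (simp add: in_keys_iff)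
    then show ?thesis using that Pair by (auto simp: lookup_single when_def)
  qed
  have "lookup (partial_x i f) (\<beta>, B) = (\<Sum>l\<in>keys f. ?h l)"
    by (simp add: partial_x_def lookup_lin_ext)
  also have "\<dots> = (\<Sum>l\<in>{(\<beta> + ?e, B)}. ?h l)"
    by (rule sum.mono_neutral_cong) (use zero in \<open>auto simp: in_keys_iff\<close>)
  finally show ?thesis by (simp add: lookup_add mult.commute)
qed

lemma jet_partial_x: "jet (partial_x i f) \<beta> B = jet f (\<beta> + single i 1) B"
  unfolding jet_def lookup_partial_x prod_fact_add_single of_nat_mult by (simp only: mult_ac)

lemma theta_sign_single_left:
  "theta_sign {|i|} B = (if i |\<in>| B then 0 else (- 1) ^ card {j. j |\<in>| B \<and> j < i})"
proof -
  have "{(a, j). a |\<in>| {|i|} \<and> j |\<in>| B \<and> j < a} = Pair i ` {j. j |\<in>| B \<and> j < i}" by auto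
  then have "card {(a, j). a |\<in>| {|i|} \<and> j |\<in>| B \<and> j < a} = card {j. j |\<in>| B \<and> j < i}"
    by (simp add: card_image inj_on_def)
  then show ?thesis by (auto simp: theta_sign_def)
qed

lemma jet_partial_theta: "jet (partial_theta i f) \<beta> B = theta_sign {|i|} B * jet f \<beta> (finsert i B)"
proof -
  let ?h = "\<lambda>l. lookup f l * lookup (case l of (\<alpha>, I) \<Rightarrow>
     if i |\<in>| I then single (\<alpha>, I |-| {|i|}) ((- 1) ^ card {j. j |\<in>| I \<and> j < i}) else 0) (\<beta>, B)"
  have zero: "?h l = 0" if "l \<noteq> (\<beta>, finsert i B)" for l
    using that by (cases l) (auto simp: lookup_single when_def)
  have "lookup (partial_theta i f) (\<beta>, B) = (\<Sum>l\<in>keys f. ?h l)"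
    by (simp add: partial_theta_def lookup_lin_ext)
  also have "\<dots> = (\<Sum>l\<in>{(\<beta>, finsert i B)}. ?h l)"
    by (rule sum.mono_neutral_cong) (use zero in \<open>auto simp: in_keys_iff\<close>)
  also have "\<dots> = theta_sign {|i|} B * lookup f (\<beta>, finsert i B)"
  proof (cases "i |\<in>| B")
    case True
    then have "finsert i B |-| {|i|} \<noteq> B" by auto
    then show ?thesis using True by (simp add: theta_sign_single_left lookup_single)
  next
    case False
    then have "finsert i B |-| {|i|} = B" by auto
    moreover have "{j. (j = i \<or> j |\<in>| B) \<and> j < i} = {j. j |\<in>| B \<and> j < i}" by auto
    ultimately show ?thesis using False by (simp add: theta_sign_single_left)
  qed
  finally show ?thesis by (simp add: jet_def)
qed

lemma jet_fold_partial_theta: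
  assumes "sorted_wrt (<) js"
  shows "jet (fold partial_theta js \<eta>) \<beta> B
     = theta_sign (fset_of_list js) B * jet \<eta> \<beta> (fset_of_list js |\<union>| B)"
  using assms
proof (induction js arbitrary: \<eta>)
  case (Cons i js)
  let ?I = "fset_of_list js"
  have lt: "\<forall>j\<in>set js. i < j" using Cons.prems by simp
  then have *: "{j. j |\<in>| ?I \<and> j < i} = {}" "i |\<notin>| ?I"
    by (auto simp: fset_of_list_elem)
  have "theta_sign {|i|} ?I = 1" unfolding theta_sign_single_left *(1) using *(2) by simp
  with theta_sign_cocycle[of "{|i|}" ?I B]
  have "theta_sign (finsert i ?I) B = theta_sign ?I B * theta_sign {|i|} (?I |\<union>| B)" by simp
  then show ?case using Cons by (simp add: jet_partial_theta)
qed simp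

lemma jet_funpow_partial_x:
  "jet ((partial_x i ^^ c) f) \<beta> B = jet f (\<beta> + single i c) B"
proof (induction c arbitrary: \<beta>)
  case (Suc c)
  have "\<beta> + single i 1 + single i c = \<beta> + single i (Suc c)"
    by (simp add: add.assoc flip: Poly_Mapping.single_add)
  then show ?case using Suc by (simp add: jet_partial_x)
qed simp

lemma jet_foldr_partial_x:
  "jet (foldr (\<lambda>i. partial_x i ^^ a i) js f) \<beta> B = jet f (\<beta> + (\<Sum>i\<leftarrow>js. single i (a i))) B"
  by (induction js arbitrary: \<beta>) (simp_all add: jet_funpow_partial_x add.assoc)

lemma sum_list_single_keys:
  "(\<Sum>i\<leftarrow>sorted_list_of_set (keys \<alpha>). single i (lookup \<alpha> i)) = \<alpha>"
  for \<alpha> :: "nat \<Rightarrow>\<^sub>0 nat"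
  using sum_single_lookup[of "keys \<alpha>" \<alpha>] by (simp add: sum_list_distinct_conv_sum_set)

lemma fset_of_sorted_list: "fset_of_list (sorted_list_of_fset I) = I"
  by (rule fset_eqI) (simp add: fset_of_list_elem)

text \<open>An operator \<open>\<partial>\<^sub>\<omega>\<close> shifts jets by the monomials of \<open>\<omega>\<close>. The order of the factors \<open>\<partial>\<^sub>\<theta>\<close> in \<open>\<partial>\<^sub>\<omega>\<close> makes the
  sign that of the product \<open>\<theta>\<^sub>I \<theta>\<^sub>B\<close>.\<close>

lemma jet_partial_form:
  "jet (partial_form \<omega> \<eta>) \<beta> B
     = (\<Sum>k\<in>keys \<omega>. cnj (lookup \<omega> k) *
          (theta_sign (snd k) B * jet \<eta> (fst k + \<beta>) (snd k |\<union>| B)))"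
  unfolding partial_form_def jet_sum case_prod_unfold
  by (intro sum.cong refl)
    (simp add: jet_scale_form jet_foldr_partial_x sum_list_single_keys jet_fold_partial_theta
      sorted_list_of_fset.rep_eq fset_of_sorted_list[unfolded sorted_list_of_fset.rep_eq] add.commute)

lemma partial_form_superset:
  assumes "finite A" "keys \<omega> \<subseteq> A"
  shows "jet (partial_form \<omega> \<eta>) \<beta> B
     = (\<Sum>k\<in>A. cnj (lookup \<omega> k) *
          (theta_sign (snd k) B * jet \<eta> (fst k + \<beta>) (snd k |\<union>| B)))"
  unfolding jet_partial_form using assms by (intro sum.mono_neutral_left) (auto simp: in_keys_iff)

lemma partial_form_add: "partial_form (\<omega> + \<kappa>) \<eta> = partial_form \<omega> \<eta> + partial_form \<kappa> \<eta>"
proof (rule form_eqI)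
  fix \<beta> B
  let ?A = "keys \<omega> \<union> keys \<kappa>"
  have "keys (\<omega> + \<kappa>) \<subseteq> ?A" by (rule Poly_Mapping.keys_add)
  then show "jet (partial_form (\<omega> + \<kappa>) \<eta>) \<beta> B = jet (partial_form \<omega> \<eta> + partial_form \<kappa> \<eta>) \<beta> B"
    by (simp add: jet_add partial_form_superset[of ?A] lookup_add distrib_right sum.distrib)
qed

lemma partial_form_0_left [simp]: "partial_form 0 \<eta> = 0"
  by (simp add: partial_form_def)

lemma partial_form_sum: "partial_form (sum F A) \<eta> = (\<Sum>a\<in>A. partial_form (F a) \<eta>)"
  by (induction A rule: infinite_finite_induct) (auto simp: partial_form_add)

lemma jet_partial_form_single:
  "jet (partial_form (single (\<alpha>, I) c) \<eta>) \<beta> B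
     = cnj c * (theta_sign I B * jet \<eta> (\<alpha> + \<beta>) (I |\<union>| B))"
  by (subst partial_form_superset[of "{(\<alpha>, I)}"]) auto

lemma partial_form_0_right [simp]: "partial_form \<omega> 0 = 0"
  by (rule form_eqI) (simp add: jet_partial_form)

lemma partial_form_add_right: "partial_form \<omega> (\<eta> + \<kappa>) = partial_form \<omega> \<eta> + partial_form \<omega> \<kappa>"
  by (rule form_eqI) (simp add: jet_partial_form jet_add distrib_left sum.distrib)

lemma partial_form_scale_right: "partial_form \<omega> (scale_form c \<eta>) = scale_form c (partial_form \<omega> \<eta>)"
  by (rule form_eqI) (simp add: jet_partial_form jet_scale_form sum_distrib_left mult.left_commute)

lemma partial_form_sum_right: "partial_form \<omega> (sum F A) = (\<Sum>a\<in>A. partial_form \<omega> (F a))"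
  by (induction A rule: infinite_finite_induct) (auto simp: partial_form_add_right)

text \<open>The reversed order of the theta derivatives makes \<open>\<omega> \<mapsto> \<partial>\<^sub>\<omega>\<close> reverse products.\<close>

lemma partial_form_mult: "partial_form (\<omega> \<star> \<kappa>) \<eta> = partial_form \<kappa> (partial_form \<omega> \<eta>)"
proof -
  have single: "partial_form (single k a \<star> single l b) \<eta>
      = partial_form (single l b) (partial_form (single k a) \<eta>)"
    for k l :: monom_form and a b
  proof (cases k; cases l; rule form_eqI)
    fix \<alpha> I \<gamma> J \<beta> B assume k: "k = (\<alpha>, I)" "l = (\<gamma>, J)"
    have "theta_sign I J * theta_sign (I |\<union>| J) B = theta_sign J B * theta_sign I (J |\<union>| B)"
      by (rule theta_sign_cocycle)
    moreover have "cnj (theta_sign I J) = theta_sign I J" by (simp add: theta_sign_def)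
    ultimately show "jet (partial_form (single k a \<star> single l b) \<eta>) \<beta> B
      = jet (partial_form (single l b) (partial_form (single k a) \<eta>)) \<beta> B"
      by (simp add: k form_mult_single jet_partial_form_single add.assoc funion_assoc mult_ac)
  qed
  let ?e = "\<lambda>f :: form. \<Sum>k \<in> keys f. single k (lookup f k)"
  have "partial_form (?e \<omega> \<star> ?e \<kappa>) \<eta> = partial_form (?e \<kappa>) (partial_form (?e \<omega>) \<eta>)"
    unfolding form_mult_sum_left form_mult_sum_right partial_form_sum partial_form_sum_right single
    by (rule sum.swap)
  then show ?thesis unfolding sum_single .
qed

section \<open>Harmonicity as annihilation by invariants\<close>

lemma theta_sign_commute:
  "theta_sign I J = (- 1) ^ (fcard I * fcard J) * theta_sign J I"
proof (cases "I |\<inter>| J = {||}")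
  case True
  let ?A = "{(i, j). i |\<in>| I \<and> j |\<in>| J \<and> j < i}" and ?B = "{(j, i). j |\<in>| J \<and> i |\<in>| I \<and> i < j}"
  have "card (fset I \<times> fset J) = card (?A \<union> prod.swap ` ?B)"
  proof (intro arg_cong[of _ _ card] equalityI subsetI)
    fix p assume p: "p \<in> fset I \<times> fset J"
    obtain i j where ij: "p = (i, j)" by (cases p)
    have "i \<noteq> j" using True p ij by auto
    then have "j < i \<or> i < j" by auto
    then show "p \<in> ?A \<union> prod.swap ` ?B"
      using p ij by (auto simp: image_iff)
  qed auto
  also have "\<dots> = card ?A + card (prod.swap ` ?B)"
    using finite_inversions[of I J] finite_inversions[of J I] by (intro card_Un_disjoint) auto
  also have "card (prod.swap ` ?B) = card ?B" by (intro card_image) auto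
  finally have "fcard I * fcard J = card ?A + card ?B"
    by (simp add: fcard.rep_eq card_cartesian_product)
  then show ?thesis using True
    by (simp add: theta_sign_def inf_commute power_add flip: power_mult_distrib)
next
  case False
  then show ?thesis by (simp add: theta_sign_def inf_commute)
qed

text \<open>This turns multiples of a bihomogeneous form on the left into multiples on the right.\<close>

lemma super_commute:
  assumes "bihomogeneous i k \<omega>"
  shows "single (\<alpha>, I) c \<star> \<omega> = \<omega> \<star> single (\<alpha>, I) ((- 1) ^ (fcard I * k) * c)"
proof -
  have "single (\<alpha>, I) c \<star> single l (lookup \<omega> l)
     = single l (lookup \<omega> l) \<star> single (\<alpha>, I) ((- 1) ^ (fcard I * k) * c)"
    if "l \<in> keys \<omega>" for l
  proof -
    obtain \<gamma> J where l: "l = (\<gamma>, J)" by (cases l)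
    have "fcard J = k" using assms that l by (auto simp: bihomogeneous_def)
    then have "theta_sign I J = (- 1) ^ (fcard I * k) * theta_sign J I"
      using theta_sign_commute[of I J] by simp
    then show ?thesis by (simp add: l form_mult_single add.commute sup_commute mult_ac)
  qed
  then have "single (\<alpha>, I) c \<star> (\<Sum>l\<in>keys \<omega>. single l (lookup \<omega> l))
     = (\<Sum>l\<in>keys \<omega>. single l (lookup \<omega> l))
        \<star> single (\<alpha>, I) ((- 1) ^ (fcard I * k) * c)"
    unfolding form_mult_sum_left form_mult_sum_right by (rule sum.cong[OF refl])
  then show ?thesis unfolding sum_single .
qed

lemma partial_form_left_mult_eq_0:
  assumes "bihomogeneous i k \<omega>" "partial_form \<omega> \<eta> = 0"
  shows "partial_form (\<kappa> \<star> \<omega>) \<eta> = 0"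
proof -
  have "partial_form (single l c \<star> \<omega>) \<eta> = 0" for l c
    using assms by (cases l) (simp add: super_commute partial_form_mult)
  then have "partial_form ((\<Sum>l\<in>keys \<kappa>. single l (lookup \<kappa> l)) \<star> \<omega>) \<eta> = 0"
    by (simp add: form_mult_sum_left partial_form_sum)
  then show ?thesis unfolding sum_single .
qed

text \<open>The forms \<open>\<omega>\<close> for which every \<open>\<kappa>\<omega>\<close> annihilates \<open>\<eta>\<close> are a two-sided ideal, so it suffices to test
  the generators of the ideal of invariants.\<close>

lemma super_harmonicsI:
  assumes K: "subfield K complex_field" and \<eta>: "\<eta> \<in> carrier (form_ring K n)"
    and inv: "\<And>\<omega> i k. \<omega> \<in> invariant_forms K n G \<Longrightarrow> 0 < i + k \<Longrightarrow> bihomogeneous i k \<omega> \<Longrightarrow>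
      partial_form \<omega> \<eta> = 0"
  shows "\<eta> \<in> super_harmonics K n G"
proof -
  let ?R = "form_ring K n"
  interpret R: ring ?R by (rule ring_form_ring[OF K])
  have ops: "f \<otimes>\<^bsub>?R\<^esub> g = f \<star> g" "f \<oplus>\<^bsub>?R\<^esub> g = f + g" "\<zero>\<^bsub>?R\<^esub> = 0" for f g
    by (simp_all add: form_ring_def)
  have minus: "\<ominus>\<^bsub>?R\<^esub> f = - f" if "f \<in> carrier ?R" for f
    using R.l_neg[OF that] unfolding ops by (simp add: eq_neg_iff_add_eq_0)
  let ?T = "{\<omega> \<in> carrier ?R. \<forall>\<kappa>. partial_form (\<kappa> \<star> \<omega>) \<eta> = 0}"
  have "ideal ?T ?R"
  proof (rule idealI)
    show "ring ?R" by (rule R.ring_axioms)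
    show "subgroup ?T (add_monoid ?R)"
    proof (rule R.add.subgroupI)
      show "?T \<noteq> {}" using R.zero_closed ops(3) by auto
      show "\<ominus>\<^bsub>?R\<^esub> f \<in> ?T" if "f \<in> ?T" for f
      proof -
        have "\<kappa> \<star> (- f) = (- \<kappa>) \<star> f" for \<kappa>
          using form_mult_add_left[of \<kappa> "- \<kappa>" f] form_mult_add_right[of \<kappa> f "- f"]
          by (simp add: add_eq_0_iff)
        then show ?thesis using that R.a_inv_closed[of f] by (simp add: minus)
      qed
      show "f \<oplus>\<^bsub>?R\<^esub> g \<in> ?T" if "f \<in> ?T" "g \<in> ?T" for f g
        using that R.a_closed[of f g] by (simp add: ops form_mult_add_right partial_form_add)
    qed auto
    fix f g assume f: "f \<in> ?T" and g: "g \<in> carrier ?R"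
    show "g \<otimes>\<^bsub>?R\<^esub> f \<in> ?T"
      using f R.m_closed[OF g, of f] by (simp add: ops flip: form_mult_assoc)
    show "f \<otimes>\<^bsub>?R\<^esub> g \<in> ?T"
      using f R.m_closed[OF _ g, of f] by (simp add: ops partial_form_mult flip: form_mult_assoc)
  qed
  moreover have "{f \<in> invariant_forms K n G. \<exists>i k. 0 < i + k \<and> bihomogeneous i k f} \<subseteq> ?T"
    using inv partial_form_left_mult_eq_0 by (fastforce simp: invariant_forms_def)
  ultimately have sub: "coinvariant_ideal K n G \<subseteq> ?T"
    unfolding coinvariant_ideal_def by (rule R.genideal_minimal)
  have "partial_form \<omega> \<eta> = 0" if "\<omega> \<in> coinvariant_ideal K n G" for \<omega>
  proof -
    have "partial_form (one_form \<star> \<omega>) \<eta> = 0" using sub that by auto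
    then show ?thesis by (simp add: form_mult_one_left)
  qed
  then show ?thesis using \<eta> by (simp add: super_harmonics_def)
qed

lemma super_harmonics_invariant:
  assumes "subfield K complex_field" "\<eta> \<in> super_harmonics K n G"
    and "\<omega> \<in> invariant_forms K n G" "0 < i + k" "bihomogeneous i k \<omega>"
  shows "partial_form \<omega> \<eta> = 0"
proof -
  interpret R: ring "form_ring K n" by (rule ring_form_ring[OF assms(1)])
  have "{f \<in> invariant_forms K n G. \<exists>i k. 0 < i + k \<and> bihomogeneous i k f} \<subseteq> carrier (form_ring K n)"
    by (auto simp: invariant_forms_def)
  from R.genideal_self[OF this] have "\<omega> \<in> coinvariant_ideal K n G"
    unfolding coinvariant_ideal_def using assms(3-5) by blast
  then show ?thesis using assms(2) by (simp add: super_harmonics_def)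
qed

section \<open>The action of monomial matrices\<close>

definition monomial_mat :: "nat \<Rightarrow> (nat \<Rightarrow> nat) \<Rightarrow> (nat \<Rightarrow> complex) \<Rightarrow> complex mat" where
  "monomial_mat n w c = mat n n (\<lambda>(i, j). if i = w j then c j else 0)"

lemma index_monomial_mat [simp]:
  "i < n \<Longrightarrow> j < n \<Longrightarrow> monomial_mat n w c $$ (i, j) = (if i = w j then c j else 0)"
  by (simp add: monomial_mat_def)

lemma monomial_mat_in_group:
  assumes w: "bij_betw w {..<n} {..<n}" and c: "\<And>j. j < n \<Longrightarrow> c j ^ m = 1" and m: "1 \<le> m"
    and prod: "(\<Prod>j<n. c j) ^ (m div p) = 1"
  shows "monomial_mat n w c \<in> monomial_group m p n"
proof -
  have c0: "c j \<noteq> 0" if "j < n" for j using c[OF that] m by (auto simp: zero_power)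
  have wn: "w j < n" if "j < n" for j using bij_betwE[OF w] that by auto
  have inj: "w i = w j \<longleftrightarrow> i = j" if "i < n" "j < n" for i j
    using bij_betw_imp_inj_on[OF w] that by (auto simp: inj_on_def)
  have "{(i, j). i < n \<and> j < n \<and> monomial_mat n w c $$ (i, j) \<noteq> 0} = (\<lambda>j. (w j, j)) ` {..<n}"
    using c0 wn by (auto split: if_splits)
  moreover have "inj_on (\<lambda>j. (w j, j)) {..<n}" by (auto simp: inj_on_def)
  ultimately have "(\<Prod>ij \<in> {(i, j). i < n \<and> j < n \<and> monomial_mat n w c $$ (i, j) \<noteq> 0}. monomial_mat n w c $$ ij)
      = (\<Prod>j<n. c j)"
    by (simp add: prod.reindex wn)
  moreover have "\<exists>!j. j < n \<and> monomial_mat n w c $$ (i, j) \<noteq> 0" if i: "i < n" for i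
  proof -
    obtain j where j: "j < n" "w j = i" using bij_betw_imp_surj_on[OF w] i by (metis imageE lessThan_iff)
    show ?thesis
    proof (rule ex1I[of _ j])
      show "j < n \<and> monomial_mat n w c $$ (i, j) \<noteq> 0" using i j c0 by simp
      show "j' = j" if "j' < n \<and> monomial_mat n w c $$ (i, j') \<noteq> 0" for j'
        using that i j inj[of j' j] by (auto split: if_splits)
    qed
  qed
  moreover have "\<exists>!i. i < n \<and> monomial_mat n w c $$ (i, j) \<noteq> 0" if j: "j < n" for j
    by (rule ex1I[of _ "w j"]) (use j wn c0 in \<open>auto split: if_splits\<close>)
  ultimately show ?thesis
    using prod c by (auto simp: monomial_group_def monomial_mat_def)
qed

lemma monomial_groupE:
  assumes "\<sigma> \<in> monomial_group m p n"
  obtains w c where "bij_betw w {..<n} {..<n}" "\<sigma> = monomial_mat n w c"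
    "\<And>j. j < n \<Longrightarrow> c j ^ m = 1" "(\<Prod>j<n. c j) ^ (m div p) = 1"
proof -
  have \<sigma>: "\<sigma> \<in> carrier_mat n n" and row: "\<And>i. i < n \<Longrightarrow> \<exists>!j. j < n \<and> \<sigma> $$ (i, j) \<noteq> 0"
    and col: "\<And>j. j < n \<Longrightarrow> \<exists>!i. i < n \<and> \<sigma> $$ (i, j) \<noteq> 0"
    and pow: "\<And>i j. i < n \<Longrightarrow> j < n \<Longrightarrow> \<sigma> $$ (i, j) \<noteq> 0 \<Longrightarrow> (\<sigma> $$ (i, j)) ^ m = 1"
    and prod: "(\<Prod>ij \<in> {(i, j). i < n \<and> j < n \<and> \<sigma> $$ (i, j) \<noteq> 0}. \<sigma> $$ ij) ^ (m div p) = 1"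
    using assms by (auto simp: monomial_group_def)
  define w where "w j = (THE i. i < n \<and> \<sigma> $$ (i, j) \<noteq> 0)" for j
  have w: "w j < n" "\<sigma> $$ (w j, j) \<noteq> 0" if "j < n" for j
    using theI'[OF col[OF that]] by (simp_all add: w_def)
  have w_eq: "i = w j" if "i < n" "j < n" "\<sigma> $$ (i, j) \<noteq> 0" for i j
    using col[of j] w[of j] that by blast
  have inj: "inj_on w {..<n}"
  proof (rule inj_onI)
    fix i j assume "i \<in> {..<n}" "j \<in> {..<n}" "w i = w j"
    then show "i = j" using w[of i] w[of j] row[of "w i"] by auto
  qed
  moreover have "w ` {..<n} \<subseteq> {..<n}" using w by auto
  ultimately have bij: "bij_betw w {..<n} {..<n}"
    by (simp add: bij_betw_def endo_inj_surj)
  have "\<sigma> = monomial_mat n w (\<lambda>j. \<sigma> $$ (w j, j))"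
    using \<sigma> w_eq by (intro eq_matI) (auto simp: monomial_mat_def)
  moreover have "{(i, j). i < n \<and> j < n \<and> \<sigma> $$ (i, j) \<noteq> 0} = (\<lambda>j. (w j, j)) ` {..<n}"
    using w w_eq by (force simp: image_iff)
  then have "(\<Prod>ij \<in> {(i, j). i < n \<and> j < n \<and> \<sigma> $$ (i, j) \<noteq> 0}. \<sigma> $$ ij) = (\<Prod>j<n. \<sigma> $$ (w j, j))"
    by (simp add: prod.reindex inj_on_def)
  ultimately show ?thesis
    using bij w pow prod by (intro that[of w "\<lambda>j. \<sigma> $$ (w j, j)"]) auto
qed

definition permute_exponent :: "(nat \<Rightarrow> nat) \<Rightarrow> (nat \<Rightarrow>\<^sub>0 nat) \<Rightarrow> nat \<Rightarrow>\<^sub>0 nat" where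
  "permute_exponent w \<alpha> = (\<Sum>j\<in>keys \<alpha>. single (w j) (lookup \<alpha> j))"

lemma permute_exponent_superset:
  "finite A \<Longrightarrow> keys \<alpha> \<subseteq> A \<Longrightarrow>
    permute_exponent w \<alpha> = (\<Sum>j\<in>A. single (w j) (lookup \<alpha> j))"
  unfolding permute_exponent_def by (intro sum.mono_neutral_left) (auto simp: in_keys_iff)

lemma permute_exponent_single [simp]:
  "permute_exponent w (single j c) = single (w j) c"
  by (subst permute_exponent_superset[of "{j}"]) auto

lemma permute_exponent_add:
  "permute_exponent w (\<alpha> + \<beta>) = permute_exponent w \<alpha> + permute_exponent w \<beta>"
proof -
  let ?A = "keys \<alpha> \<union> keys \<beta>"
  have "keys (\<alpha> + \<beta>) \<subseteq> ?A" by (rule Poly_Mapping.keys_add)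
  then show ?thesis
    by (simp add: permute_exponent_superset[of ?A] lookup_add Poly_Mapping.single_add sum.distrib)
qed

lemma permute_exponent_sum:
  "permute_exponent w (sum F A) = (\<Sum>a\<in>A. permute_exponent w (F a))"
  by (induction A rule: infinite_finite_induct) (auto simp: permute_exponent_add permute_exponent_def[of w 0])

lemma permute_exponent_id [simp]: "permute_exponent id \<alpha> = \<alpha>"
  using sum_single_lookup[of "keys \<alpha>" \<alpha>] by (simp add: permute_exponent_def)

lemma foldr_mult_singles:
  fixes w :: "nat \<Rightarrow> nat" and c :: "nat \<Rightarrow> complex"
  assumes "\<And>j. j \<in> set js \<Longrightarrow> f j = single (single (w j) 1, {||}) (c j)"
  shows "foldr (\<star>) (concat (map (\<lambda>j. replicate (a j) (f j)) js)) (single (\<beta>, I) d)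
     = single ((\<Sum>j\<leftarrow>js. single (w j) (a j)) + \<beta>, I) ((\<Prod>j\<leftarrow>js. c j ^ a j) * d)"
  using assms
proof (induction js)
  case (Cons j js)
  have "foldr (\<star>) (replicate r (f j)) (single (\<gamma>, I) d')
     = single (single (w j) r + \<gamma>, I) (c j ^ r * d')" for r \<gamma> d'
  proof (induction r)
    case (Suc r)
    have "single (w j) 1 + (single (w j) r + \<gamma>) = single (w j) (Suc r) + \<gamma>"
      by (simp add: add.assoc[symmetric] flip: Poly_Mapping.single_add)
    then show ?case using Suc Cons.prems[of j] by (simp add: form_mult_single mult.assoc)
  qed simp
  then show ?case using Cons by (simp add: add.assoc mult.assoc)
qed simp

text \<open>A diagonal matrix scales \<open>\<theta>\<^sub>i\<close> like \<open>x\<^sub>i\<close>, so it acts on \<open>x\<^sup>\<alpha> \<theta>\<^sub>I\<close> through this exponent.\<close>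

definition weight :: "monom_form \<Rightarrow> nat \<Rightarrow>\<^sub>0 nat" where
  "weight k = fst k + (\<Sum>i\<in>fset (snd k). single i 1)"

text \<open>With at most one theta, permuting the indices leads to no reordering sign.\<close>

lemma form_action_single:
  assumes w: "\<And>j. j < n \<Longrightarrow> w j < n"
    and supp: "keys \<alpha> \<subseteq> {..<n}" "fset I \<subseteq> {..<n}" and card: "fcard I \<le> 1"
  shows "form_action n (monomial_mat n w c) (single (\<alpha>, I) a)
     = single (permute_exponent w \<alpha>, w |`| I)
         (a * (\<Prod>j<n. cnj (c j) ^ lookup (weight (\<alpha>, I)) j))"
proof -
  let ?\<sigma> = "monomial_mat n w c"
  have x: "x_image n ?\<sigma> j = single (single (w j) 1, {||}) (cnj (c j))" if j: "j < n" for j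
  proof -
    have "x_image n ?\<sigma> j = (\<Sum>i<n. if i = w j then scale_form (cnj (c j)) (x_form i) else 0)"
      unfolding x_image_def using j by (intro sum.cong) (auto intro!: poly_mapping_eqI)
    also have "\<dots> = scale_form (cnj (c j)) (x_form (w j))" using w[OF j] by simp
    finally show ?thesis by (simp add: x_form_def scale_form_def)
  qed
  have \<theta>: "theta_image n ?\<sigma> j = single (0, {|w j|}) (cnj (c j))" if j: "j < n" for j
  proof -
    have "theta_image n ?\<sigma> j = (\<Sum>i<n. if i = w j then scale_form (cnj (c j)) (theta_form i) else 0)"
      unfolding theta_image_def using j by (intro sum.cong) (auto intro!: poly_mapping_eqI)
    also have "\<dots> = scale_form (cnj (c j)) (theta_form (w j))" using w[OF j] by simp
    finally show ?thesis by (simp add: theta_form_def scale_form_def)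
  qed
  let ?\<chi> = "\<Prod>i\<in>fset I. cnj (c i)"
  have thetas: "foldr (\<star>) (map (theta_image n ?\<sigma>) (sorted_list_of_fset I)) one_form
      = single (0, w |`| I) ?\<chi>"
  proof (cases "fcard I = 0")
    case True
    then have "I = {||}" by simp
    then show ?thesis by (simp add: one_form_def sorted_list_of_fset.rep_eq)
  next
    case False
    then obtain i where "I = {|i|}" using card fcard_1_elim[of I] by fastforce
    then show ?thesis using supp \<theta>
      by (simp add: sorted_list_of_fset.rep_eq form_mult_one_right)
  qed
  let ?L = "sorted_list_of_set (keys \<alpha>)"
  have "foldr (\<star>) (concat (map (\<lambda>j. replicate (lookup \<alpha> j) (x_image n ?\<sigma> j)) ?L))
      (single (0, w |`| I) ?\<chi>)
    = single ((\<Sum>j\<leftarrow>?L. single (w j) (lookup \<alpha> j)) + 0, w |`| I)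
       ((\<Prod>j\<leftarrow>?L. cnj (c j) ^ lookup \<alpha> j) * ?\<chi>)"
    using supp by (intro foldr_mult_singles x) auto
  also have "(\<Sum>j\<leftarrow>?L. single (w j) (lookup \<alpha> j)) + 0 = permute_exponent w \<alpha>"
    by (simp add: permute_exponent_def sum_list_distinct_conv_sum_set)
  also have "(\<Prod>j\<leftarrow>?L. cnj (c j) ^ lookup \<alpha> j)
      = (\<Prod>j\<in>keys \<alpha>. cnj (c j) ^ lookup \<alpha> j)"
    using prod.distinct_set_conv_list[of ?L "\<lambda>j. cnj (c j) ^ lookup \<alpha> j"] by simp
  also have "\<dots> = (\<Prod>j<n. cnj (c j) ^ lookup \<alpha> j)"
    using supp by (intro prod.mono_neutral_left) (auto simp: in_keys_iff)
  also have "(\<Prod>j<n. cnj (c j) ^ lookup \<alpha> j) * ?\<chi>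
      = (\<Prod>j<n. cnj (c j) ^ lookup (weight (\<alpha>, I)) j)"
  proof -
    have "?\<chi> = (\<Prod>j\<in>fset I. cnj (c j) ^ (if j |\<in>| I then 1 else 0))" by simp
    also have "\<dots> = (\<Prod>j<n. cnj (c j) ^ (if j |\<in>| I then 1 else 0))"
      using supp by (intro prod.mono_neutral_left) auto
    finally show ?thesis
      by (simp only: prod.distrib[symmetric])
        (rule prod.cong, auto simp: weight_def lookup_add lookup_sum lookup_single when_def power_add)
  qed
  finally show ?thesis
    unfolding form_action_def lin_ext_single by (simp add: thetas scale_form_def)
qed

lemma form_action_sum: "form_action n \<sigma> (sum F A) = (\<Sum>a\<in>A. form_action n \<sigma> (F a))"
  by (simp add: form_action_def lin_ext_sum)

section \<open>The invariants that bound the harmonics\<close>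

text \<open>The form \<open>F \<theta>\<^sub>I\<close>, with the thetas of \<open>I\<close> in increasing order.\<close>

definition with_theta :: "mpoly \<Rightarrow> nat fset \<Rightarrow> form" where
  "with_theta F I = (\<Sum>\<alpha>\<in>keys F. single (\<alpha>, I) (lookup F \<alpha>))"

lemma lookup_with_theta:
  "lookup (with_theta F I) (\<alpha>, B) = (if B = I then lookup F \<alpha> else 0)"
proof -
  have "lookup (with_theta F I) (\<alpha>, B)
      = (\<Sum>\<beta>\<in>keys F. if \<beta> = \<alpha> \<and> B = I then lookup F \<beta> else 0)"
    unfolding with_theta_def lookup_sum by (intro sum.cong) (auto simp: lookup_single when_def)
  then show ?thesis by (cases "B = I") (auto simp: in_keys_iff)
qed

lemma with_theta_sum: "with_theta (sum F A) I = (\<Sum>a\<in>A. with_theta (F a) I)"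
proof (rule poly_mapping_eqI)
  fix k :: monom_form
  show "lookup (with_theta (sum F A) I) k = lookup (\<Sum>a\<in>A. with_theta (F a) I) k"
    by (cases k) (simp add: lookup_with_theta lookup_sum)
qed

lemma with_theta_single [simp]: "with_theta (single \<alpha> c) I = single (\<alpha>, I) c"
proof (rule poly_mapping_eqI)
  fix k :: monom_form
  show "lookup (with_theta (single \<alpha> c) I) k = lookup (single (\<alpha>, I) c) k"
    by (cases k) (auto simp: lookup_with_theta lookup_single when_def)
qed

lemma jet_partial_with_theta:
  "jet (partial_form (with_theta F I) \<eta>) \<beta> B = theta_sign I B * pair F (\<lambda>\<alpha>. jet \<eta> (\<alpha> + \<beta>) (I |\<union>| B))"
proof -
  have "jet (partial_form (with_theta F I) \<eta>) \<beta> B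
      = (\<Sum>k\<in>(\<lambda>\<alpha>. (\<alpha>, I)) ` keys F. cnj (lookup (with_theta F I) k) *
          (theta_sign (snd k) B * jet \<eta> (fst k + \<beta>) (snd k |\<union>| B)))"
    by (rule partial_form_superset) (auto simp: in_keys_iff lookup_with_theta image_iff split: if_splits)
  also have "\<dots> = theta_sign I B * pair F (\<lambda>\<alpha>. jet \<eta> (\<alpha> + \<beta>) (I |\<union>| B))"
    by (subst sum.reindex) (auto simp: inj_on_def lookup_with_theta pair_def sum_distrib_left mult_ac)
  finally show ?thesis .
qed

definition orbit_forms :: "nat \<Rightarrow> nat \<Rightarrow> nat \<Rightarrow> form set" where
  "orbit_forms m e n = {with_theta F {||} | F dF. (F, dF) \<in> invariant_pairs m e n}
     \<union> {\<Sum>j<n. with_theta (dF j) {|j|} | F dF. (F, dF) \<in> invariant_pairs m e n}"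

lemma subfield_sum:
  assumes "subfield K complex_field" "\<And>a. a \<in> A \<Longrightarrow> F a \<in> K"
  shows "sum F A \<in> K"
  using assms(2) by (induction A rule: infinite_finite_induct)
    (auto simp: subfield_complex_closed(1,4)[OF assms(1)])

lemma carrier_form_ring_iff:
  "f \<in> carrier (form_ring K n) \<longleftrightarrow> (\<forall>k. lookup f k \<in> K) \<and>
     (\<forall>k. lookup f k \<noteq> 0 \<longrightarrow> keys (fst k) \<subseteq> {..<n} \<and> fset (snd k) \<subseteq> {..<n})"
  by (simp add: form_ring_def in_keys_iff case_prod_unfold Ball_def)

text \<open>A sum of monomials is invariant if the permutations permute its monomials (through \<open>u\<close>) and the diagonal
  matrices act trivially on each of them.\<close>

lemma sum_monomials_invariant:
  assumes K: "subfield K complex_field" and fin: "finite A"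
    and supp: "\<And>a. a \<in> A \<Longrightarrow> keys (\<gamma> a) \<subseteq> {..<n} \<and> fset (I a) \<subseteq> {..<n} \<and> fcard (I a) \<le> 1"
    and u: "\<And>w. bij_betw w {..<n} {..<n} \<Longrightarrow> bij_betw (u w) A A"
    and perm: "\<And>w a. bij_betw w {..<n} {..<n} \<Longrightarrow> a \<in> A \<Longrightarrow>
       permute_exponent w (\<gamma> a) = \<gamma> (u w a) \<and> w |`| I a = I (u w a)"
    and char: "\<And>c a. \<forall>j<n. c j ^ m = 1 \<Longrightarrow> (\<Prod>j<n. c j) ^ (m div p) = 1 \<Longrightarrow> a \<in> A \<Longrightarrow>
       (\<Prod>j<n. c j ^ lookup (weight (\<gamma> a, I a)) j) = (1::complex)"
  shows "(\<Sum>a\<in>A. single (\<gamma> a, I a) 1) \<in> invariant_forms K n (monomial_group m p n)"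
proof -
  let ?f = "\<Sum>a\<in>A. single (\<gamma> a, I a) (1::complex)"
  note closed = subfield_complex_closed[OF K]
  have "?f \<in> carrier (form_ring K n)"
    unfolding carrier_form_ring_iff
  proof (intro conjI allI impI)
    fix k
    show "lookup ?f k \<in> K"
      unfolding lookup_sum using closed by (intro subfield_sum[OF K]) (auto simp: lookup_single when_def)
    assume "lookup ?f k \<noteq> 0"
    then obtain a where a: "a \<in> A" "lookup (single (\<gamma> a, I a) (1::complex)) k \<noteq> 0"
      unfolding lookup_sum by (rule sum.not_neutral_contains_not_neutral)
    then have "k = (\<gamma> a, I a)" by (auto simp: lookup_single when_def split: if_splits)
    then show "keys (fst k) \<subseteq> {..<n}" "fset (snd k) \<subseteq> {..<n}"
      using supp[OF a(1)] by simp_all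
  qed
  moreover have "form_action n \<sigma> ?f = ?f" if \<sigma>: "\<sigma> \<in> monomial_group m p n" for \<sigma>
  proof -
    obtain w c where wc: "bij_betw w {..<n} {..<n}" "\<sigma> = monomial_mat n w c"
      "\<And>j. j < n \<Longrightarrow> c j ^ m = 1" "(\<Prod>j<n. c j) ^ (m div p) = 1"
      by (rule monomial_groupE[OF \<sigma>]) (rule that)
    have wn: "w j < n" if "j < n" for j using bij_betwE[OF wc(1)] that by auto
    have "form_action n \<sigma> ?f = (\<Sum>a\<in>A. single (\<gamma> (u w a), I (u w a)) 1)"
      unfolding form_action_sum wc(2)
    proof (intro sum.cong refl)
      fix a assume a: "a \<in> A"
      have "(\<Prod>j<n. cnj (c j) ^ lookup (weight (\<gamma> a, I a)) j)
          = cnj (\<Prod>j<n. c j ^ lookup (weight (\<gamma> a, I a)) j)" by simp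
      then have "(\<Prod>j<n. cnj (c j) ^ lookup (weight (\<gamma> a, I a)) j) = 1"
        using char[OF _ wc(4) a] wc(3) by simp
      then show "form_action n (monomial_mat n w c) (single (\<gamma> a, I a) 1)
          = single (\<gamma> (u w a), I (u w a)) 1"
        using perm[OF wc(1) a] supp[OF a] by (subst form_action_single[OF wn]) auto
    qed
    also have "\<dots> = ?f" by (rule sum.reindex_bij_betw[OF u[OF wc(1)]])
    finally show ?thesis .
  qed
  ultimately show ?thesis by (simp add: invariant_forms_def)
qed

lemma bihomogeneous_sum_monomials:
  assumes "\<And>a. a \<in> A \<Longrightarrow> x_deg (\<gamma> a) = i \<and> fcard (I a) = k"
  shows "bihomogeneous i k (\<Sum>a\<in>A. single (\<gamma> a, I a) c)"
proof -
  have "l \<in> (\<Union>a\<in>A. {(\<gamma> a, I a)})"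
    if "l \<in> keys (\<Sum>a\<in>A. single (\<gamma> a, I a) c)" for l
    using that Poly_Mapping.keys_sum[of "\<lambda>a. single (\<gamma> a, I a) c" A]
    by (force split: if_splits)
  then show ?thesis using assms unfolding bihomogeneous_def by blast
qed

text \<open>Each of the four kinds of forms is a sum over an orbit of monomials, so \<open>sum_monomials_invariant\<close> applies.
  The diagonal matrices act trivially because the exponents including the theta are \<open>m r\<close> at one index, or \<open>e\<close> at every
  index.\<close>

lemma orbit_forms_invariant:
  assumes K: "subfield K complex_field" and m: "1 \<le> m" and p: "p dvd m" and n: "1 \<le> n"
    and \<omega>: "\<omega> \<in> orbit_forms m (m div p) n"
  shows "\<omega> \<in> invariant_forms K n (monomial_group m p n)"
    and "\<exists>i k. 0 < i + k \<and> bihomogeneous i k \<omega>"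
proof -
  define e where "e = m div p"
  have e: "1 \<le> e" using m p by (auto simp: e_def dvd_def)
  let ?G = "monomial_group m p n"
  let ?c = "\<lambda>j. (\<Sum>l\<in>{..<n} - {j}. single l e) + single j (e - 1)"
  have var_prod: "(\<Prod>l\<in>A. var l ^ e) = single (\<Sum>l\<in>A. single l e) 1" for A
    unfolding var_power by (rule prod_single)
  have w1: "with_theta (\<Sum>j<n. var j ^ c) {||} = (\<Sum>j<n. single (single j c, {||}) 1)" for c
    by (simp only: with_theta_sum var_power with_theta_single)
  have w2: "(\<Sum>j<n. with_theta (var j ^ c) {|j|}) = (\<Sum>j<n. single (single j c, {|j|}) 1)" for c
    by (simp only: var_power with_theta_single)
  have w3: "with_theta (\<Prod>j<n. var j ^ e) {||} = single (\<Sum>l<n. single l e, {||}) 1"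
    by (simp only: var_prod with_theta_single)
  have w4: "(\<Sum>j<n. with_theta ((\<Prod>l\<in>{..<n} - {j}. var l ^ e) * var j ^ (e - 1)) {|j|})
      = (\<Sum>j<n. single (?c j, {|j|}) 1)"
    unfolding var_prod by (simp only: with_theta_single mult_single var_power mult_1_left)
  obtain F dF where F: "(F, dF) \<in> invariant_pairs m e n"
    and \<omega>_eq: "\<omega> = with_theta F {||} \<or> \<omega> = (\<Sum>j<n. with_theta (dF j) {|j|})"
    using \<omega> unfolding orbit_forms_def e_def[symmetric] by blast
  from F consider (sum) r where "0 < r" "F = (\<Sum>j<n. var j ^ (m * r))" "dF = (\<lambda>j. var j ^ (m * r - 1))"
    | (prod) "F = (\<Prod>j<n. var j ^ e)" "dF = (\<lambda>j. (\<Prod>l\<in>{..<n} - {j}. var l ^ e) * var j ^ (e - 1))"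
    unfolding invariant_pairs_def by blast
  then consider
      (1) r where "0 < r" "\<omega> = (\<Sum>j<n. single (single j (m * r), {||}) 1)"
    | (2) r where "0 < r" "\<omega> = (\<Sum>j<n. single (single j (m * r - 1), {|j|}) 1)"
    | (3) "\<omega> = single (\<Sum>l<n. single l e, {||}) 1"
    | (4) "\<omega> = (\<Sum>j<n. single (?c j, {|j|}) 1)"
  proof cases
    case sum
    from \<omega>_eq show ?thesis
    proof
      assume "\<omega> = with_theta F {||}"
      then show ?thesis unfolding sum(2) w1 by (rule that(1)[OF sum(1)])
    next
      assume "\<omega> = (\<Sum>j<n. with_theta (dF j) {|j|})"
      then show ?thesis unfolding sum(3) w2 by (rule that(2)[OF sum(1)])
    qed
  next
    case prod
    from \<omega>_eq show ?thesis
    proof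
      assume "\<omega> = with_theta F {||}"
      then show ?thesis unfolding prod(1) w3 by (rule that(3))
    next
      assume "\<omega> = (\<Sum>j<n. with_theta (dF j) {|j|})"
      then show ?thesis unfolding prod(2) w4 by (rule that(4))
    qed
  qed
  then have "\<omega> \<in> invariant_forms K n ?G \<and> (\<exists>i k. 0 < i + k \<and> bihomogeneous i k \<omega>)"
  proof cases
    case 1
    have "\<omega> \<in> invariant_forms K n ?G" unfolding 1(2)
    proof (rule sum_monomials_invariant[OF K, where u = "\<lambda>w. w"])
      show "(\<Prod>l<n. c l ^ lookup (weight (single j (m * r), {||})) l) = 1"
        if "\<forall>j<n. c j ^ m = 1" for c :: "nat \<Rightarrow> complex" and j
        using that by (intro prod.neutral) (auto simp: weight_def lookup_single when_def power_mult)
    qed (auto simp: fcard.rep_eq)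
    moreover have "bihomogeneous (m * r) 0 \<omega>"
      unfolding 1(2) by (rule bihomogeneous_sum_monomials) (simp add: fcard.rep_eq)
    moreover have "0 < m * r + 0" using 1(1) m by simp
    ultimately show ?thesis by (intro conjI exI)
  next
    case 2
    have mr: "Suc (m * r - 1) = m * r" using 2(1) m by simp
    have wt: "weight (single j (m * r - 1), {|j|}) = single j (m * r)" for j
      using mr by (simp add: weight_def flip: Poly_Mapping.single_add)
    have "\<omega> \<in> invariant_forms K n ?G" unfolding 2(2)
    proof (rule sum_monomials_invariant[OF K, where u = "\<lambda>w. w"])
      show "(\<Prod>l<n. c l ^ lookup (weight (single j (m * r - 1), {|j|})) l) = 1"
        if "\<forall>j<n. c j ^ m = 1" for c :: "nat \<Rightarrow> complex" and j
        unfolding wt using that by (intro prod.neutral) (auto simp: lookup_single when_def power_mult)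
    qed (auto simp: fcard.rep_eq split: if_splits)
    moreover have "bihomogeneous (m * r - 1) 1 \<omega>"
      unfolding 2(2) by (rule bihomogeneous_sum_monomials) (simp add: fcard.rep_eq)
    moreover have "0 < m * r - 1 + 1" by simp
    ultimately show ?thesis by (intro conjI exI)
  next
    case 3
    let ?E = "\<Sum>l<n. single l e"
    have E: "lookup ?E l = (if l < n then e else 0)" for l
      by (simp add: lookup_sum lookup_single when_def)
    have inv: "(\<Sum>a\<in>{()}. single (?E, {||}) 1) \<in> invariant_forms K n ?G"
    proof (rule sum_monomials_invariant[OF K, where u = "\<lambda>w. id"])
      show "permute_exponent w ?E = ?E \<and> w |`| {||} = {||}"
        if "bij_betw w {..<n} {..<n}" for w
        using sum.reindex_bij_betw[OF that, of "\<lambda>l. single l e"]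
        by (simp add: permute_exponent_sum)
      show "(\<Prod>l<n. c l ^ lookup (weight (?E, {||})) l) = 1"
        if "(\<Prod>j<n. c j) ^ (m div p) = 1" for c :: "nat \<Rightarrow> complex"
        using that[folded e_def] by (simp add: weight_def E prod_power_distrib)
    qed (auto simp: in_keys_iff E fcard.rep_eq split: if_splits)
    moreover have "bihomogeneous (n * e) 0 \<omega>"
    proof -
      have "keys ?E \<subseteq> {..<n}" by (auto simp: in_keys_iff E split: if_splits)
      then have "x_deg ?E = n * e" by (simp add: x_deg_superset[of "{..<n}"] E)
      then show ?thesis by (simp add: 3 bihomogeneous_def)
    qed
    moreover have "0 < n * e + 0" using n e by simp
    moreover have "\<omega> \<in> invariant_forms K n ?G" using inv unfolding 3 by simp
    ultimately show ?thesis by (intro conjI exI)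
  next
    case 4
    have E: "lookup (?c j) l = (if l < n then if l = j then e - 1 else e else 0)" if "j < n" for j l
    proof -
      have "(\<Sum>x\<in>{..<n} - {j}. if x = l then e else 0) = (if l \<in> {..<n} - {j} then e else 0)"
        by (rule sum.delta) simp
      then show ?thesis using that by (auto simp: lookup_add lookup_sum lookup_single when_def)
    qed
    have wt: "lookup (weight (?c j, {|j|})) l = e" if "j < n" "l < n" for j l
      unfolding weight_def fst_conv snd_conv lookup_add[of "?c j"] E[OF that(1)]
      using that e by (simp add: lookup_single when_def)
    have supp: "keys (?c j) \<subseteq> {..<n}" if "j < n" for j
      using E[OF that] by (auto simp: in_keys_iff split: if_splits)
    have "\<omega> \<in> invariant_forms K n ?G" unfolding 4
    proof (rule sum_monomials_invariant[OF K, where u = "\<lambda>w. w"])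
      show "permute_exponent w (?c j) = ?c (w j) \<and> w |`| {|j|} = {|w j|}"
        if w: "bij_betw w {..<n} {..<n}" and "j \<in> {..<n}" for w j
      proof -
        have "bij_betw w ({..<n} - {j}) ({..<n} - {w j})"
        proof -
          have "w j \<in> {..<n}" using w that(2) by (rule bij_betw_apply)
          then show ?thesis
            using that(2) by (intro bij_betw_DiffI[OF w] bij_betw_singletonI) simp_all
        qed
        from sum.reindex_bij_betw[OF this, of "\<lambda>l. single l e"] show ?thesis
          by (simp add: permute_exponent_add permute_exponent_sum)
      qed
      show "(\<Prod>l<n. c l ^ lookup (weight (?c j, {|j|})) l) = 1"
        if "(\<Prod>j<n. c j) ^ (m div p) = 1" "j \<in> {..<n}" for c :: "nat \<Rightarrow> complex" and j
      proof -
        have "(\<Prod>l<n. c l ^ lookup (weight (?c j, {|j|})) l) = (\<Prod>l<n. c l ^ e)"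
          using that(2) by (intro prod.cong refl arg_cong2[where f = "(^)"] wt) auto
        then show ?thesis using that(1)[folded e_def] by (simp only: prod_power_distrib)
      qed
    qed (use supp in \<open>auto simp: fcard.rep_eq\<close>)
    moreover have "bihomogeneous (n * e - 1) 1 \<omega>"
    proof -
      have "x_deg (?c j) = n * e - 1" if "j < n" for j
      proof -
        have "x_deg (?c j) = (\<Sum>l<n. if l < n then if l = j then e - 1 else e else 0)"
          unfolding x_deg_superset[OF finite_lessThan supp[OF that]] E[OF that] ..
        also have "\<dots> = (e - 1) + (\<Sum>l\<in>{..<n} - {j}. e)"
          using that by (subst sum.remove[of _ j]) (auto intro!: sum.cong)
        finally have "x_deg (?c j) + 1 = e + (\<Sum>l\<in>{..<n} - {j}. e)" using e by simp
        also have "\<dots> = (\<Sum>l<n. e)" using that by (intro sum.remove[symmetric]) auto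
        finally have "x_deg (?c j) + 1 = n * e" by simp
        then show ?thesis by simp
      qed
      then show ?thesis
        unfolding 4 by (intro bihomogeneous_sum_monomials) (simp add: fcard.rep_eq)
    qed
    moreover have "0 < n * e - 1 + 1" by simp
    ultimately show ?thesis by (intro conjI exI)
  qed
  then show "\<omega> \<in> invariant_forms K n ?G" "\<exists>i k. 0 < i + k \<and> bihomogeneous i k \<omega>" by auto
qed

lemma harmonic_system_jet:
  assumes K: "subfield K complex_field" and m: "1 \<le> m" and p: "p dvd m" and n: "1 \<le> n"
    and \<eta>: "\<eta> \<in> super_harmonics K n (monomial_group m p n)"
  shows "harmonic_system m (m div p) n (jet \<eta>)"
proof (rule harmonic_systemI)
  have car: "\<eta> \<in> carrier (form_ring K n)" using \<eta> by (simp add: super_harmonics_def)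
  show "keys \<alpha> \<subseteq> {..<n} \<and> fset B \<subseteq> {..<n}" if "jet \<eta> \<alpha> B \<noteq> 0" for \<alpha> B
    using that conjunct2[OF car[unfolded carrier_form_ring_iff], rule_format, of "(\<alpha>, B)"]
    by (simp add: jet_eq_0_iff)
  have ann: "partial_form \<omega> \<eta> = 0" if \<omega>: "\<omega> \<in> orbit_forms m (m div p) n" for \<omega>
  proof -
    obtain i k where "0 < i + k" "bihomogeneous i k \<omega>"
      using orbit_forms_invariant(2)[OF K m p n \<omega>] by (elim exE conjE)
    then show ?thesis
      by (rule super_harmonics_invariant[OF K \<eta> orbit_forms_invariant(1)[OF K m p n \<omega>]])
  qed
  fix F dF \<beta> B assume F: "(F, dF) \<in> invariant_pairs m (m div p) n"
  have "partial_form (with_theta F {||}) \<eta> = 0"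
    using F by (intro ann) (auto simp: orbit_forms_def)
  then have "jet (partial_form (with_theta F {||}) \<eta>) \<beta> B = 0" by simp
  then show "pair F (\<lambda>\<alpha>. jet \<eta> (\<alpha> + \<beta>) B) = 0" by (simp add: jet_partial_with_theta)
  have "partial_form (\<Sum>j<n. with_theta (dF j) {|j|}) \<eta> = 0"
    using F unfolding orbit_forms_def by (intro ann) (auto simp: orbit_forms_def)
  then have "jet (partial_form (\<Sum>j<n. with_theta (dF j) {|j|}) \<eta>) \<beta> B = 0" by simp
  then have "(\<Sum>j<n. theta_sign {|j|} B * pair (dF j) (\<lambda>\<alpha>. jet \<eta> (\<alpha> + \<beta>) (finsert j B))) = 0"
    by (simp add: partial_form_sum jet_sum jet_partial_with_theta)
  also have "(\<Sum>j<n. theta_sign {|j|} B * pair (dF j) (\<lambda>\<alpha>. jet \<eta> (\<alpha> + \<beta>) (finsert j B)))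
     = (\<Sum>j\<in>{..<n} - fset B. theta_sign {|j|} B * pair (dF j) (\<lambda>\<alpha>. jet \<eta> (\<alpha> + \<beta>) (finsert j B)))"
    by (intro sum.mono_neutral_right) (auto simp: theta_sign_def)
  finally show "(\<Sum>j\<in>{..<n} - fset B. theta_sign {|j|} B * pair (dF j) (\<lambda>\<alpha>. jet \<eta> (\<alpha> + \<beta>) (finsert j B))) = 0" .
qed

section \<open>Exponents of invariants\<close>

lemma primitive_root_of_unity:
  assumes m: "1 \<le> m"
  obtains \<zeta> :: complex where "\<zeta> ^ m = 1" "\<And>k. \<zeta> ^ k = 1 \<Longrightarrow> m dvd k"
proof
  let ?\<zeta> = "cis (2 * pi * real 1 / real m)"
  have pow: "?\<zeta> ^ k = cis (2 * pi * real k / real m)" for k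
    unfolding DeMoivre by (simp add: mult_ac)
  show m1: "?\<zeta> ^ m = 1" unfolding pow using m by simp
  show "m dvd k" if "?\<zeta> ^ k = 1" for k
  proof -
    have "?\<zeta> ^ k = (?\<zeta> ^ m) ^ (k div m) * ?\<zeta> ^ (k mod m)"
      by (simp only: power_mult[symmetric] power_add[symmetric] mult_div_mod_eq)
    then have "?\<zeta> ^ (k mod m) = 1" using that m1 by simp
    then have "cis (2 * pi * real (k mod m) / real m) = cis (2 * pi * real 0 / real m)"
      unfolding pow by simp
    moreover have "inj_on (\<lambda>k. cis (2 * pi * real k / real m)) {..<m}"
      using bij_betw_roots_unity[of m] m by (simp add: bij_betw_def)
    moreover have "k mod m < m" "0 < m" using m by auto
    ultimately have "k mod m = 0"
      by (elim inj_onD[of "\<lambda>k. cis (2 * pi * real k / real m)"]) auto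
    then show ?thesis by auto
  qed
qed

text \<open>Diagonal matrices scale monomials, so they fix every monomial of an invariant.\<close>

lemma invariant_character:
  fixes c :: "nat \<Rightarrow> complex"
  assumes f: "f \<in> invariant_forms K n (monomial_group m p n)" and m: "1 \<le> m"
    and bi: "bihomogeneous i k f" "k \<le> 1" and key: "l \<in> keys f"
    and c: "\<And>j. j < n \<Longrightarrow> c j ^ m = 1" "(\<Prod>j<n. c j) ^ (m div p) = 1"
  shows "(\<Prod>j<n. c j ^ lookup (weight l) j) = 1"
proof -
  let ?\<sigma> = "monomial_mat n id c"
  let ?\<chi> = "\<lambda>l. \<Prod>j<n. cnj (c j) ^ lookup (weight l) j"
  have "?\<sigma> \<in> monomial_group m p n" by (rule monomial_mat_in_group[OF _ c(1) m c(2)]) auto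
  then have inv: "form_action n ?\<sigma> f = f" and car: "f \<in> carrier (form_ring K n)"
    using f by (auto simp: invariant_forms_def)
  have "form_action n ?\<sigma> f
      = form_action n ?\<sigma> (\<Sum>l\<in>keys f. single l (lookup f l))"
    by (simp only: sum_single)
  also have "\<dots> = (\<Sum>l\<in>keys f. single l (lookup f l * ?\<chi> l))"
    unfolding form_action_sum
  proof (intro sum.cong refl)
    fix l assume l: "l \<in> keys f"
    obtain \<alpha> I where lI: "l = (\<alpha>, I)" by (cases l)
    have "keys \<alpha> \<subseteq> {..<n}" "fset I \<subseteq> {..<n}" "fcard I \<le> 1"
      using l car bi unfolding carrier_form_ring_iff by (auto simp: bihomogeneous_def in_keys_iff lI)
    then show "form_action n ?\<sigma> (single l (lookup f l))
        = single l (lookup f l * ?\<chi> l)"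
      unfolding lI by (subst form_action_single) auto
  qed
  finally have f_eq: "f = (\<Sum>l\<in>keys f. single l (lookup f l * ?\<chi> l))"
    using inv by simp
  have "lookup f l
      = lookup (\<Sum>l\<in>keys f. single l (lookup f l * ?\<chi> l)) l"
    by (rule arg_cong[OF f_eq, of "\<lambda>f. lookup f l"])
  also have "\<dots> = (\<Sum>l'\<in>keys f. if l' = l then lookup f l' * ?\<chi> l' else 0)"
    unfolding lookup_sum by (intro sum.cong refl) (simp add: lookup_single when_def)
  also have "\<dots> = lookup f l * ?\<chi> l" using key by simp
  finally have "?\<chi> l = 1" using key by (simp add: in_keys_iff)
  then have "cnj (?\<chi> l) = 1" by simp
  then show ?thesis by simp
qed

lemma prod_two_powers:
  fixes x y :: "'a::comm_monoid_mult" and n :: nat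
  assumes "a < n" "b < n" "a \<noteq> b"
  shows "(\<Prod>j<n. (if j = a then x else if j = b then y else 1) ^ g j) = x ^ g a * y ^ g b"
proof -
  have "(\<Prod>j<n. (if j = a then x else if j = b then y else 1) ^ g j)
      = (\<Prod>j<n. (if j = a then x ^ g a else 1) * (if j = b then y ^ g b else 1))"
    using assms by (intro prod.cong) auto
  also have "\<dots> = (\<Prod>j<n. if j = a then x ^ g a else 1) * (\<Prod>j<n. if j = b then y ^ g b else 1)"
    by (rule prod.distrib)
  also have "\<dots> = x ^ g a * y ^ g b"
    using assms by (simp only: prod.delta[OF finite_lessThan] lessThan_iff if_True)
  finally show ?thesis .
qed

text \<open>The diagonal matrix with a primitive root of unity at \<open>a\<close> and its inverse at \<open>b\<close> has determinant \<open>1\<close>.\<close>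

lemma invariant_weight_cong:
  assumes f: "f \<in> invariant_forms K n (monomial_group m p n)" and m: "1 \<le> m"
    and bi: "bihomogeneous i k f" "k \<le> 1" and key: "l \<in> keys f" and ab: "a < n" "b < n"
  shows "int m dvd int (lookup (weight l) a) - int (lookup (weight l) b)"
proof (cases "a = b")
  case False
  let ?g = "lookup (weight l)"
  obtain \<zeta> :: complex where \<zeta>: "\<zeta> ^ m = 1" "\<And>k. \<zeta> ^ k = 1 \<Longrightarrow> m dvd k"
    using primitive_root_of_unity[OF m] by blast
  have \<zeta>0: "\<zeta> \<noteq> 0" using \<zeta>(1) m by (auto simp: zero_power)
  let ?c = "\<lambda>j. if j = a then \<zeta> else if j = b then inverse \<zeta> else 1"
  have "(\<Prod>j<n. ?c j) = 1"
    using prod_two_powers[OF ab False, of \<zeta> "inverse \<zeta>" "\<lambda>_. 1"] \<zeta>0 by simp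
  then have "(\<Prod>j<n. ?c j ^ ?g j) = 1"
    using \<zeta>(1) by (intro invariant_character[OF f m bi key]) (auto simp: power_inverse)
  then have "\<zeta> ^ ?g a * inverse \<zeta> ^ ?g b = 1" unfolding prod_two_powers[OF ab False] .
  then have eq: "\<zeta> ^ ?g a = \<zeta> ^ ?g b" using \<zeta>0 by (simp add: field_simps)
  have *: "int m dvd int x - int y" if "\<zeta> ^ x = \<zeta> ^ y" "y \<le> x" for x y
  proof -
    have "\<zeta> ^ (x - y) * \<zeta> ^ y = 1 * \<zeta> ^ y" using that by (simp flip: power_add)
    then have "\<zeta> ^ (x - y) = 1" using \<zeta>0 by simp
    then have "m dvd x - y" by (rule \<zeta>(2))
    then have "int m dvd int (x - y)" by simp
    then show ?thesis using that(2) by (simp add: of_nat_diff)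
  qed
  show ?thesis
  proof (cases "?g b \<le> ?g a")
    case True then show ?thesis using * eq by blast
  next
    case False
    then have "int m dvd int (?g b) - int (?g a)" using *[of "?g b" "?g a"] eq by simp
    then show ?thesis by (simp only: dvd_diff_commute)
  qed
qed simp

text \<open>Tested with the diagonal matrix whose only entry different from \<open>1\<close> is \<open>\<zeta>\<^sup>p\<close> at \<open>a\<close>, for a primitive root \<open>\<zeta>\<close>.\<close>

lemma invariant_weight_dvd:
  assumes f: "f \<in> invariant_forms K n (monomial_group m p n)" and m: "1 \<le> m" and p: "p dvd m"
    and bi: "bihomogeneous i k f" "k \<le> 1" and key: "l \<in> keys f" and a: "a < n"
  shows "(m div p) dvd lookup (weight l) a"
proof -
  let ?g = "lookup (weight l)"
  obtain \<zeta> :: complex where \<zeta>: "\<zeta> ^ m = 1" "\<And>k. \<zeta> ^ k = 1 \<Longrightarrow> m dvd k"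
    using primitive_root_of_unity[OF m] by blast
  have mp: "m = p * (m div p)" using p by simp
  let ?c = "\<lambda>j. if j = a then \<zeta> ^ p else 1"
  have "(\<Prod>j<n. ?c j) = \<zeta> ^ p" using a by simp
  moreover have "(\<zeta> ^ p) ^ (m div p) = 1" using \<zeta>(1) mp by (simp flip: power_mult)
  moreover have "?c j ^ m = 1" for j using \<zeta>(1) by (simp flip: power_mult add: mult.commute[of p]) (simp add: power_mult)
  ultimately have "(\<Prod>j<n. ?c j ^ ?g j) = 1"
    by (intro invariant_character[OF f m bi key]) auto
  also have "(\<Prod>j<n. ?c j ^ ?g j) = (\<Prod>j<n. if j = a then (\<zeta> ^ p) ^ ?g a else 1)"
    by (intro prod.cong) auto
  also have "\<dots> = \<zeta> ^ (p * ?g a)" using a by (simp add: power_mult)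
  finally have "m dvd p * ?g a" by (rule \<zeta>(2))
  then have "p * (m div p) dvd p * ?g a" using mp by simp
  moreover have "0 < p" using m mp by (cases p) auto
  ultimately show ?thesis by simp
qed

abbreviation swap2 :: "nat \<Rightarrow> nat \<Rightarrow> nat \<Rightarrow> nat" where "swap2 \<equiv> Transposition.transpose"

lemma permute_exponent_comp:
  "permute_exponent v (permute_exponent w \<alpha>) = permute_exponent (v \<circ> w) \<alpha>"
  by (simp add: permute_exponent_def[of w] permute_exponent_def[of "v \<circ> w"] permute_exponent_sum)

lemma permute_swap_swap [simp]: "permute_exponent (swap2 a b) (permute_exponent (swap2 a b) \<alpha>) = \<alpha>"
  by (simp add: permute_exponent_comp)

lemma image_swap_swap [simp]: "swap2 a b |`| (swap2 a b |`| I) = I"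
  by (rule fset_eqI) (auto simp: image_iff)

lemma lookup_permute_swap [simp]:
  "lookup (permute_exponent (swap2 a b) \<alpha>) i = lookup \<alpha> (swap2 a b i)"
proof -
  have "lookup (permute_exponent (swap2 a b) \<alpha>) i
     = (\<Sum>j\<in>keys \<alpha>. if j = swap2 a b i then lookup \<alpha> j else 0)"
    unfolding permute_exponent_def lookup_sum
    by (intro sum.cong) (auto simp: lookup_single when_def)
  then show ?thesis by (simp add: in_keys_iff)
qed

lemma keys_permute_swap:
  "keys (permute_exponent (swap2 a b) \<alpha>) = swap2 a b ` keys \<alpha>"
proof -
  have "i \<in> keys (permute_exponent (swap2 a b) \<alpha>) \<longleftrightarrow> i \<in> swap2 a b ` keys \<alpha>" for i
  proof
    assume "i \<in> keys (permute_exponent (swap2 a b) \<alpha>)"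
    then have "swap2 a b i \<in> keys \<alpha>" by (simp add: in_keys_iff)
    then show "i \<in> swap2 a b ` keys \<alpha>" by (rule rev_image_eqI) simp
  next
    assume "i \<in> swap2 a b ` keys \<alpha>"
    then show "i \<in> keys (permute_exponent (swap2 a b) \<alpha>)" by (auto simp: in_keys_iff)
  qed
  then show ?thesis by blast
qed

lemma weight_swap:
  "weight (permute_exponent (swap2 a b) \<alpha>, swap2 a b |`| I) = permute_exponent (swap2 a b) (weight (\<alpha>, I))"
proof -
  have "(\<Sum>i\<in>swap2 a b ` fset I. single i (1::nat)) = (\<Sum>i\<in>fset I. single (swap2 a b i) 1)"
    by (subst sum.reindex) (auto intro: inj_onI)
  then show ?thesis by (simp add: weight_def permute_exponent_add permute_exponent_sum)
qed

lemma invariant_swap: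
  assumes f: "f \<in> invariant_forms K n (monomial_group m p n)" and m: "1 \<le> m"
    and bi: "bihomogeneous i k f" "k \<le> 1" and ab: "a < n" "b < n"
  shows "lookup f (permute_exponent (swap2 a b) \<alpha>, swap2 a b |`| I) = lookup f (\<alpha>, I)"
proof -
  let ?\<tau> = "swap2 a b"
  let ?T = "\<lambda>l :: monom_form. (permute_exponent ?\<tau> (fst l), ?\<tau> |`| snd l)"
  have bij: "bij_betw ?\<tau> {..<n} {..<n}" using ab by simp
  have "monomial_mat n ?\<tau> (\<lambda>_. 1) \<in> monomial_group m p n"
    by (rule monomial_mat_in_group[OF bij _ m]) auto
  then have inv: "form_action n (monomial_mat n ?\<tau> (\<lambda>_. 1)) f = f" and car: "f \<in> carrier (form_ring K n)"
    using f by (auto simp: invariant_forms_def)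
  have \<tau>n: "?\<tau> j < n" if "j < n" for j using ab that by (auto simp: transpose_def)
  have "form_action n (monomial_mat n ?\<tau> (\<lambda>_. 1)) f
      = form_action n (monomial_mat n ?\<tau> (\<lambda>_. 1)) (\<Sum>l\<in>keys f. single l (lookup f l))"
    by (simp only: sum_single)
  also have "\<dots> = (\<Sum>l\<in>keys f. single (?T l) (lookup f l))"
    unfolding form_action_sum
  proof (intro sum.cong refl)
    fix l assume l: "l \<in> keys f"
    obtain \<alpha> I where lI: "l = (\<alpha>, I)" by (cases l)
    have "keys \<alpha> \<subseteq> {..<n}" "fset I \<subseteq> {..<n}" "fcard I \<le> 1"
      using l car bi unfolding carrier_form_ring_iff by (auto simp: bihomogeneous_def in_keys_iff lI)
    then show "form_action n (monomial_mat n ?\<tau> (\<lambda>_. 1)) (single l (lookup f l))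
        = single (?T l) (lookup f l)"
      unfolding lI by (subst form_action_single[OF \<tau>n]) auto
  qed
  finally have f_eq: "f = (\<Sum>l\<in>keys f. single (?T l) (lookup f l))"
    using inv by simp
  have TT: "?T (?T l) = l" for l by simp
  have step: "lookup f (?T l) = lookup f l" if l: "l \<in> keys f" for l
  proof -
    have "lookup f (?T l)
       = lookup (\<Sum>l\<in>keys f. single (?T l) (lookup f l)) (?T l)"
      by (rule arg_cong[OF f_eq, of "\<lambda>f. lookup f (?T l)"])
    also have "\<dots> = (\<Sum>l'\<in>keys f. if l' = l then lookup f l' else 0)"
      unfolding lookup_sum
    proof (intro sum.cong refl)
      fix l' :: monom_form
      have "?T l' = ?T l \<longleftrightarrow> l' = l" using TT[of l'] TT[of l] by metis
      then show "lookup (single (?T l') (lookup f l')) (?T l)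
          = (if l' = l then lookup f l' else 0)"
        by (simp only: lookup_single when_def)
    qed
    also have "\<dots> = lookup f l" using l by simp
    finally show ?thesis .
  qed
  have "lookup f (?T l) = lookup f l" for l
  proof (cases "l \<in> keys f \<or> ?T l \<in> keys f")
    case True
    then show ?thesis using step[of l] step[of "?T l"] TT[of l] by metis
  next
    case False
    then show ?thesis by (simp add: in_keys_iff)
  qed
  from this[of "(\<alpha>, I)"] show ?thesis by simp
qed

lemma sum_ge_sum_lessThan: "finite S \<Longrightarrow> (\<Sum>i<card S. i) \<le> (\<Sum>S :: nat)"
proof (induction "card S" arbitrary: S)
  case (Suc k)
  have ne: "S \<noteq> {}" using Suc.hyps(2) by auto
  let ?M = "Max S"
  have "S \<subseteq> {..?M}" using Suc.prems by auto
  then have "card S \<le> Suc ?M" using card_mono[of "{..?M}" S] by simp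
  then have "k \<le> ?M" using Suc.hyps(2) by simp
  moreover have "k = card (S - {?M})" using Suc.hyps(2) Suc.prems ne by simp
  then have "(\<Sum>i<k. i) \<le> \<Sum>(S - {?M})" using Suc.hyps(1)[of "S - {?M}"] Suc.prems by simp
  moreover have "\<Sum>S = ?M + \<Sum>(S - {?M})" using Suc.prems ne by (intro sum.remove) auto
  ultimately show ?case unfolding Suc.hyps(2)[symmetric] by simp
qed simp

lemma top_degree_eq: "top_degree m e n = n * (e - 1) + m * (\<Sum>i<n. i)"
proof -
  have "(\<Sum>j<n. n - 1 - j) = (\<Sum>i<n. i)"
    using sum.nat_diff_reindex[of "\<lambda>i. i" n] by simp
  then show ?thesis by (simp add: top_degree_def sum.distrib flip: sum_distrib_left)
qed

text \<open>The exponents are \<open>r + m q\<^sub>i\<close> with a common remainder \<open>r\<close>. Divisibility of \<open>r + 1\<close> by \<open>e\<close> gives \<open>r \<ge> e - 1\<close>, and the \<open>q\<^sub>i\<close>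
  are distinct, so their sum is at least \<open>0 + 1 + \<dots> + (n - 1)\<close>.\<close>

lemma distinct_exponents_bound:
  fixes b :: "nat \<Rightarrow> nat"
  assumes m: "1 \<le> m" and e: "e dvd m" and inj: "inj_on b {..<n}"
    and cong: "\<And>i j. i < n \<Longrightarrow> j < n \<Longrightarrow> int m dvd int (b i) - int (b j)"
    and dvd: "\<And>i. i < n \<Longrightarrow> e dvd Suc (b i)"
  shows "top_degree m e n \<le> (\<Sum>i<n. b i)"
proof (cases "n = 0")
  case False
  define r where "r = b 0 mod m"
  have r: "b i mod m = r" if "i < n" for i
    using cong[OF that, of 0] False unfolding r_def
    by (simp only: mod_eq_dvd_iff[symmetric] zmod_int[symmetric] of_nat_eq_iff)
  have b: "b i = r + m * (b i div m)" if "i < n" for i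
    using r[OF that] mult_div_mod_eq[of m "b i"] by simp
  have "e dvd Suc r"
  proof -
    have "e dvd Suc (r + m * (b 0 div m))" using dvd[of 0] b[of 0] False by simp
    then have "e dvd Suc r + m * (b 0 div m)" by simp
    then show ?thesis using e by (simp only: dvd_add_left_iff dvd_mult2)
  qed
  then have "e \<le> Suc r" by (rule dvd_imp_le) simp
  then have er: "e - 1 \<le> r" by simp
  have injq: "inj_on (\<lambda>i. b i div m) {..<n}"
  proof (rule inj_onI)
    fix i j assume "i \<in> {..<n}" "j \<in> {..<n}" "b i div m = b j div m"
    then have "b i = b j" using b[of i] b[of j] by simp
    then show "i = j" using inj \<open>i \<in> _\<close> \<open>j \<in> _\<close> by (auto dest: inj_onD)
  qed
  then have "(\<Sum>i<n. i) \<le> (\<Sum>i<n. b i div m)"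
    using sum_ge_sum_lessThan[of "(\<lambda>i. b i div m) ` {..<n}"] by (simp add: card_image sum.reindex)
  then have "m * (\<Sum>i<n. i) \<le> m * (\<Sum>i<n. b i div m)" by simp
  moreover have "n * (e - 1) \<le> n * r" using er by simp
  moreover have "(\<Sum>i<n. b i) = (\<Sum>i<n. r + m * (b i div m))" using b by (intro sum.cong) auto
  then have "(\<Sum>i<n. b i) = n * r + m * (\<Sum>i<n. b i div m)" by (simp add: sum.distrib sum_distrib_left)
  ultimately show ?thesis unfolding top_degree_eq by linarith
qed (simp add: top_degree_def)

text \<open>If two entries of \<open>\<beta>\<close> agree, the corresponding transposition fixes \<open>\<beta>\<close> and the invariant \<open>f\<close>, and it changes
  the sign of \<open>\<phi>\<close>, so the sum equals its negative. If all are distinct, \<open>distinct_exponents_bound\<close> gives \<open>\<beta>\<close> the degree \<open>M\<close> at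
  least, and a monomial of \<open>f\<close> in front of it exceeds the degree of the support of \<open>\<phi>\<close>.\<close>

lemma invariant_annihilates:
  assumes f: "f \<in> invariant_forms K n (monomial_group m p n)" and m: "1 \<le> m" and p: "p dvd m"
    and bi: "bihomogeneous i k f" "k \<le> 1" "0 < i + k"
    and supp: "\<And>\<gamma>. \<phi> \<gamma> \<noteq> 0 \<Longrightarrow> keys \<gamma> \<subseteq> {..<n} \<and> x_deg \<gamma> = top_degree m (m div p) n \<and>
        (\<forall>i<n. int m dvd int (lookup \<gamma> i) - (int (m div p) - 1))"
    and anti: "\<And>a b \<gamma>. a < n \<Longrightarrow> b < n \<Longrightarrow> a \<noteq> b \<Longrightarrow> \<phi> (permute_exponent (swap2 a b) \<gamma>) = - \<phi> \<gamma>"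
  shows "(\<Sum>l\<in>keys f. cnj (lookup f l) * \<phi> (weight l + \<beta>)) = 0" (is "?S = 0")
proof (rule ccontr)
  assume nz: "?S \<noteq> 0"
  then obtain l where l: "l \<in> keys f" "cnj (lookup f l) * \<phi> (weight l + \<beta>) \<noteq> 0"
    by (rule sum.not_neutral_contains_not_neutral)
  then have \<phi>: "\<phi> (weight l + \<beta>) \<noteq> 0" by auto
  let ?e = "m div p" and ?b = "lookup \<beta>" and ?g = "lookup (weight l)"
  have em: "?e dvd m" using p by (auto simp: dvd_def)
  have e1: "1 \<le> ?e" using m p by (auto simp: dvd_def)
  have inj: "inj_on ?b {..<n}"
  proof (rule inj_onI, rule ccontr)
    fix a b assume ab: "a \<in> {..<n}" "b \<in> {..<n}" "?b a = ?b b" "a \<noteq> b"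
    let ?T = "\<lambda>l :: monom_form. (permute_exponent (swap2 a b) (fst l), swap2 a b |`| snd l)"
    have fT: "lookup f (?T l) = lookup f l" for l
      using invariant_swap[OF f m bi(1,2), of a b "fst l" "snd l"] ab by simp
    have "permute_exponent (swap2 a b) \<beta> = \<beta>"
      using ab(3) by (intro poly_mapping_eqI) (auto simp: transpose_def)
    then have wT: "weight (?T l) + \<beta> = permute_exponent (swap2 a b) (weight l + \<beta>)" for l
      using weight_swap[of a b "fst l" "snd l"] by (simp add: permute_exponent_add)
    have "?S = (\<Sum>l\<in>keys f. cnj (lookup f (?T l)) * \<phi> (weight (?T l) + \<beta>))"
      by (rule sum.reindex_bij_witness[of _ ?T ?T]) (auto simp: in_keys_iff fT[unfolded fst_conv snd_conv] fT)
    also have "\<dots> = - ?S"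
      unfolding fT wT using anti[of a b] ab by (simp add: sum_negf)
    finally show False using nz by simp
  qed
  have s: "keys (weight l + \<beta>) \<subseteq> {..<n}" "x_deg (weight l + \<beta>) = top_degree m ?e n"
    and s3: "\<And>i. i < n \<Longrightarrow> int m dvd int (?g i + ?b i) - (int ?e - 1)"
    using supp[OF \<phi>] by (auto simp: lookup_add)
  have "top_degree m ?e n \<le> (\<Sum>i<n. ?b i)"
  proof (rule distinct_exponents_bound[OF m em inj])
    fix i j assume ij: "i < n" "j < n"
    have "int m dvd (int (?g i + ?b i) - (int ?e - 1)) - (int (?g j + ?b j) - (int ?e - 1)) - (int (?g i) - int (?g j))"
      by (intro dvd_diff s3 ij invariant_weight_cong[OF f m bi(1,2) l(1)])
    then show "int m dvd int (?b i) - int (?b j)" by (simp add: algebra_simps)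
  next
    fix i assume i: "i < n"
    have "int ?e dvd int m" using em by simp
    then have "int ?e dvd int (?g i + ?b i) - (int ?e - 1)" using s3[OF i] by (rule dvd_trans)
    moreover have "int ?e dvd int (?g i)" using invariant_weight_dvd[OF f m p bi(1,2) l(1) i] by simp
    ultimately have "int ?e dvd (int (?g i + ?b i) - (int ?e - 1)) - int (?g i) + int ?e"
      by (intro dvd_add[OF dvd_diff dvd_refl])
    then have "int ?e dvd int (Suc (?b i))" by (simp add: algebra_simps)
    then show "?e dvd Suc (?b i)" by (simp only: int_dvd_int_iff)
  qed
  moreover have "(\<Sum>i<n. ?b i) = x_deg \<beta>"
    using s(1) by (intro x_deg_superset[symmetric]) (auto simp: keys_add_nat)
  moreover have "x_deg (weight l) = i + k"
  proof -
    have "x_deg (\<Sum>j\<in>A. single j 1) = card A" if "finite A" for A :: "nat set"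
      using that by (induction A) (simp_all add: x_deg_add x_deg_def[of 0])
    then show ?thesis using bi(1) l(1)
      by (auto simp: weight_def x_deg_add bihomogeneous_def fcard.rep_eq)
  qed
  ultimately show False using s(2) bi(3) by (simp add: x_deg_add)
qed

section \<open>Antisymmetry and support of the top polynomial\<close>

lemma mult_eq_sum_singles:
  "F * G = (\<Sum>\<alpha>\<in>keys F. \<Sum>\<beta>\<in>keys G.
     single (\<alpha> + \<beta>) (lookup F \<alpha> * lookup G \<beta>))"
  for F G :: mpoly
proof -
  have "F * G = (\<Sum>\<alpha>\<in>keys F. single \<alpha> (lookup F \<alpha>))
      * (\<Sum>\<beta>\<in>keys G. single \<beta> (lookup G \<beta>))"
    by (simp only: sum_single)
  then show ?thesis by (simp add: sum_product mult_single)
qed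

definition permute_poly :: "(nat \<Rightarrow> nat) \<Rightarrow> mpoly \<Rightarrow> mpoly" where
  "permute_poly w F = (\<Sum>\<alpha>\<in>keys F. single (permute_exponent w \<alpha>) (lookup F \<alpha>))"

lemma permute_poly_superset:
  "finite A \<Longrightarrow> keys F \<subseteq> A \<Longrightarrow>
    permute_poly w F = (\<Sum>\<alpha>\<in>A. single (permute_exponent w \<alpha>) (lookup F \<alpha>))"
  unfolding permute_poly_def by (intro sum.mono_neutral_left) (auto simp: in_keys_iff)

lemma permute_poly_single [simp]:
  "permute_poly w (single \<alpha> c) = single (permute_exponent w \<alpha>) c"
  by (subst permute_poly_superset[of "{\<alpha>}"]) auto

lemma permute_poly_add: "permute_poly w (F + G) = permute_poly w F + permute_poly w G"
proof -
  let ?A = "keys F \<union> keys G"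
  have "keys (F + G) \<subseteq> ?A" by (rule Poly_Mapping.keys_add)
  then show ?thesis
    by (simp add: permute_poly_superset[of ?A] lookup_add Poly_Mapping.single_add sum.distrib)
qed

lemma permute_poly_0 [simp]: "permute_poly w 0 = 0"
  by (simp add: permute_poly_def)

lemma permute_poly_sum: "permute_poly w (sum F A) = (\<Sum>a\<in>A. permute_poly w (F a))"
  by (induction A rule: infinite_finite_induct) (auto simp: permute_poly_add)

lemma permute_poly_diff: "permute_poly w (F - G) = permute_poly w F - permute_poly w G"
  using permute_poly_add[of w "F - G" G] by (simp add: eq_diff_eq)

lemma permute_poly_mult: "permute_poly w (F * G) = permute_poly w F * permute_poly w G"
  unfolding mult_eq_sum_singles[of F G] permute_poly_sum permute_poly_def[of w F] permute_poly_def[of w G] sum_product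
  by (simp add: mult_single permute_exponent_add)

lemma permute_poly_prod: "permute_poly w (prod F A) = (\<Prod>a\<in>A. permute_poly w (F a))"
proof (induction A rule: infinite_finite_induct)
  case (insert x A)
  then show ?case by (simp add: permute_poly_mult)
qed (simp_all add: permute_exponent_def flip: single_one)

lemma permute_poly_var_power: "permute_poly w (var i ^ c) = var (w i) ^ c"
  by (simp add: var_power)

lemma lookup_permute_poly_swap:
  "lookup (permute_poly (swap2 a b) F) \<gamma> = lookup F (permute_exponent (swap2 a b) \<gamma>)"
proof -
  have "permute_exponent (swap2 a b) \<alpha> = \<gamma> \<longleftrightarrow> \<alpha> = permute_exponent (swap2 a b) \<gamma>" for \<alpha>
    using permute_swap_swap[of a b] by metis
  then have "lookup (permute_poly (swap2 a b) F) \<gamma>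
     = (\<Sum>\<alpha>\<in>keys F. if \<alpha> = permute_exponent (swap2 a b) \<gamma> then lookup F \<alpha> else 0)"
    unfolding permute_poly_def lookup_sum by (intro sum.cong) (auto simp: lookup_single when_def)
  then show ?thesis by (simp add: in_keys_iff)
qed

definition pairs :: "nat \<Rightarrow> (nat \<times> nat) set" where
  "pairs n = {(i, j). i < j \<and> j < n}"

lemma finite_pairs [simp]: "finite (pairs n)"
  by (rule finite_subset[of _ "{..<n} \<times> {..<n}"]) (auto simp: pairs_def)

lemma card_pairs: "card (pairs n) = (\<Sum>j<n. j)"
proof -
  have "pairs n = prod.swap ` (SIGMA j:{..<n}. {..<j})" by (auto simp: pairs_def image_iff)
  then have "card (pairs n) = card (SIGMA j:{..<n}. {..<j})"
    by (simp add: card_image)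
  then show ?thesis by simp
qed

lemma sum_lessThan_eq_choose: "(\<Sum>j<n. j) = n choose 2"
  by (induction n) (simp_all add: numeral_2_eq_2)

lemma top_poly_eq:
  "top_poly m p n = (\<Prod>(i, j)\<in>pairs n. var j ^ m - var i ^ m) * (\<Prod>i<n. var i ^ (m div p - 1))"
  by (simp add: top_poly_def pairs_def prod_power_distrib)

lemma swap_adjacent_pairs:
  assumes "Suc a < n"
  shows "bij_betw (\<lambda>(i, j). (swap2 a (Suc a) i, swap2 a (Suc a) j)) (pairs n - {(a, Suc a)}) (pairs n - {(a, Suc a)})"
proof (rule bij_betw_byWitness)
  let ?f = "\<lambda>(i, j). (swap2 a (Suc a) i, swap2 a (Suc a) j)"
  show "\<forall>x\<in>pairs n - {(a, Suc a)}. ?f (?f x) = x" "\<forall>x\<in>pairs n - {(a, Suc a)}. ?f (?f x) = x"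
    by auto
  show "?f ` (pairs n - {(a, Suc a)}) \<subseteq> pairs n - {(a, Suc a)}"
    "?f ` (pairs n - {(a, Suc a)}) \<subseteq> pairs n - {(a, Suc a)}"
    using assms by (auto simp: pairs_def transpose_def split: if_splits)
qed

text \<open>An adjacent transposition changes the sign of one factor and permutes the others.\<close>

lemma top_poly_swap_adjacent:
  assumes "Suc a < n"
  shows "permute_poly (swap2 a (Suc a)) (top_poly m p n) = - top_poly m p n"
proof -
  let ?s = "swap2 a (Suc a)"
  let ?d = "\<lambda>(i, j). var j ^ m - var i ^ m"
  let ?P = "pairs n - {(a, Suc a)}"
  have mem: "(a, Suc a) \<in> pairs n" using assms by (simp add: pairs_def)
  have V: "(\<Prod>x\<in>pairs n. ?d x) = ?d (a, Suc a) * (\<Prod>x\<in>?P. ?d x)"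
    using mem by (intro prod.remove) auto
  have "permute_poly ?s (\<Prod>x\<in>?P. ?d x) = (\<Prod>x\<in>?P. ?d ((\<lambda>(i, j). (?s i, ?s j)) x))"
    unfolding permute_poly_prod
    by (intro prod.cong) (auto simp: permute_poly_diff permute_poly_var_power)
  also have "\<dots> = (\<Prod>x\<in>?P. ?d x)"
    by (rule prod.reindex_bij_betw[OF swap_adjacent_pairs[OF assms]])
  finally have P: "permute_poly ?s (\<Prod>x\<in>?P. ?d x) = (\<Prod>x\<in>?P. ?d x)" .
  have "permute_poly ?s (\<Prod>i<n. var i ^ c) = (\<Prod>i<n. var (?s i) ^ c)" for c
    by (simp add: permute_poly_prod permute_poly_var_power)
  also have "(\<Prod>i<n. var (?s i) ^ c) = (\<Prod>i<n. var i ^ c)" for c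
    using assms by (intro prod.reindex_bij_betw) simp
  finally have E: "permute_poly ?s (\<Prod>i<n. var i ^ c) = (\<Prod>i<n. var i ^ c)" for c .
  have d: "permute_poly ?s (?d (a, Suc a)) = - ?d (a, Suc a)"
    by (simp add: permute_poly_diff permute_poly_var_power)
  show ?thesis
    unfolding top_poly_eq V permute_poly_mult P E d by (simp only: mult_minus_left)
qed

text \<open>A transposition is a conjugate of an adjacent one by adjacent ones.\<close>

lemma top_poly_swap:
  assumes "a < n" "b < n" "a \<noteq> b"
  shows "lookup (top_poly m p n) (permute_exponent (swap2 a b) \<gamma>) = - lookup (top_poly m p n) \<gamma>"
proof -
  let ?L = "lookup (top_poly m p n)"
  have adj: "?L (permute_exponent (swap2 c (Suc c)) \<gamma>) = - ?L \<gamma>" if "Suc c < n" for c \<gamma>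
    using lookup_permute_poly_swap[of c "Suc c" "top_poly m p n" \<gamma>]
    unfolding top_poly_swap_adjacent[OF that] by simp
  have less: "?L (permute_exponent (swap2 a (Suc (a + d))) \<gamma>) = - ?L \<gamma>" if "Suc (a + d) < n" for a d \<gamma>
    using that
  proof (induction d arbitrary: \<gamma>)
    case 0
    then show ?case using adj by simp
  next
    case (Suc d)
    let ?b = "Suc (a + d)"
    let ?s = "swap2 ?b (Suc ?b)"
    have "swap2 a (Suc ?b) = ?s \<circ> (swap2 a ?b \<circ> ?s)"
      by (auto simp: fun_eq_iff transpose_def)
    then have "permute_exponent (swap2 a (Suc ?b)) \<gamma>
       = permute_exponent ?s (permute_exponent (swap2 a ?b) (permute_exponent ?s \<gamma>))"
      by (simp only: permute_exponent_comp)
    then show ?case using adj[of ?b] Suc by simp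
  qed
  show ?thesis
  proof (cases "a < b")
    case True
    then show ?thesis using less[of a "b - a - 1" \<gamma>] assms by simp
  next
    case False
    then show ?thesis using less[of b "a - b - 1" \<gamma>] assms by (simp add: transpose_commute)
  qed
qed

lemma keys_mult_subset:
  fixes F G :: mpoly
  assumes "\<gamma> \<in> keys (F * G)"
  obtains \<alpha> \<beta> where "\<alpha> \<in> keys F" "\<beta> \<in> keys G" "\<gamma> = \<alpha> + \<beta>"
  using assms Poly_Mapping.keys_mult[of F G] by blast

lemma top_poly_support:
  assumes "lookup (top_poly m p n) \<gamma> \<noteq> 0" and e: "1 \<le> m div p"
  shows "keys \<gamma> \<subseteq> {..<n} \<and> x_deg \<gamma> = top_degree m (m div p) n \<and>
        (\<forall>i<n. int m dvd int (lookup \<gamma> i) - (int (m div p) - 1))"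
proof -
  define e where "e = m div p"
  let ?V = "\<lambda>A. \<Prod>(i, j)\<in>A. var j ^ m - var i ^ m"
  have V: "keys \<alpha> \<subseteq> {..<n} \<and> x_deg \<alpha> = m * card A \<and> (\<forall>i. m dvd lookup \<alpha> i)"
    if "finite A" "A \<subseteq> pairs n" "\<alpha> \<in> keys (?V A)" for A \<alpha>
    using that
  proof (induction A arbitrary: \<alpha>)
    case empty
    then show ?case by (simp add: x_deg_def)
  next
    case (insert x A)
    obtain i j where x: "x = (i, j)" by (cases x)
    have "?V (insert x A) = (var j ^ m - var i ^ m) * ?V A" using insert.hyps x by simp
    then obtain \<beta> \<delta> where bd: "\<beta> \<in> keys (var j ^ m - var i ^ m)" "\<delta> \<in> keys (?V A)" "\<alpha> = \<beta> + \<delta>"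
      using insert.prems(2) keys_mult_subset by metis
    have "keys (var j ^ m - var i ^ m) \<subseteq> {single j m, single i m}"
      unfolding var_power
      by (rule order.trans[OF Poly_Mapping.keys_diff]) auto
    then have \<beta>: "\<beta> = single j m \<or> \<beta> = single i m" using bd(1) by blast
    have ij: "i < n" "j < n" using insert.prems(1) x by (auto simp: pairs_def)
    have "keys \<beta> \<subseteq> {..<n} \<and> x_deg \<beta> = m \<and> (\<forall>i. m dvd lookup \<beta> i)"
      using \<beta> ij by (auto simp: lookup_single when_def split: if_splits)
    moreover have "keys \<delta> \<subseteq> {..<n} \<and> x_deg \<delta> = m * card A \<and> (\<forall>i. m dvd lookup \<delta> i)"
      using insert.IH[OF _ bd(2)] insert.prems(1) by simp
    ultimately show ?case
      using insert.hyps by (simp add: bd(3) keys_add_nat x_deg_add lookup_add)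
  qed
  let ?E = "\<Sum>i<n. single i (e - 1)"
  have E: "lookup ?E i = (if i < n then e - 1 else 0)" for i
    by (simp add: lookup_sum lookup_single when_def)
  have Ek: "keys ?E \<subseteq> {..<n}"
  proof
    fix i assume "i \<in> keys ?E"
    then have "lookup ?E i \<noteq> 0" by (simp only: in_keys_iff not_False_eq_True)
    then show "i \<in> {..<n}" by (rule contrapos_np) (simp only: E lessThan_iff if_False)
  qed
  have "top_poly m p n = ?V (pairs n) * single ?E 1"
    unfolding top_poly_eq e_def[symmetric] var_power[of _ "e - 1"] prod_single ..
  moreover have "\<gamma> \<in> keys (top_poly m p n)" using assms(1) by (simp add: in_keys_iff)
  ultimately have "\<gamma> \<in> keys (?V (pairs n) * single ?E 1)" by (simp only:)
  then obtain \<alpha> \<beta> where ab: "\<alpha> \<in> keys (?V (pairs n))"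
      "\<beta> \<in> keys (single ?E (1::complex))" "\<gamma> = \<alpha> + \<beta>"
    by (rule keys_mult_subset)
  have \<beta>: "\<beta> = ?E" using ab(2) by simp
  note Va = V[OF finite_pairs order.refl ab(1)]
  have "x_deg ?E = n * (e - 1)"
    unfolding x_deg_superset[OF finite_lessThan Ek] E by simp
  then have deg: "x_deg \<gamma> = top_degree m e n"
    using Va by (simp add: ab(3) \<beta> x_deg_add card_pairs top_degree_eq)
  have "int m dvd int (lookup \<gamma> i) - (int e - 1)" if "i < n" for i
  proof -
    have "int (lookup \<gamma> i) - (int e - 1) = int (lookup \<alpha> i)"
      unfolding ab(3) \<beta> lookup_add E using that e by (simp add: e_def of_nat_diff)
    then show ?thesis using Va by simp
  qed
  moreover have "keys \<gamma> \<subseteq> {..<n}"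
    using Va Ek by (simp add: ab(3) \<beta> keys_add_nat)
  ultimately show ?thesis using deg by (simp add: e_def)
qed

lemma top_poly_nonzero:
  assumes "1 \<le> m"
  shows "top_poly m p n \<noteq> 0"
proof -
  have "var j ^ m - var i ^ m \<noteq> 0" if "i < j" for i j
  proof
    assume "var j ^ m - var i ^ m = 0"
    then have "lookup (var j ^ m) (single j m) = lookup (var i ^ m) (single j m)"
      by simp
    moreover have "single i m \<noteq> single j m"
    proof
      assume "single i m = single j m"
      then have "lookup (single i m) j = lookup (single j m) j" by simp
      then show False using that assms by (simp add: lookup_single)
    qed
    ultimately show False unfolding var_power by (simp add: lookup_single)
  qed
  then have "(\<Prod>(i, j)\<in>pairs n. var j ^ m - var i ^ m) \<noteq> 0"
    by (subst prod_zero_iff[OF finite_pairs]) (auto simp: pairs_def)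
  moreover have "(\<Prod>i<n. var i ^ (m div p - 1)) \<noteq> 0"
  proof
    assume "(\<Prod>i<n. var i ^ (m div p - 1)) = 0"
    then obtain i where "var i ^ (m div p - 1) = 0"
      unfolding prod_zero_iff[OF finite_lessThan] by blast
    then have "var i = 0" by (simp only: power_eq_0_iff)
    then show False using var_neq_0 by blast
  qed
  ultimately show ?thesis unfolding top_poly_eq by (simp only: mult_eq_0_iff simp_thms)
qed

lemma top_poly_coeff_in_field:
  assumes K: "subfield K complex_field"
  shows "lookup (top_poly m p n) \<gamma> \<in> K"
proof -
  note closed = subfield_complex_closed[OF K]
  have mult: "\<forall>\<gamma>. lookup (F * G) \<gamma> \<in> K"
    if "\<forall>\<gamma>. lookup F \<gamma> \<in> K" "\<forall>\<gamma>. lookup G \<gamma> \<in> K" for F G :: mpoly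
    unfolding mult_eq_sum_singles[of F G] lookup_sum
    using that closed by (intro allI subfield_sum[OF K]) (simp add: lookup_single when_def)
  have single: "\<forall>\<gamma>. lookup (single \<alpha> 1) \<gamma> \<in> K" for \<alpha> :: "nat \<Rightarrow>\<^sub>0 nat"
    using closed by (simp add: lookup_single when_def)
  have diff: "\<forall>\<gamma>. lookup (var j ^ m - var i ^ m) \<gamma> \<in> K" for i j
  proof
    fix \<gamma>
    have "lookup (var j ^ m) \<gamma> + - lookup (var i ^ m) \<gamma> \<in> K"
      unfolding var_power by (intro closed(3,4) single[rule_format])
    then show "lookup (var j ^ m - var i ^ m) \<gamma> \<in> K" by (simp add: lookup_minus)
  qed
  have "\<forall>\<gamma>. lookup (\<Prod>(i, j)\<in>A. var j ^ m - var i ^ m) \<gamma> \<in> K" for A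
  proof (induction A rule: infinite_finite_induct)
    case (insert x A)
    obtain i j where x: "x = (i, j)" by (cases x)
    show ?case using mult[OF diff[of j i] insert.IH] insert.hyps x by simp
  qed (use single[of 0] in simp_all)
  moreover have "\<forall>\<gamma>. lookup (\<Prod>i<n. var i ^ (m div p - 1)) \<gamma> \<in> K"
    unfolding var_power prod_single by (rule single)
  ultimately show ?thesis unfolding top_poly_eq by (rule mult[THEN spec])
qed

section \<open>The top form and its differential are harmonic\<close>

definition top_jet :: "nat \<Rightarrow> nat \<Rightarrow> nat \<Rightarrow> (nat \<Rightarrow>\<^sub>0 nat) \<Rightarrow> complex" where
  "top_jet m p n \<gamma> = jet (top_form m p n) \<gamma> {||}"

lemma top_form_eq: "top_form m p n = with_theta (top_poly m p n) {||}"
  by (simp add: top_form_def form_of_poly_def with_theta_def)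

lemma jet_top_form: "jet (top_form m p n) \<gamma> B = (if B = {||} then top_jet m p n \<gamma> else 0)"
  by (simp add: top_jet_def jet_def top_form_eq lookup_with_theta)

lemma top_jet_eq_0_iff: "top_jet m p n \<gamma> = 0 \<longleftrightarrow> lookup (top_poly m p n) \<gamma> = 0"
  by (simp add: top_jet_def jet_eq_0_iff top_form_eq lookup_with_theta)

lemma top_jet_swap:
  assumes "a < n" "b < n" "a \<noteq> b"
  shows "top_jet m p n (permute_exponent (swap2 a b) \<gamma>) = - top_jet m p n \<gamma>"
proof -
  have "(\<Prod>i\<in>keys (permute_exponent (swap2 a b) \<gamma>). fact (lookup (permute_exponent (swap2 a b) \<gamma>) i))
     = (\<Prod>i\<in>keys \<gamma>. fact (lookup \<gamma> i) :: nat)"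
    unfolding keys_permute_swap by (subst prod.reindex) (auto intro: inj_onI)
  then show ?thesis
    by (simp add: top_jet_def jet_def top_form_eq lookup_with_theta top_poly_swap[OF assms])
qed

lemma theta_form_mult_with_theta: "theta_form i \<star> with_theta F {||} = with_theta F {|i|}"
  by (simp add: with_theta_def theta_form_def form_mult_sum_right form_mult_single)

lemma jet_with_theta: "jet (with_theta F I) \<gamma> B = (if B = I then jet (with_theta F {||}) \<gamma> {||} else 0)"
  by (simp add: jet_def lookup_with_theta)

lemma jet_ext_deriv_top_form:
  "jet (ext_deriv n (top_form m p n)) \<gamma> B
     = (\<Sum>i<n. if B = {|i|} then top_jet m p n (\<gamma> + single i 1) else 0)"
  unfolding ext_deriv_def jet_sum jet_partial_x top_form_eq theta_form_mult_with_theta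
  by (intro sum.cong refl) (simp add: jet_with_theta[of _ "{|_|}"] top_jet_def top_form_eq)

lemma jet_ext_deriv_single:
  "i < n \<Longrightarrow> jet (ext_deriv n (top_form m p n)) \<gamma> {|i|} = top_jet m p n (\<gamma> + single i 1)"
  by (simp add: jet_ext_deriv_top_form)

lemma jet_ext_deriv_other:
  "(\<And>i. i < n \<Longrightarrow> B \<noteq> {|i|}) \<Longrightarrow> jet (ext_deriv n (top_form m p n)) \<gamma> B = 0"
  by (simp add: jet_ext_deriv_top_form)

lemma jet_ext_deriv_nonzeroE:
  assumes "jet (ext_deriv n (top_form m p n)) \<gamma> B \<noteq> 0"
  obtains i where "i < n" "B = {|i|}" "top_jet m p n (\<gamma> + single i 1) \<noteq> 0"
proof -
  obtain i where i: "i < n" "(if B = {|i|} then top_jet m p n (\<gamma> + single i 1) else 0) \<noteq> 0"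
    using assms unfolding jet_ext_deriv_top_form
    by (rule sum.not_neutral_contains_not_neutral) simp
  then have "B = {|i|}" by (auto split: if_splits)
  then show ?thesis using i by (intro that) auto
qed

lemma subfield_inverse:
  assumes K: "subfield K complex_field" and a: "a \<in> K"
  shows "inverse a \<in> K"
proof (cases "a = 0")
  case True
  then show ?thesis using a by simp
next
  case False
  then have "a \<in> K - {\<zero>\<^bsub>complex_field\<^esub>}" using a by (simp add: complex_field_def)
  then obtain b where "b \<in> K" "a \<otimes>\<^bsub>complex_field\<^esub> b = \<one>\<^bsub>complex_field\<^esub>"
    using ring.subfield_m_inv(1,2)[OF ring_complex_field K] by blast
  then have "b \<in> K" "a * b = 1" by (simp_all add: complex_field_def)
  then show ?thesis using inverse_unique[of a b] by simp
qed

lemma subfield_of_nat: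
  assumes K: "subfield K complex_field"
  shows "of_nat r \<in> K"
  by (induction r) (simp_all add: subfield_complex_closed[OF K])

lemma carrier_jetI:
  assumes K: "subfield K complex_field" and coeff: "\<And>\<gamma> B. jet \<eta> \<gamma> B \<in> K"
    and supp: "\<And>\<gamma> B. jet \<eta> \<gamma> B \<noteq> 0 \<Longrightarrow> keys \<gamma> \<subseteq> {..<n} \<and> fset B \<subseteq> {..<n}"
  shows "\<eta> \<in> carrier (form_ring K n)"
  unfolding carrier_form_ring_iff
proof (intro conjI allI impI)
  fix k :: monom_form
  obtain \<gamma> B where k: "k = (\<gamma>, B)" by (cases k)
  define c :: complex where "c = of_nat (\<Prod>i\<in>keys \<gamma>. fact (lookup \<gamma> i))"
  have "c \<noteq> 0" by (simp add: c_def)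
  moreover have "jet \<eta> \<gamma> B = c * lookup \<eta> k" by (simp only: jet_def k c_def)
  ultimately have "lookup \<eta> k = inverse c * jet \<eta> \<gamma> B" by simp
  moreover have "c \<in> K" unfolding c_def by (rule subfield_of_nat[OF K])
  ultimately show "lookup \<eta> k \<in> K"
    using subfield_complex_closed(5)[OF K] subfield_inverse[OF K] coeff by simp
  assume "lookup \<eta> k \<noteq> 0"
  then have "jet \<eta> \<gamma> B \<noteq> 0" by (simp add: jet_eq_0_iff k)
  from supp[OF this] show "keys (fst k) \<subseteq> {..<n}" "fset (snd k) \<subseteq> {..<n}"
    by (simp_all add: k)
qed

lemma jet_in_field:
  assumes K: "subfield K complex_field" and "\<And>k. lookup \<eta> k \<in> K"
  shows "jet \<eta> \<gamma> B \<in> K"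
  unfolding jet_def by (intro subfield_complex_closed(5)[OF K] subfield_of_nat[OF K] assms(2))

text \<open>A quotient of two coefficients recovers the proportionality factor, which therefore lies in \<open>K\<close>.\<close>

lemma proportional_over_subfield:
  assumes K: "subfield K complex_field"
    and fK: "\<And>k. lookup \<eta> k \<in> K" and gK: "\<And>k. lookup \<kappa> k \<in> K"
    and c: "\<And>\<gamma> B. jet \<eta> \<gamma> B = c * jet \<kappa> \<gamma> B"
  obtains a where "a \<in> K" "\<eta> = scale_form a \<kappa>"
proof -
  have \<eta>: "\<eta> = scale_form c \<kappa>" by (rule form_eqI) (simp add: jet_scale_form c)
  show ?thesis
  proof (cases "\<kappa> = 0")
    case True
    then have "\<eta> = scale_form 0 \<kappa>" using \<eta> by (intro poly_mapping_eqI) simp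
    then show ?thesis using that subfield_complex_closed(1)[OF K] by blast
  next
    case False
    then obtain k where k: "lookup \<kappa> k \<noteq> 0"
      using poly_mapping_eqI[of \<kappa> 0] by auto
    have "lookup \<eta> k = c * lookup \<kappa> k" by (simp add: \<eta>)
    then have "c = lookup \<eta> k * inverse (lookup \<kappa> k)" using k by (simp add: field_simps)
    then have "c \<in> K" using fK gK subfield_inverse[OF K] subfield_complex_closed(5)[OF K] by simp
    then show ?thesis using \<eta> that by blast
  qed
qed

locale monomial_group_setting =
  fixes m p n :: nat and K :: "complex set"
  assumes m: "1 \<le> m" and n: "1 \<le> n" and p: "p dvd m" and K: "subfield K complex_field"
    and mp: "p \<noteq> m \<or> p = 1"
begin

abbreviation G where "G \<equiv> monomial_group m p n"
abbreviation SH where "SH \<equiv> super_harmonics_bideg K n G"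
abbreviation SHT where "SHT \<equiv> super_harmonics_total K n G"
abbreviation \<Delta> where "\<Delta> \<equiv> top_form m p n"
abbreviation d\<Delta> where "d\<Delta> \<equiv> ext_deriv n \<Delta>"
abbreviation e where "e \<equiv> m div p"
abbreviation M where "M \<equiv> top_degree m e n"
abbreviation \<phi> where "\<phi> \<equiv> top_jet m p n"

lemma e: "1 \<le> e" "e \<le> m" "2 \<le> e \<or> m = 1"
proof -
  have me: "m = p * e" using p by simp
  show e1: "1 \<le> e" using m me by (cases e) auto
  show "e \<le> m" by simp
  show "2 \<le> e \<or> m = 1" using mp me m e1 by (cases "e = 1") auto
qed

lemma \<phi>_support:
  assumes "\<phi> \<gamma> \<noteq> 0"
  shows "keys \<gamma> \<subseteq> {..<n} \<and> x_deg \<gamma> = M \<and>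
        (\<forall>i<n. int m dvd int (lookup \<gamma> i) - (int e - 1))"
  using assms top_poly_support[OF _ e(1)] by (simp add: top_jet_eq_0_iff)

lemma \<phi>_in_K: "\<phi> \<gamma> \<in> K"
  unfolding top_jet_def using subfield_complex_closed(1)[OF K] top_poly_coeff_in_field[OF K]
  by (intro jet_in_field[OF K]) (auto simp: top_form_eq with_theta_def lookup_sum lookup_single when_def intro!: subfield_sum[OF K])

lemma invariant_kills_\<phi>:
  assumes "\<omega> \<in> invariant_forms K n G" "0 < i + k" "bihomogeneous i k \<omega>" "k \<le> 1"
  shows "(\<Sum>l\<in>keys \<omega>. cnj (lookup \<omega> l) * \<phi> (weight l + \<beta>)) = 0"
  by (rule invariant_annihilates[OF assms(1) m p assms(3,4,2) \<phi>_support top_jet_swap])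

lemma weight_0: "fcard (snd l) = 0 \<Longrightarrow> weight l = fst l"
  by (simp add: weight_def)

text \<open>The form is a partial derivative of \<open>\<Delta>\<close>. An invariant with a theta kills it for lack of thetas, and any other
  invariant is covered by \<open>invariant_annihilates\<close>.\<close>

lemma shifted_top_harmonic:
  assumes \<eta>: "\<And>\<gamma> B. jet \<eta> \<gamma> B = (if B = {||} then \<phi> (\<gamma> + \<delta>) else 0)"
  shows "\<eta> \<in> super_harmonics K n G"
proof (rule super_harmonicsI[OF K])
  show "\<eta> \<in> carrier (form_ring K n)"
  proof (rule carrier_jetI[OF K])
    show "jet \<eta> \<gamma> B \<in> K" for \<gamma> B using \<phi>_in_K subfield_complex_closed(1)[OF K] by (simp add: \<eta>)
    show "keys \<gamma> \<subseteq> {..<n} \<and> fset B \<subseteq> {..<n}" if "jet \<eta> \<gamma> B \<noteq> 0" for \<gamma> B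
      using that \<phi>_support[of "\<gamma> + \<delta>"] by (auto simp: \<eta> keys_add_nat split: if_splits)
  qed
  fix \<omega> i k assume \<omega>: "\<omega> \<in> invariant_forms K n G" "0 < i + k" "bihomogeneous i k \<omega>"
  show "partial_form \<omega> \<eta> = 0"
  proof (rule form_eqI)
    fix \<beta> B
    have k: "fcard (snd l) = k" if "l \<in> keys \<omega>" for l
      using \<omega>(3) that by (auto simp: bihomogeneous_def)
    show "jet (partial_form \<omega> \<eta>) \<beta> B = jet 0 \<beta> B"
    proof (cases "k = 0 \<and> B = {||}")
      case True
      have "jet (partial_form \<omega> \<eta>) \<beta> B
          = (\<Sum>l\<in>keys \<omega>. cnj (lookup \<omega> l) * \<phi> (weight l + (\<beta> + \<delta>)))"
        unfolding jet_partial_form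
      proof (intro sum.cong refl)
        fix l assume "l \<in> keys \<omega>"
        then have l: "fcard (snd l) = 0" using k True by simp
        then have "snd l = {||}" by simp
        then show "cnj (lookup \<omega> l) * (theta_sign (snd l) B * jet \<eta> (fst l + \<beta>) (snd l |\<union>| B))
            = cnj (lookup \<omega> l) * \<phi> (weight l + (\<beta> + \<delta>))"
          using True by (simp add: weight_0[OF l] \<eta> add.assoc)
      qed
      then show ?thesis using invariant_kills_\<phi>[OF \<omega>] True by simp
    next
      case False
      have "jet \<eta> (fst l + \<beta>) (snd l |\<union>| B) = 0" if "l \<in> keys \<omega>" for l
      proof -
        have "snd l |\<union>| B \<noteq> {||}"
          using False k[OF that] by (cases "snd l = {||}") (auto simp: fcard.rep_eq)
        then show ?thesis by (simp only: \<eta> if_False)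
      qed
      then show ?thesis by (simp add: jet_partial_form)
    qed
  qed
qed

text \<open>Apart from trivial cases, the invariant has no theta and the coefficient of \<open>\<theta>\<^sub>j\<close> is a partial derivative
  of \<open>\<Delta>\<close>, or the invariant has one theta, and contracting it with \<open>d\<Delta>\<close> amounts to pairing \<open>\<Delta>\<close> with its weights.\<close>

lemma ext_deriv_top_harmonic: "d\<Delta> \<in> super_harmonics K n G" (is "?\<eta> \<in> _")
proof (rule super_harmonicsI[OF K])
  have zero: "0 \<in> K" by (rule subfield_complex_closed(1)[OF K])
  show "?\<eta> \<in> carrier (form_ring K n)"
  proof (rule carrier_jetI[OF K])
    show "jet ?\<eta> \<gamma> B \<in> K" for \<gamma> B
      unfolding jet_ext_deriv_top_form using \<phi>_in_K zero by (intro subfield_sum[OF K]) simp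
    show "keys \<gamma> \<subseteq> {..<n} \<and> fset B \<subseteq> {..<n}" if nz: "jet ?\<eta> \<gamma> B \<noteq> 0" for \<gamma> B
    proof -
      obtain i where i: "i < n" "B = {|i|}" "\<phi> (\<gamma> + single i 1) \<noteq> 0"
        using nz by (rule jet_ext_deriv_nonzeroE)
      from \<phi>_support[OF i(3)] show ?thesis using i by (simp add: keys_add_nat)
    qed
  qed
  fix \<omega> i k assume \<omega>: "\<omega> \<in> invariant_forms K n G" "0 < i + k" "bihomogeneous i k \<omega>"
  have car: "\<omega> \<in> carrier (form_ring K n)" using \<omega>(1) by (simp add: invariant_forms_def)
  show "partial_form \<omega> ?\<eta> = 0"
  proof (rule form_eqI)
    fix \<beta> B
    have k: "fcard (snd l) = k" if "l \<in> keys \<omega>" for l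
      using \<omega>(3) that by (auto simp: bihomogeneous_def)
    consider (0) j where "k = 0" "j < n" "B = {|j|}" | (1) "k = 1" "B = {||}"
      | (2) "\<not> (k = 0 \<and> (\<exists>j<n. B = {|j|}))" "\<not> (k = 1 \<and> B = {||})" by blast
    then show "jet (partial_form \<omega> ?\<eta>) \<beta> B = jet 0 \<beta> B"
    proof cases
      case 0
      have "jet (partial_form \<omega> ?\<eta>) \<beta> B
          = (\<Sum>l\<in>keys \<omega>. cnj (lookup \<omega> l) * \<phi> (weight l + (\<beta> + single j 1)))"
        unfolding jet_partial_form
      proof (intro sum.cong refl)
        fix l assume "l \<in> keys \<omega>"
        then have l: "fcard (snd l) = 0" using k 0 by simp
        then have "snd l = {||}" by simp
        then show "cnj (lookup \<omega> l) * (theta_sign (snd l) B * jet ?\<eta> (fst l + \<beta>) (snd l |\<union>| B))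
            = cnj (lookup \<omega> l) * \<phi> (weight l + (\<beta> + single j 1))"
          using 0 by (simp add: weight_0[OF l] jet_ext_deriv_single add.assoc)
      qed
      then show ?thesis using invariant_kills_\<phi>[OF \<omega>] 0 by simp
    next
      case 1
      have "jet (partial_form \<omega> ?\<eta>) \<beta> B
          = (\<Sum>l\<in>keys \<omega>. cnj (lookup \<omega> l) * \<phi> (weight l + \<beta>))"
        unfolding jet_partial_form
      proof (intro sum.cong refl)
        fix l assume l: "l \<in> keys \<omega>"
        then have "fcard (snd l) = 1" using k 1 by simp
        then obtain j where j: "snd l = {|j|}" by (rule fcard_1_elim)
        have "fset (snd l) \<subseteq> {..<n}"
          using conjunct2[OF car[unfolded carrier_form_ring_iff], rule_format, of l] l by (simp add: in_keys_iff)
        then have "j < n" using j by simp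
        then show "cnj (lookup \<omega> l) * (theta_sign (snd l) B * jet ?\<eta> (fst l + \<beta>) (snd l |\<union>| B))
            = cnj (lookup \<omega> l) * \<phi> (weight l + \<beta>)"
          using 1 j by (simp add: weight_def jet_ext_deriv_single add_ac)
      qed
      then show ?thesis using invariant_kills_\<phi>[OF \<omega>] 1 by simp
    next
      case 2
      have "theta_sign (snd l) B * jet ?\<eta> (fst l + \<beta>) (snd l |\<union>| B) = 0" if l: "l \<in> keys \<omega>" for l
      proof (cases "snd l |\<inter>| B = {||}")
        case True
        have "snd l |\<union>| B \<noteq> {|j|}" if "j < n" for j
        proof
          assume eq: "snd l |\<union>| B = {|j|}"
          have "fset (snd l) \<inter> fset B = {}" using arg_cong[OF True, of fset] by simp
          moreover have "fset (snd l) \<union> fset B = {j}" using arg_cong[OF eq, of fset] by simp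
          ultimately have card: "fcard (snd l) + fcard B = 1"
            using card_Un_disjoint[of "fset (snd l)" "fset B"] by (simp add: fcard.rep_eq)
          show False
          proof (cases "k = 0")
            case True
            then have "snd l = {||}" using k[OF l] by simp
            then show False using 2(1) eq that True by auto
          next
            case False
            then have "fcard B = 0" "k = 1" using card k[OF l] by linarith+
            then show False using 2(2) by simp
          qed
        qed
        then show ?thesis by (simp add: jet_ext_deriv_other)
      next
        case False
        then show ?thesis by (simp add: theta_sign_def)
      qed
      then have "jet (partial_form \<omega> ?\<eta>) \<beta> B = 0" unfolding jet_partial_form by (intro sum.neutral) simp
      then show ?thesis by simp
    qed
  qed
qed

lemma bihomogeneous_jetI:
  "(\<And>\<gamma> B. jet \<eta> \<gamma> B \<noteq> 0 \<Longrightarrow> x_deg \<gamma> = i \<and> fcard B = k) \<Longrightarrow> bihomogeneous i k \<eta>"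
  unfolding bihomogeneous_def by (auto simp: in_keys_iff jet_eq_0_iff)

lemma bihomogeneous_jetD:
  "bihomogeneous i k \<eta> \<Longrightarrow> jet \<eta> \<gamma> B \<noteq> 0 \<Longrightarrow> x_deg \<gamma> = i \<and> fcard B = k"
  unfolding bihomogeneous_def by (auto simp: in_keys_iff jet_eq_0_iff)

lemma top_form_bideg: "\<Delta> \<in> SH M 0"
proof -
  have "\<Delta> \<in> super_harmonics K n G"
    by (rule shifted_top_harmonic[of _ 0]) (simp add: jet_top_form)
  moreover have "bihomogeneous M 0 (\<Delta>)"
    by (rule bihomogeneous_jetI) (use \<phi>_support in \<open>auto simp: jet_top_form split: if_splits\<close>)
  ultimately show ?thesis by (simp add: super_harmonics_bideg_def)
qed

lemma ext_deriv_top_bideg: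
  assumes "1 \<le> M"
  shows "d\<Delta> \<in> SH (M - 1) 1"
proof -
  have "bihomogeneous (M - 1) 1 (d\<Delta>)"
  proof (rule bihomogeneous_jetI)
    fix \<gamma> B assume nz: "jet (d\<Delta>) \<gamma> B \<noteq> 0"
    obtain i where i: "i < n" "B = {|i|}" "\<phi> (\<gamma> + single i 1) \<noteq> 0"
      using nz by (rule jet_ext_deriv_nonzeroE)
    from \<phi>_support[OF i(3)] show "x_deg \<gamma> = M - 1 \<and> fcard B = 1"
      using i by (auto simp: x_deg_add fcard.rep_eq)
  qed
  then show ?thesis using ext_deriv_top_harmonic by (simp add: super_harmonics_bideg_def)
qed

lemma top_form_nonzero: "\<Delta> \<noteq> 0"
proof
  assume "\<Delta> = 0"
  then have "\<phi> \<gamma> = 0" for \<gamma> by (simp add: top_jet_def)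
  then have "top_poly m p n = 0" by (intro poly_mapping_eqI) (simp add: top_jet_eq_0_iff)
  then show False using top_poly_nonzero[OF m] by blast
qed

text \<open>Differentiating \<open>\<Delta>\<close> by a factor \<open>x\<^sup>\<beta>\<close> of one of its monomials does not give \<open>0\<close>; such factors exist in all
  degrees up to \<open>M\<close>.\<close>

lemma nonzero_harmonic_below:
  assumes "l \<le> M"
  obtains \<eta> where "\<eta> \<in> SH l 0" "\<eta> \<noteq> 0"
proof -
  have "\<exists>\<gamma>. \<phi> \<gamma> \<noteq> 0"
  proof (rule ccontr)
    assume "\<not> ?thesis"
    then have "top_poly m p n = 0"
      by (intro poly_mapping_eqI) (simp add: top_jet_eq_0_iff)
    then show False using top_poly_nonzero[OF m] by blast
  qed
  then obtain \<gamma> where \<gamma>: "\<phi> \<gamma> \<noteq> 0" by blast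
  have split: "\<exists>\<alpha> \<beta>. \<alpha> + \<beta> = \<gamma> \<and> x_deg \<alpha> = d" if "d \<le> x_deg \<gamma>" for d
    using that
  proof (induction d)
    case 0
    show ?case by (intro exI[of _ 0] exI[of _ \<gamma>]) (simp add: x_deg_def)
  next
    case (Suc d)
    then obtain \<alpha> \<beta> where ab: "\<alpha> + \<beta> = \<gamma>" "x_deg \<alpha> = d" by auto
    then have "x_deg \<beta> \<noteq> 0" using Suc.prems by (auto simp: x_deg_add)
    then obtain i where i: "i \<in> keys \<beta>" by (auto simp: x_deg_def)
    let ?e = "single i (1::nat)"
    have "\<alpha> + ?e + (\<beta> - ?e) = \<gamma>"
    proof -
      have "\<alpha> + ((\<beta> - ?e) + ?e) = \<gamma>" using keys_decompose[OF i] ab(1) by (simp only:)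
      then show ?thesis by (simp only: add_ac)
    qed
    moreover have "x_deg (\<alpha> + ?e) = Suc d" using ab by (simp add: x_deg_add)
    ultimately show ?case by blast
  qed
  have "l \<le> x_deg \<gamma>" using \<phi>_support[OF \<gamma>] assms by simp
  from split[OF this] obtain \<alpha> \<beta> where ab: "\<alpha> + \<beta> = \<gamma>" "x_deg \<alpha> = l" by (elim exE conjE)
  define \<eta> where "\<eta> = partial_form (single (\<beta>, {||}) 1) (\<Delta>)"
  have \<eta>: "jet \<eta> \<delta> B = (if B = {||} then \<phi> (\<delta> + \<beta>) else 0)" for \<delta> B
    by (simp add: \<eta>_def jet_partial_form_single jet_top_form add.commute)
  have "\<eta> \<in> super_harmonics K n G" by (rule shifted_top_harmonic[OF \<eta>])
  moreover have "bihomogeneous l 0 \<eta>"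
  proof (rule bihomogeneous_jetI)
    fix \<delta> B assume "jet \<eta> \<delta> B \<noteq> 0"
    then have B: "B = {||}" "\<phi> (\<delta> + \<beta>) \<noteq> 0" by (auto simp: \<eta> split: if_splits)
    then have "x_deg \<delta> + x_deg \<beta> = x_deg \<alpha> + x_deg \<beta>"
      using \<phi>_support[OF B(2)] \<phi>_support[OF \<gamma>] ab(1) by (auto simp: x_deg_add)
    then show "x_deg \<delta> = l \<and> fcard B = 0" using ab(2) B(1) by (simp add: fcard.rep_eq)
  qed
  moreover have "jet \<eta> \<alpha> {||} \<noteq> 0" using \<gamma> ab(1) by (simp add: \<eta>)
  then have "\<eta> \<noteq> 0" by auto
  ultimately show ?thesis by (intro that) (auto simp: super_harmonics_bideg_def)
qed

section \<open>The bigraded components\<close>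

lemma bideg_system:
  assumes "\<eta> \<in> SH i k"
  shows "harmonic_system m e n (jet \<eta>)" "bihomogeneous i k \<eta>" "\<And>l. lookup \<eta> l \<in> K"
proof -
  have \<eta>: "\<eta> \<in> super_harmonics K n G" "bihomogeneous i k \<eta>"
    using assms by (auto simp: super_harmonics_bideg_def)
  then show "harmonic_system m e n (jet \<eta>)" "bihomogeneous i k \<eta>"
    using harmonic_system_jet[OF K m p n] by auto
  show "lookup \<eta> l \<in> K" for l
  proof -
    have "\<eta> \<in> carrier (form_ring K n)" using \<eta>(1) by (simp add: super_harmonics_def)
    then show ?thesis unfolding carrier_form_ring_iff by (rule spec[OF conjunct1])
  qed
qed

lemma bideg_eq_0:
  assumes \<eta>: "\<eta> \<in> SH i k"
    and deg: "M < i + k \<or> (M = i + k \<and> 2 \<le> k)"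
  shows "\<eta> = 0"
proof (rule form_eqI)
  fix \<gamma> B
  note H = bideg_system[OF \<eta>]
  show "jet \<eta> \<gamma> B = jet 0 \<gamma> B"
  proof (rule ccontr)
    assume "jet \<eta> \<gamma> B \<noteq> jet 0 \<gamma> B"
    then have nz: "jet \<eta> \<gamma> B \<noteq> 0" by simp
    have "x_deg \<gamma> = i" "fcard B = k" using bihomogeneous_jetD[OF H(2) nz] by auto
    then have "jet \<eta> \<gamma> B = 0"
      using deg by (intro harmonic_system_eq_0[OF H(1) m n e]) auto
    then show False using nz by simp
  qed
qed

lemma \<phi>_system: "harmonic_system m e n (\<lambda>\<alpha> B. if B = {||} then \<phi> \<alpha> else 0)"
proof -
  have "jet (\<Delta>) = (\<lambda>\<alpha> B. if B = {||} then \<phi> \<alpha> else 0)"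
    by (intro ext) (rule jet_top_form)
  then show ?thesis using bideg_system(1)[OF top_form_bideg] by simp
qed

lemma \<phi>_top: "\<phi> (top_exponent m e n) \<noteq> 0"
proof
  assume zero: "\<phi> (top_exponent m e n) = 0"
  have "\<phi> \<gamma> = 0" for \<gamma>
  proof (rule ccontr)
    assume nz: "\<phi> \<gamma> \<noteq> 0"
    then have "M \<le> x_deg \<gamma>" using \<phi>_support by simp
    then show False
      using nz zero harmonic_system_eq_0[OF \<phi>_system m n e, of \<gamma> "{||}"] by simp
  qed
  then have "\<Delta> = 0" by (intro form_eqI) (simp add: jet_top_form)
  then show False using top_form_nonzero by blast
qed

section \<open>The components of top total degree\<close>

text \<open>The difference vanishes at \<open>top_exponent\<close>, which determines a solution in top degree.\<close>

lemma top_degree_system: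
  assumes H: "harmonic_system m e n (\<lambda>\<alpha> B. if B = {||} then \<zeta> \<alpha> else 0)" and deg: "M \<le> x_deg \<gamma>"
  shows "\<zeta> \<gamma> = (\<zeta> (top_exponent m e n) / \<phi> (top_exponent m e n)) * \<phi> \<gamma>"
proof -
  let ?c = "\<zeta> (top_exponent m e n) / \<phi> (top_exponent m e n)"
  have "harmonic_system m e n (\<lambda>\<alpha> B. (if B = {||} then \<zeta> \<alpha> else 0) - ?c * (if B = {||} then \<phi> \<alpha> else 0))"
    by (rule harmonic_system_diff[OF H \<phi>_system])
  from harmonic_system_eq_0[OF this m n e, of \<gamma> "{||}"] show ?thesis using deg \<phi>_top by simp
qed

lemma bideg_top_0:
  assumes "\<eta> \<in> SH M 0"
  obtains a where "a \<in> K" "\<eta> = scale_form a (\<Delta>)"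
proof -
  note H = bideg_system[OF assms]
  have eq: "jet \<eta> = (\<lambda>\<alpha> B. if B = {||} then jet \<eta> \<alpha> {||} else 0)"
  proof (intro ext)
    fix \<alpha> B
    show "jet \<eta> \<alpha> B = (if B = {||} then jet \<eta> \<alpha> {||} else 0)"
      using bihomogeneous_jetD[OF H(2), of \<alpha> B] by auto
  qed
  have H0: "harmonic_system m e n (\<lambda>\<alpha> B. if B = {||} then jet \<eta> \<alpha> {||} else 0)"
    using H(1) by (subst (asm) eq)
  let ?c = "jet \<eta> (top_exponent m e n) {||} / \<phi> (top_exponent m e n)"
  have "jet \<eta> \<gamma> B = ?c * jet (\<Delta>) \<gamma> B" for \<gamma> B
  proof (cases "B = {||} \<and> x_deg \<gamma> = M")
    case True
    then show ?thesis using top_degree_system[OF H0, of \<gamma>] by (simp add: jet_top_form)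
  next
    case False
    have "jet \<eta> \<gamma> B = 0" using bihomogeneous_jetD[OF H(2), of \<gamma> B] False by fastforce
    moreover have "jet (\<Delta>) \<gamma> B = 0"
      using \<phi>_support[of \<gamma>] False by (auto simp: jet_top_form)
    ultimately show ?thesis by simp
  qed
  then show ?thesis
    by (rule proportional_over_subfield[OF K H(3) bideg_system(3)[OF top_form_bideg]]) (rule that)
qed

text \<open>A potential of \<open>\<eta>\<close> is a solution of top degree, hence a multiple of \<open>\<Delta>\<close>.\<close>

lemma bideg_top_1:
  assumes "\<eta> \<in> SH i 1" and i: "i + 1 = M"
  obtains a where "a \<in> K" "\<eta> = scale_form a (d\<Delta>)"
proof -
  note H = bideg_system[OF assms(1)]
  have deg: "x_deg \<alpha> + 1 = M" if "jet \<eta> \<alpha> {|j|} \<noteq> 0" for \<alpha> j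
    using bihomogeneous_jetD[OF H(2) that] i by simp
  have "\<exists>\<zeta>. (\<forall>\<alpha> j. j < n \<longrightarrow> jet \<eta> \<alpha> {|j|} = \<zeta> (\<alpha> + single j 1)) \<and>
      harmonic_system m e n (\<lambda>\<alpha> B. if B = {||} then \<zeta> \<alpha> else 0)"
  proof (rule harmonic_system_potential[OF H(1) m n e])
    show "x_deg \<alpha> + 1 = M" if "jet \<eta> \<alpha> {|j|} \<noteq> 0" for \<alpha> j by (rule deg[OF that])
  next
    fix \<zeta>
    assume z: "\<And>\<alpha> i. i < n \<Longrightarrow> jet \<eta> \<alpha> {|i|} = \<zeta> (\<alpha> + single i 1)"
      and h: "harmonic_system m e n (\<lambda>\<alpha> B. if B = {||} then \<zeta> \<alpha> else 0)"
    show ?thesis by (intro exI[of _ \<zeta>] conjI allI impI z h)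
  qed
  then obtain \<zeta> where \<zeta>: "\<forall>\<alpha> j. j < n \<longrightarrow> jet \<eta> \<alpha> {|j|} = \<zeta> (\<alpha> + single j 1)"
    and H0: "harmonic_system m e n (\<lambda>\<alpha> B. if B = {||} then \<zeta> \<alpha> else 0)"
    by (elim exE conjE)
  let ?c = "\<zeta> (top_exponent m e n) / \<phi> (top_exponent m e n)"
  have *: "jet \<eta> \<gamma> B = ?c * jet (d\<Delta>) \<gamma> B" for \<gamma> B
  proof (cases "\<exists>j<n. B = {|j|}")
    case True
    then obtain j where j: "j < n" "B = {|j|}" by blast
    show ?thesis
    proof (cases "x_deg \<gamma> + 1 = M")
      case True
      then have "M \<le> x_deg (\<gamma> + single j 1)" by (simp add: x_deg_add)
      from top_degree_system[OF H0 this] show ?thesis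
        using j \<zeta>[rule_format, OF j(1), of \<gamma>] by (simp only: jet_ext_deriv_single)
    next
      case False
      have "jet \<eta> \<gamma> B = 0" using deg[of \<gamma> j] False j by auto
      moreover have "\<phi> (\<gamma> + single j 1) = 0"
        using \<phi>_support[of "\<gamma> + single j 1"] False by (auto simp: x_deg_add)
      ultimately show ?thesis using j by (simp add: jet_ext_deriv_single)
    qed
  next
    case False
    have "jet \<eta> \<gamma> B = 0"
    proof (rule ccontr)
      assume nz: "jet \<eta> \<gamma> B \<noteq> 0"
      then have "fcard B = 1" using bihomogeneous_jetD[OF H(2)] by simp
      then obtain j where j: "B = {|j|}" by (rule fcard_1_elim)
      have "fset B \<subseteq> {..<n}" using harmonic_system_support[OF H(1) nz] by simp
      then show False using False j by auto
    qed
    then show ?thesis using False by (simp add: jet_ext_deriv_other)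
  qed
  have "d\<Delta> \<in> carrier (form_ring K n)"
    using ext_deriv_top_harmonic by (simp add: super_harmonics_def)
  then have "lookup (d\<Delta>) l \<in> K" for l
    unfolding carrier_form_ring_iff by (rule spec[OF conjunct1])
  from K H(3) this * show ?thesis by (rule proportional_over_subfield) (rule that)
qed

section \<open>Total degrees\<close>

lemma zero_bideg: "0 \<in> SH i k"
proof -
  have "0 \<in> super_harmonics K n G"
    using subfield_complex_closed(1)[OF K] by (auto simp: super_harmonics_def carrier_form_ring_iff)
  then show ?thesis by (simp add: super_harmonics_bideg_def bihomogeneous_def)
qed

lemma scale_bideg:
  assumes \<eta>: "\<eta> \<in> SH i k" and a: "a \<in> K"
  shows "scale_form a \<eta> \<in> SH i k"
proof -
  note H = bideg_system[OF \<eta>]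
  have S: "\<eta> \<in> super_harmonics K n G" using \<eta> by (simp add: super_harmonics_bideg_def)
  then have car: "\<eta> \<in> carrier (form_ring K n)" by (simp add: super_harmonics_def)
  have "scale_form a \<eta> \<in> carrier (form_ring K n)"
    unfolding carrier_form_ring_iff
  proof (intro conjI allI impI)
    fix l
    show "lookup (scale_form a \<eta>) l \<in> K"
      using subfield_complex_closed(5)[OF K a H(3)] by simp
    assume "lookup (scale_form a \<eta>) l \<noteq> 0"
    then have "lookup \<eta> l \<noteq> 0" by simp
    from conjunct2[OF car[unfolded carrier_form_ring_iff], rule_format, OF this]
    show "keys (fst l) \<subseteq> {..<n}" "fset (snd l) \<subseteq> {..<n}" by (rule conjunct1, rule conjunct2)
  qed
  moreover have "scale_form a (0 :: form) = 0" by (intro poly_mapping_eqI) simp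
  then have "partial_form \<omega> (scale_form a \<eta>) = 0" if "partial_form \<omega> \<eta> = 0" for \<omega>
    using that by (simp only: partial_form_scale_right)
  ultimately have "scale_form a \<eta> \<in> super_harmonics K n G"
    using S by (simp add: super_harmonics_def)
  moreover have "bihomogeneous i k (scale_form a \<eta>)"
  proof (rule bihomogeneous_jetI)
    fix \<gamma> B assume "jet (scale_form a \<eta>) \<gamma> B \<noteq> 0"
    then have "jet \<eta> \<gamma> B \<noteq> 0" by (simp add: jet_scale_form)
    then show "x_deg \<gamma> = i \<and> fcard B = k" by (rule bihomogeneous_jetD[OF H(2)])
  qed
  ultimately show ?thesis by (simp add: super_harmonics_bideg_def)
qed

lemma finite_bidegrees: "finite {(i, k). int i + int k = l}"
  by (rule finite_subset[of _ "{..nat l} \<times> {..nat l}"]) auto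

lemma totalD:
  assumes "\<kappa> \<in> SHT l"
  shows "\<exists>\<eta>. \<kappa> = (\<Sum>(i, k) \<in> {(i, k). int i + int k = l}. \<eta> i k) \<and>
    (\<forall>i k. int i + int k = l \<longrightarrow> \<eta> i k \<in> SH i k)"
  using assms unfolding super_harmonics_total_def by (rule CollectD)

lemma totalI:
  assumes "\<forall>i k. int i + int k = l \<longrightarrow> \<eta> i k \<in> SH i k"
  shows "(\<Sum>(i, k) \<in> {(i, k). int i + int k = l}. \<eta> i k) \<in> SHT l"
  unfolding super_harmonics_total_def mem_Collect_eq by (intro exI[of _ \<eta>] conjI refl assms)

lemma total_eq_zero_iff:
  "SHT l = {0} \<longleftrightarrow>
     (\<forall>i k. int i + int k = l \<longrightarrow> SH i k = {0})"
proof
  assume zero: "SHT l = {0}"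
  show "\<forall>i k. int i + int k = l \<longrightarrow> SH i k = {0}"
  proof (intro allI impI)
    fix i k assume ik: "int i + int k = l"
    have "\<kappa> = 0" if \<kappa>: "\<kappa> \<in> SH i k" for \<kappa>
    proof -
      define \<eta> where "\<eta> i' k' = (if (i', k') = (i, k) then \<kappa> else 0)" for i' k'
      have "(\<Sum>(i', k') \<in> {(i, k). int i + int k = l}. \<eta> i' k')
          = (\<Sum>x \<in> {(i, k). int i + int k = l}. if x = (i, k) then \<kappa> else 0)"
        by (intro sum.cong refl) (simp only: \<eta>_def split_paired_all case_prod_conv)
      also have "\<dots> = \<kappa>" using ik by (simp add: sum.delta[OF finite_bidegrees])
      finally have "(\<Sum>(i', k') \<in> {(i, k). int i + int k = l}. \<eta> i' k') = \<kappa>" .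
      moreover have "(\<Sum>(i', k') \<in> {(i, k). int i + int k = l}. \<eta> i' k') \<in> SHT l"
        using \<kappa> zero_bideg by (intro totalI allI impI) (simp add: \<eta>_def)
      ultimately show ?thesis using zero by simp
    qed
    then show "SH i k = {0}"
      using zero_bideg[of i k] by (intro equalityI subsetI) auto
  qed
next
  assume zero: "\<forall>i k. int i + int k = l \<longrightarrow> SH i k = {0}"
  have "\<kappa> = 0" if \<kappa>: "\<kappa> \<in> SHT l" for \<kappa>
  proof -
    from totalD[OF \<kappa>] obtain \<eta> where \<eta>: "\<kappa> = (\<Sum>(i, k) \<in> {(i, k). int i + int k = l}. \<eta> i k)"
      "\<forall>i k. int i + int k = l \<longrightarrow> \<eta> i k \<in> SH i k"
      by (elim exE conjE)
    have z: "\<eta> i k = 0" if "int i + int k = l" for i k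
      using \<eta>(2)[rule_format, OF that] zero[rule_format, OF that] by simp
    show ?thesis unfolding \<eta>(1)
    proof (intro sum.neutral ballI)
      fix x assume "x \<in> {(i, k). int i + int k = l}"
      then show "(case x of (i, k) \<Rightarrow> \<eta> i k) = 0" by (cases x) (simp add: z)
    qed
  qed
  moreover have "0 \<in> SHT l"
    using totalI[of l "\<lambda>_ _. 0"] zero_bideg by simp
  ultimately show "SHT l = {0}" by (intro equalityI subsetI) auto
qed

lemma total_nonzero_iff: "SHT l \<noteq> {0} \<longleftrightarrow> 0 \<le> l \<and> l \<le> int M"
proof
  assume "SHT l \<noteq> {0}"
  then obtain i k where ik: "int i + int k = l" and nz: "SH i k \<noteq> {0}"
    unfolding total_eq_zero_iff not_all not_imp by (elim exE conjE)
  have "\<not> M < i + k"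
  proof
    assume "M < i + k"
    then have "\<eta> = 0" if "\<eta> \<in> SH i k" for \<eta>
      using bideg_eq_0[OF that] by simp
    then have "SH i k \<subseteq> {0}" by (intro subsetI) (simp only: singleton_iff)
    then have "SH i k = {0}" using zero_bideg[of i k] by (intro equalityI) simp_all
    then show False using nz by (rule notE[rotated])
  qed
  then show "0 \<le> l \<and> l \<le> int M" using ik(1) by linarith
next
  assume l: "0 \<le> l \<and> l \<le> int M"
  then have "nat l \<le> M" by linarith
  then obtain \<eta> where "\<eta> \<in> SH (nat l) 0" "\<eta> \<noteq> 0"
    by (rule nonzero_harmonic_below)
  moreover have "int (nat l) + int 0 = l" using l by simp
  ultimately show "SHT l \<noteq> {0}"
    unfolding total_eq_zero_iff not_all not_imp
    by (intro exI[of _ "nat l"] exI[of _ 0] conjI) (assumption, metis singletonD)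
qed

text \<open>For \<open>M = 0\<close> there is no component of \<open>\<theta>\<close>-degree \<open>1\<close>; this is consistent because then \<open>d\<Delta> = 0\<close>.\<close>

lemma total_top:
  "SHT (int M)
     = {scale_form a (\<Delta>) + scale_form b (d\<Delta>) | a b. a \<in> K \<and> b \<in> K}"
  (is "_ = ?span")
proof (intro equalityI subsetI)
  let ?S = "{(i, k). int i + int k = int M}"
  \<comment> \<open>only \<open>k = 0\<close> and \<open>k = 1\<close> survive in the top degree\<close>
  have split: "(\<Sum>(i, k)\<in>?S. \<eta> i k) = \<eta> M 0 + (if 1 \<le> M then \<eta> (M - 1) 1 else 0)"
    if van: "\<And>i k. i + k = M \<Longrightarrow> 2 \<le> k \<Longrightarrow> \<eta> i k = 0" for \<eta> :: "nat \<Rightarrow> nat \<Rightarrow> form"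
  proof -
    let ?T = "insert (M, 0) (if 1 \<le> M then {(M - 1, 1)} else {})"
    have "(\<Sum>(i, k)\<in>?S. \<eta> i k) = (\<Sum>(i, k)\<in>?T. \<eta> i k)"
    proof (rule sum.mono_neutral_right)
      show "finite ?S" by (rule finite_bidegrees)
      show "?T \<subseteq> ?S" by (auto simp: of_nat_diff)
      show "\<forall>x\<in>?S - ?T. (case x of (i, k) \<Rightarrow> \<eta> i k) = 0"
      proof
        fix x assume x: "x \<in> ?S - ?T"
        obtain i k where ik: "x = (i, k)" by (cases x)
        have s: "i + k = M" using x ik by (auto simp flip: of_nat_add)
        have "k \<noteq> 0" using x ik s by auto
        moreover have "k \<noteq> 1" using x ik s by auto
        ultimately show "(case x of (i, k) \<Rightarrow> \<eta> i k) = 0" using van s ik by simp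
      qed
    qed
    then show ?thesis by auto
  qed
  {
    fix \<kappa> assume "\<kappa> \<in> SHT (int M)"
    from totalD[OF this] obtain \<eta> where \<eta>: "\<kappa> = (\<Sum>(i, k)\<in>?S. \<eta> i k)"
      "\<forall>i k. int i + int k = int M \<longrightarrow> \<eta> i k \<in> SH i k"
      by (elim exE conjE)
    have "\<eta> i k = 0" if ik: "i + k = M" "2 \<le> k" for i k
    proof (rule bideg_eq_0)
      show "\<eta> i k \<in> SH i k" using ik(1) by (intro \<eta>(2)[rule_format]) linarith
      show "M < i + k \<or> M = i + k \<and> 2 \<le> k" using ik by linarith
    qed
    then have \<kappa>: "\<kappa> = \<eta> M 0 + (if 1 \<le> M then \<eta> (M - 1) 1 else 0)" unfolding \<eta>(1) by (rule split)
    have "\<eta> M 0 \<in> SH M 0" by (intro \<eta>(2)[rule_format]) simp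
    then obtain a where a: "a \<in> K" "\<eta> M 0 = scale_form a \<Delta>" by (rule bideg_top_0)
    show "\<kappa> \<in> ?span"
    proof (cases "1 \<le> M")
      case True
      have "\<eta> (M - 1) 1 \<in> SH (M - 1) 1"
        using True by (intro \<eta>(2)[rule_format]) linarith
      moreover have "M - 1 + 1 = M" using True by linarith
      ultimately obtain b where b: "b \<in> K" "\<eta> (M - 1) 1 = scale_form b (d\<Delta>)"
        by (rule bideg_top_1)
      have "\<kappa> = scale_form a \<Delta> + scale_form b (d\<Delta>)"
        unfolding \<kappa> using True by (simp only: a(2) b(2) if_True)
      then show ?thesis unfolding mem_Collect_eq by (intro exI[of _ a] exI[of _ b] conjI a(1) b(1))
    next
      case False
      have "scale_form 0 (d\<Delta>) = 0" by (intro poly_mapping_eqI) simp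
      then have "\<kappa> = scale_form a \<Delta> + scale_form 0 (d\<Delta>)" using a \<kappa> False by simp
      then show ?thesis unfolding mem_Collect_eq
        by (intro exI[of _ a] exI[of _ 0] conjI a(1) subfield_complex_closed(1)[OF K])
    qed
  }
  fix \<kappa> assume "\<kappa> \<in> ?span"
  then obtain a b where ab: "a \<in> K" "b \<in> K" "\<kappa> = scale_form a \<Delta> + scale_form b (d\<Delta>)"
    unfolding mem_Collect_eq by (elim exE conjE)
  define \<eta> where "\<eta> i k = (if k = 0 then scale_form a \<Delta> else if k = 1 then scale_form b (d\<Delta>) else 0)"
    for i k :: nat
  have "\<forall>i k. int i + int k = int M \<longrightarrow> \<eta> i k \<in> SH i k"
  proof (intro allI impI)
    fix i k assume "int i + int k = int M"
    then have s: "i + k = M" by linarith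
    consider (0) "k = 0" "i = M" | (1) "k = 1" "i = M - 1" "1 \<le> M" | (2) "2 \<le> k" using s by linarith
    then show "\<eta> i k \<in> SH i k"
    proof cases
      case 0
      show ?thesis using scale_bideg[OF top_form_bideg ab(1)] by (simp add: \<eta>_def 0)
    next
      case 1
      have "\<eta> i k = scale_form b (d\<Delta>)" by (simp add: \<eta>_def 1)
      then show ?thesis using scale_bideg[OF ext_deriv_top_bideg[OF 1(3)] ab(2)] by (simp only: 1)
    next
      case 2
      then show ?thesis using zero_bideg by (simp add: \<eta>_def)
    qed
  qed
  moreover have "(\<Sum>(i, k)\<in>?S. \<eta> i k) = \<kappa>"
  proof -
    have "d\<Delta> = 0" if M0: "M = 0"
    proof (rule form_eqI)
      have z: "\<phi> (\<gamma> + single i 1) = 0" for \<gamma> i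
        using \<phi>_support[of "\<gamma> + single i 1"] M0 by (auto simp: x_deg_add)
      show "jet (d\<Delta>) \<gamma> B = jet 0 \<gamma> B" for \<gamma> B
        by (simp only: jet_ext_deriv_top_form z if_cancel sum.neutral_const jet_0)
    qed
    then have "scale_form b (d\<Delta>) = 0" if "M = 0"
      using that by (intro poly_mapping_eqI) simp
    moreover have "\<eta> i k = 0" if "2 \<le> k" for i k using that by (simp add: \<eta>_def)
    then have "(\<Sum>(i, k)\<in>?S. \<eta> i k) = \<eta> M 0 + (if 1 \<le> M then \<eta> (M - 1) 1 else 0)" by (rule split)
    moreover have "\<eta> M 0 = scale_form a \<Delta>" "\<eta> (M - 1) 1 = scale_form b (d\<Delta>)"
      by (simp_all add: \<eta>_def)
    ultimately show ?thesis unfolding ab(3) by (cases "M = 0") (simp_all only:, simp_all)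
  qed
  ultimately show "\<kappa> \<in> SHT (int M)"
    using totalI[of "int M" \<eta>] by (simp only:)
qed

end

theorem theorem1p15:
  fixes m p n :: nat and K :: "complex set"
  assumes "1 \<le> m" and "1 \<le> p" and "1 \<le> n" and "p dvd m"
    and "subfield K complex_field"
    and "\<forall>z\<in>K. cnj z \<in> K"
    and "{z. z ^ m = 1} \<subseteq> K"
    and "p \<noteq> m \<or> p = 1"
  shows "(\<forall>l::int. super_harmonics_total K n (monomial_group m p n) l \<noteq> {0} \<longleftrightarrow>
           0 \<le> l \<and> l \<le> int m * int (n choose 2) + int n * (int (m div p) - 1))
       \<and> (\<forall>l::int. l = int m * int (n choose 2) + int n * (int (m div p) - 1) \<longrightarrow>
           super_harmonics_total K n (monomial_group m p n) l =
             {scale_form a (top_form m p n) + scale_form b (ext_deriv n (top_form m p n)) | a b.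
                a \<in> K \<and> b \<in> K})"
proof -
  interpret monomial_group_setting m p n K
    by (intro monomial_group_setting.intro assms)
  have M: "int m * int (n choose 2) + int n * (int (m div p) - 1) = int M"
    using e(1) by (simp add: top_degree_eq sum_lessThan_eq_choose of_nat_diff)
  show ?thesis unfolding M by (intro conjI allI impI total_nonzero_iff) (simp only: total_top)
qed

end
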